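(* Let $\varphi\colon\mathbb D\to\mathbb D$ be analytic and let $H=H^2(\beta)$ be an admissible Hilbert space on which the composition operator $C_\varphi f=f\circ\varphi$ is bounded. Then: 1) $\mathcal M(H^2,\varphi)\subseteq\mathcal M(H,\varphi)$; 2) $\mathcal M(H,\varphi)=H$ if and only if $\|\varphi\|_\infty<1$; 3) $\mathcal M(H,\varphi)=H^\infty$ if and only if $\varphi$ is a finite Blaschke product.
   Context: $\mathbb D$ is the open unit disk of $\mathbb C$. $H^\infty$ is the space of bounded analytic functions on $\mathbb D$ and $\|\varphi\|_\infty=\sup_{\mathbb D}|\varphi|$. For a sequence $\beta=(\beta_k)_{k\ge0}$ of positive numbers with $\liminf_{k\to\infty}\beta_k^{1/k}\ge1$, $H^2(\beta)$ is the Hilbert space of analytic functions $f(z)=\sum_{k\ge0}c_kz^k$ on $\mathbb D$ with $\|f\|^2=\sum_{k\ge0}\beta_k|c_k|^2<\infty$; point evaluations are bounded on it. $H^2$ is the Hardy space (all $\beta_k=1$). For a Hilbert space $H$ of analytic functions on $\mathbb D$ with bounded point evaluations, $K_a\in H$ ($a\in\mathbb D$) denotes its reproducing kernel: $f(a)=\langle f,K_a\rangle$ for all $f\in H$. The set of multipliers is $\mathcal M(H)=\{w\in H : wf\in H \text{ for all } f\in H\}$, and the set of multipliers conditionally to $\varphi$ is $\mathcal M(H,\varphi)=\{w\in H : w\,(f\circ\varphi)\in H\text{ for all }f\in H\}$. A Hilbert space $H$ of analytic functions on $\mathbb D$, containing the constants and with reproducing kernels $K_a$, is called admissible if: (i)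 $H^2$ is continuously embedded in $H$; (ii) $\mathcal M(H)=H^\infty$; (iii) the automorphisms of $\mathbb D$ induce bounded composition operators on $H$; (iv) there is a non-decreasing function $h\colon\mathbb R^+\to\mathbb R^+$ such that $\frac{\|K_a\|_H}{\|K_b\|_H}\le h\Big(\frac{1-|b|}{1-|a|}\Big)$ for all $a,b\in\mathbb D$ close to $\partial\mathbb D$ (i.e. for all $a,b$ with $r_0\le|a|,|b|<1$, for some $r_0<1$). *)

theory Defs
  imports "HOL-Complex_Analysis.Complex_Analysis"
begin

text \<open>
  Functions on the open unit disc are represented by total functions on the complex plane of which
  only the values on the disc matter. Every function space below is closed under changing
  a function outside the disc, so that equality and inclusion of such sets of functions mean
  equality and inclusion of the corresponding sets of functions on the disc.
\<close>

abbreviation unit_disc :: "complex set" where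
  "unit_disc \<equiv> ball 0 1"

definition inner_norm ::
    "((complex \<Rightarrow> complex) \<Rightarrow> (complex \<Rightarrow> complex) \<Rightarrow> complex) \<Rightarrow> (complex \<Rightarrow> complex) \<Rightarrow> real" where
  "inner_norm ip f = sqrt (Re (ip f f))"

text \<open>
  A Hilbert space of analytic functions on the disc with bounded point evaluations, given by its set
  of functions and its inner product (linear in the first argument). The inner product is definite
  up to equality on the disc.
\<close>

locale analytic_hilbert_space =
  fixes H :: "(complex \<Rightarrow> complex) set"
    and ip :: "(complex \<Rightarrow> complex) \<Rightarrow> (complex \<Rightarrow> complex) \<Rightarrow> complex"
  assumes holomorphic: "f \<in> H \<Longrightarrow> f holomorphic_on unit_disc"
    and cong: "f \<in> H \<Longrightarrow> (\<And>z. z \<in> unit_disc \<Longrightarrow> g z = f z) \<Longrightarrow> g \<in> H"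
    and zero_mem: "(\<lambda>_. 0) \<in> H"
    and add_mem: "f \<in> H \<Longrightarrow> g \<in> H \<Longrightarrow> (\<lambda>z. f z + g z) \<in> H"
    and scale_mem: "f \<in> H \<Longrightarrow> (\<lambda>z. c * f z) \<in> H"
    and ip_add: "f \<in> H \<Longrightarrow> g \<in> H \<Longrightarrow> k \<in> H \<Longrightarrow> ip (\<lambda>z. f z + g z) k = ip f k + ip g k"
    and ip_scale: "f \<in> H \<Longrightarrow> k \<in> H \<Longrightarrow> ip (\<lambda>z. c * f z) k = c * ip f k"
    and ip_cnj: "f \<in> H \<Longrightarrow> g \<in> H \<Longrightarrow> ip g f = cnj (ip f g)"
    and ip_nonneg: "f \<in> H \<Longrightarrow> 0 \<le> Re (ip f f)"
    and ip_definite: "f \<in> H \<Longrightarrow> ip f f = 0 \<longleftrightarrow> (\<forall>z\<in>unit_disc. f z = 0)"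
    and complete: "\<lbrakk>\<And>n::nat. F n \<in> H;
           \<forall>e>0. \<exists>N. \<forall>m\<ge>N. \<forall>n\<ge>N. inner_norm ip (\<lambda>z. F m z - F n z) < e\<rbrakk>
         \<Longrightarrow> \<exists>f\<in>H. (\<lambda>n. inner_norm ip (\<lambda>z. F n z - f z)) \<longlonglongrightarrow> 0"
    and bounded_evaluation: "a \<in> unit_disc \<Longrightarrow> \<exists>C. \<forall>f\<in>H. cmod (f a) \<le> C * inner_norm ip f"

text \<open>In an \<open>analytic_hilbert_space\<close> the kernel exists, and is unique up to equality on the disc.\<close>

definition repr_kernel ::
    "(complex \<Rightarrow> complex) set \<Rightarrow> ((complex \<Rightarrow> complex) \<Rightarrow> (complex \<Rightarrow> complex) \<Rightarrow> complex)
      \<Rightarrow> complex \<Rightarrow> complex \<Rightarrow> complex" where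
  "repr_kernel H ip a = (SOME k. k \<in> H \<and> (\<forall>f\<in>H. f a = ip f k))"

definition H_infinity :: "(complex \<Rightarrow> complex) set" where
  "H_infinity = {f. f holomorphic_on unit_disc \<and> bounded (f ` unit_disc)}"

definition sup_norm :: "(complex \<Rightarrow> complex) \<Rightarrow> real" where
  "sup_norm f = (SUP z\<in>unit_disc. cmod (f z))"

definition multipliers :: "(complex \<Rightarrow> complex) set \<Rightarrow> (complex \<Rightarrow> complex) set" where
  "multipliers H = {w \<in> H. \<forall>f\<in>H. (\<lambda>z. w z * f z) \<in> H}"

definition cond_multipliers ::
    "(complex \<Rightarrow> complex) set \<Rightarrow> (complex \<Rightarrow> complex) \<Rightarrow> (complex \<Rightarrow> complex) set" where
  "cond_multipliers H \<phi> = {w \<in> H. \<forall>f\<in>H. (\<lambda>z. w z * f (\<phi> z)) \<in> H}"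

definition bounded_composition_operator ::
    "(complex \<Rightarrow> complex) set \<Rightarrow> ((complex \<Rightarrow> complex) \<Rightarrow> (complex \<Rightarrow> complex) \<Rightarrow> complex)
      \<Rightarrow> (complex \<Rightarrow> complex) \<Rightarrow> bool" where
  "bounded_composition_operator H ip \<phi> \<longleftrightarrow>
     (\<forall>f\<in>H. f \<circ> \<phi> \<in> H) \<and>
     (\<exists>C. \<forall>f\<in>H. inner_norm ip (f \<circ> \<phi>) \<le> C * inner_norm ip f)"

definition taylor_coeff :: "(complex \<Rightarrow> complex) \<Rightarrow> nat \<Rightarrow> complex" where
  "taylor_coeff f k = (deriv ^^ k) f 0 / fact k"

definition H2 :: "(nat \<Rightarrow> real) \<Rightarrow> (complex \<Rightarrow> complex) set" where
  "H2 \<beta> = {f. f holomorphic_on unit_disc \<and> summable (\<lambda>k. \<beta> k * (cmod (taylor_coeff f k))\<^sup>2)}"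

definition H2_inner ::
    "(nat \<Rightarrow> real) \<Rightarrow> (complex \<Rightarrow> complex) \<Rightarrow> (complex \<Rightarrow> complex) \<Rightarrow> complex" where
  "H2_inner \<beta> f g = (\<Sum>k. of_real (\<beta> k) * taylor_coeff f k * cnj (taylor_coeff g k))"

abbreviation hardy :: "(complex \<Rightarrow> complex) set" where
  "hardy \<equiv> H2 (\<lambda>_. 1)"

abbreviation hardy_inner :: "(complex \<Rightarrow> complex) \<Rightarrow> (complex \<Rightarrow> complex) \<Rightarrow> complex" where
  "hardy_inner \<equiv> H2_inner (\<lambda>_. 1)"

definition disc_automorphism :: "(complex \<Rightarrow> complex) \<Rightarrow> bool" where
  "disc_automorphism \<tau> \<longleftrightarrow>
     \<tau> holomorphic_on unit_disc \<and> \<tau> ` unit_disc \<subseteq> unit_disc \<and>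
     (\<exists>\<sigma>. \<sigma> holomorphic_on unit_disc \<and> \<sigma> ` unit_disc \<subseteq> unit_disc \<and>
        (\<forall>z\<in>unit_disc. \<sigma> (\<tau> z) = z \<and> \<tau> (\<sigma> z) = z))"

definition admissible ::
    "(complex \<Rightarrow> complex) set \<Rightarrow> ((complex \<Rightarrow> complex) \<Rightarrow> (complex \<Rightarrow> complex) \<Rightarrow> complex) \<Rightarrow> bool" where
  "admissible H ip \<longleftrightarrow>
     analytic_hilbert_space H ip \<and>
     (\<forall>c. (\<lambda>_. c) \<in> H) \<and>
     (hardy \<subseteq> H \<and> (\<exists>C. \<forall>f\<in>hardy. inner_norm ip f \<le> C * inner_norm hardy_inner f)) \<and>
     multipliers H = H_infinity \<and>
     (\<forall>\<tau>. disc_automorphism \<tau> \<longrightarrow> bounded_composition_operator H ip \<tau>) \<and>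
     (\<exists>h :: real \<Rightarrow> real. mono_on {0<..} h \<and> (\<forall>x>0. h x > 0) \<and>
        (\<exists>r<1. \<forall>a b. r \<le> cmod a \<and> cmod a < 1 \<and> r \<le> cmod b \<and> cmod b < 1 \<longrightarrow>
           inner_norm ip (repr_kernel H ip a) / inner_norm ip (repr_kernel H ip b)
             \<le> h ((1 - cmod b) / (1 - cmod a))))"

text \<open>
  The empty product is allowed; it gives a unimodular constant, which is not a self-map of the
  open disc.
\<close>

definition finite_blaschke_product :: "(complex \<Rightarrow> complex) \<Rightarrow> bool" where
  "finite_blaschke_product \<phi> \<longleftrightarrow>
     (\<exists>c as. cmod c = 1 \<and> set as \<subseteq> unit_disc \<and>
        (\<forall>z\<in>unit_disc. \<phi> z = c * (\<Prod>a\<leftarrow>as. (z - a) / (1 - cnj a * z))))"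

end

theory Submission
  imports Defs
begin

text \<open>
  Admissibility forces \<open>\<beta> (n + k) \<le> C * \<beta> k\<close>, so \<open>\<beta>\<close> is equivalent to a decreasing weight. After
  composing with an automorphism one may assume \<open>\<phi> 0 = 0\<close>; then \<open>f \<mapsto> w \<cdot> (f \<circ> \<phi>)\<close> has a lower
  triangular matrix, and its boundedness on the Hardy space passes to decreasing weights by Abel
  summation. This is 1).

  For 2), if all of \<open>H\<close> consists of conditional multipliers, every \<open>f \<circ> \<phi>\<close> is a multiplier, hence
  bounded; by uniform boundedness the norms of the kernels at the points \<open>\<phi> z\<close> are bounded.

  For 3), a conditional multiplier satisfies \<open>\<bar>w a\<bar> \<le> C * \<parallel>K a\<parallel> / \<parallel>K (\<phi> a)\<parallel>\<close>, which is bounded when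
  \<open>1 - \<bar>\<phi> a\<bar>\<close> is comparable to \<open>1 - \<bar>a\<bar>\<close>. If \<open>\<phi>\<close> is not a finite Blaschke product, there are
  points \<open>a\<close> tending to the circle with \<open>\<bar>\<phi> a\<bar> \<le> r < 1\<close>. For \<open>g z = (1 - \<bar>a\<bar>\<^sup>2) / (1 - cnj a * z)\<close> the
  operator \<open>f \<mapsto> g \<cdot> (f \<circ> \<phi>)\<close> has small norm on the Hardy space although \<open>g a = 1\<close>, and a
  lacunary sum of such \<open>g\<close> is an unbounded conditional multiplier.
\<close>

section \<open>Uniform boundedness on weighted sequence spaces\<close>

text \<open>Being a conditional multiplier is a set-theoretic condition and carries no estimate.
  Estimates come from uniform boundedness of an indexed family: truncated norms of the image on the
  Hardy space for 1), evaluations at the points \<open>\<phi> z\<close> for 2) and 3). Only weighted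
  sequence spaces are involved, so the principle is proved for \<open>l2 \<beta>\<close> alone.
  Limits are taken coefficientwise under a bound on the norms, which replaces both boundary values
  and convergence in norm. The function \<open>g\<close> is the Szego kernel at \<open>a\<close>
  scaled to take the value 1 there. Its Hardy norm is the square root of
  \<open>1 - \<bar>a\<bar>\<^sup>2\<close>, and composition with \<phi> costs only a factor
  depending on |\<phi> a|; this is why points with |\<phi> a| at most \<open>r\<close> are wanted.
  If \<open>1 - \<bar>a\<bar>\<^sup>2\<close> is at most 64^-n, the operator given by 4^n * g has
  norm of order 2^-n while the height at \<open>a\<close> is 4^n.\<close>

definition l2 :: "(nat \<Rightarrow> real) \<Rightarrow> (nat \<Rightarrow> complex) set" where
  "l2 \<beta> = {c. summable (\<lambda>k. \<beta> k * (cmod (c k))\<^sup>2)}"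

definition l2_norm :: "(nat \<Rightarrow> real) \<Rightarrow> (nat \<Rightarrow> complex) \<Rightarrow> real" where
  "l2_norm \<beta> c = sqrt (\<Sum>k. \<beta> k * (cmod (c k))\<^sup>2)"

locale positive_weight =
  fixes \<beta> :: "nat \<Rightarrow> real"
  assumes pos: "\<beta> k > 0"
begin

lemma term_nonneg [simp]: "0 \<le> \<beta> k * (cmod x)\<^sup>2"
  using pos[of k] by simp

lemma l2_norm_nonneg: "c \<in> l2 \<beta> \<Longrightarrow> 0 \<le> l2_norm \<beta> c"
  by (simp add: l2_def l2_norm_def suminf_nonneg)

lemma partial_le_l2_norm: "c \<in> l2 \<beta> \<Longrightarrow> (\<Sum>k<n. \<beta> k * (cmod (c k))\<^sup>2) \<le> (l2_norm \<beta> c)\<^sup>2"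
  by (simp add: l2_def l2_norm_def suminf_nonneg sum_le_suminf)

lemma l2_normI:
  assumes "0 \<le> B" "\<And>n. (\<Sum>k<n. \<beta> k * (cmod (c k))\<^sup>2) \<le> B\<^sup>2"
  shows "c \<in> l2 \<beta>" "l2_norm \<beta> c \<le> B"
proof -
  show *: "c \<in> l2 \<beta>"
    unfolding l2_def using summableI_nonneg_bounded[of "\<lambda>k. \<beta> k * (cmod (c k))\<^sup>2" "B\<^sup>2"] assms by simp
  have "(\<Sum>k. \<beta> k * (cmod (c k))\<^sup>2) \<le> B\<^sup>2"
    using * assms by (intro suminf_le_const) (auto simp: l2_def)
  then show "l2_norm \<beta> c \<le> B"
    unfolding l2_norm_def using assms(1) real_le_lsqrt by blast
qed

text \<open>Lower semicontinuity of the norm: a partial sum sees finitely many coordinates, so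
  coordinatewise convergence passes the bound to the limit. Completeness and
  \<open>hardy_fatou\<close> both rest on it.\<close>

lemma l2_norm_fatou:
  assumes "0 \<le> B" "\<And>k. (\<lambda>m. y m k) \<longlonglongrightarrow> x k"
    and "\<And>m. m \<ge> M \<Longrightarrow> y m \<in> l2 \<beta> \<and> l2_norm \<beta> (y m) \<le> B"
  shows "x \<in> l2 \<beta>" "l2_norm \<beta> x \<le> B"
proof -
  have "(\<Sum>k<n. \<beta> k * (cmod (x k))\<^sup>2) \<le> B\<^sup>2" for n
  proof (rule LIMSEQ_le_const2)
    show "(\<lambda>m. \<Sum>k<n. \<beta> k * (cmod (y m k))\<^sup>2) \<longlonglongrightarrow> (\<Sum>k<n. \<beta> k * (cmod (x k))\<^sup>2)"
      by (intro tendsto_intros assms)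
    have "(\<Sum>k<n. \<beta> k * (cmod (y m k))\<^sup>2) \<le> B\<^sup>2" if "m \<ge> M" for m
      using partial_le_l2_norm[of "y m" n] assms(3)[OF that] l2_norm_nonneg[of "y m"]
      by (meson order_trans power_mono)
    then show "\<exists>N. \<forall>m\<ge>N. (\<Sum>k<n. \<beta> k * (cmod (y m k))\<^sup>2) \<le> B\<^sup>2" by blast
  qed
  then show "x \<in> l2 \<beta>" "l2_norm \<beta> x \<le> B" using l2_normI assms(1) by blast+
qed

lemma L2_set_le_l2_norm:
  assumes "c \<in> l2 \<beta>" shows "L2_set (\<lambda>k. sqrt (\<beta> k) * cmod (c k)) {..<n} \<le> l2_norm \<beta> c"
  unfolding L2_set_def using partial_le_l2_norm[OF assms, of n] l2_norm_nonneg[OF assms] pos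
  by (intro real_le_lsqrt) (simp_all add: power_mult_distrib less_imp_le sum_nonneg)

lemma l2_add:
  assumes "x \<in> l2 \<beta>" "y \<in> l2 \<beta>"
  shows "(\<lambda>k. x k + y k) \<in> l2 \<beta>" "l2_norm \<beta> (\<lambda>k. x k + y k) \<le> l2_norm \<beta> x + l2_norm \<beta> y"
proof -
  let ?B = "l2_norm \<beta> x + l2_norm \<beta> y"
  have B: "0 \<le> ?B" using assms l2_norm_nonneg by force
  have "(\<Sum>k<n. \<beta> k * (cmod (x k + y k))\<^sup>2) \<le> ?B\<^sup>2" for n
  proof -
    have "(\<Sum>k<n. \<beta> k * (cmod (x k + y k))\<^sup>2)
        \<le> (L2_set (\<lambda>k. sqrt (\<beta> k) * cmod (x k) + sqrt (\<beta> k) * cmod (y k)) {..<n})\<^sup>2"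
      unfolding L2_set_def
    proof (subst real_sqrt_pow2)
      show "(\<Sum>k<n. \<beta> k * (cmod (x k + y k))\<^sup>2)
          \<le> (\<Sum>k<n. (sqrt (\<beta> k) * cmod (x k) + sqrt (\<beta> k) * cmod (y k))\<^sup>2)"
      proof (rule sum_mono)
        fix k
        have "\<beta> k * (cmod (x k + y k))\<^sup>2 = (sqrt (\<beta> k) * cmod (x k + y k))\<^sup>2"
          using pos[of k] by (simp add: power_mult_distrib)
        also have "\<dots> \<le> (sqrt (\<beta> k) * cmod (x k) + sqrt (\<beta> k) * cmod (y k))\<^sup>2"
          using pos[of k] norm_triangle_ineq[of "x k" "y k"]
          by (intro power_mono) (simp_all flip: distrib_left)
        finally show "\<beta> k * (cmod (x k + y k))\<^sup>2
            \<le> (sqrt (\<beta> k) * cmod (x k) + sqrt (\<beta> k) * cmod (y k))\<^sup>2" .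
      qed
    qed (simp add: sum_nonneg)
    also have "\<dots> \<le> ?B\<^sup>2"
      using L2_set_triangle_ineq[of "\<lambda>k. sqrt (\<beta> k) * cmod (x k)" "\<lambda>k. sqrt (\<beta> k) * cmod (y k)" "{..<n}"]
        L2_set_le_l2_norm[OF assms(1), of n] L2_set_le_l2_norm[OF assms(2), of n]
      by (intro power_mono) auto
    finally show ?thesis .
  qed
  from l2_normI[OF B this]
  show "(\<lambda>k. x k + y k) \<in> l2 \<beta>" "l2_norm \<beta> (\<lambda>k. x k + y k) \<le> ?B" by auto
qed

lemma l2_scale:
  assumes "x \<in> l2 \<beta>"
  shows "(\<lambda>k. s * x k) \<in> l2 \<beta>" "l2_norm \<beta> (\<lambda>k. s * x k) = cmod s * l2_norm \<beta> x"
proof -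
  have *: "\<beta> k * (cmod (s * x k))\<^sup>2 = (cmod s)\<^sup>2 * (\<beta> k * (cmod (x k))\<^sup>2)" for k
    by (simp add: norm_mult power_mult_distrib)
  show "(\<lambda>k. s * x k) \<in> l2 \<beta>"
    using assms unfolding l2_def mem_Collect_eq * by (intro summable_mult)
  show "l2_norm \<beta> (\<lambda>k. s * x k) = cmod s * l2_norm \<beta> x"
    unfolding l2_norm_def * using assms by (simp add: l2_def suminf_mult real_sqrt_mult)
qed

lemma l2_zero: "(\<lambda>k. 0) \<in> l2 \<beta>" "l2_norm \<beta> (\<lambda>k. 0) = 0"
  by (auto simp: l2_def l2_norm_def)

lemma cmod_le_l2_norm:
  assumes "x \<in> l2 \<beta>" shows "sqrt (\<beta> k) * cmod (x k) \<le> l2_norm \<beta> x"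
proof -
  have "sqrt (\<beta> k) * cmod (x k) \<le> L2_set (\<lambda>k. sqrt (\<beta> k) * cmod (x k)) {..<Suc k}"
    using member_le_L2_set[of "{..<Suc k}" k "\<lambda>k. sqrt (\<beta> k) * cmod (x k)"] by simp
  with L2_set_le_l2_norm[OF assms, of "Suc k"] show ?thesis by linarith
qed

text \<open>Only the geometric rate produced by the steps in \<open>uniform_boundedness\<close> is
  needed; the constant 3/2 is the sum of all powers of 1/3.\<close>

lemma l2_complete:
  assumes mem: "\<And>n. x n \<in> l2 \<beta>"
    and step: "\<And>n. l2_norm \<beta> (\<lambda>k. x (Suc n) k - x n k) \<le> (1/3) ^ n"
  obtains y where "y \<in> l2 \<beta>" "\<And>n. l2_norm \<beta> (\<lambda>k. y k - x n k) \<le> 3/2 * (1/3) ^ n"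
proof -
  have diff: "(\<lambda>k. u k - v k) \<in> l2 \<beta>" if "u \<in> l2 \<beta>" "v \<in> l2 \<beta>" for u v
    using l2_add(1)[OF that(1) l2_scale(1)[OF that(2), of "-1"]] by simp
  have dist: "l2_norm \<beta> (\<lambda>k. x (n + m) k - x n k) \<le> 3/2 * ((1/3) ^ n - (1/3) ^ (n + m))" for n m
  proof (induction m)
    case 0 then show ?case by (simp add: l2_zero)
  next
    case (Suc m)
    have "l2_norm \<beta> (\<lambda>k. x (n + Suc m) k - x n k)
       = l2_norm \<beta> (\<lambda>k. (x (Suc (n + m)) k - x (n + m) k) + (x (n + m) k - x n k))" by simp
    also have "\<dots> \<le> l2_norm \<beta> (\<lambda>k. x (Suc (n + m)) k - x (n + m) k) + l2_norm \<beta> (\<lambda>k. x (n + m) k - x n k)"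
      by (intro l2_add diff mem)
    also have "\<dots> \<le> (1/3) ^ (n + m) + 3/2 * ((1/3) ^ n - (1/3) ^ (n + m))"
      using Suc step[of "n + m"] by linarith
    also have "\<dots> = 3/2 * ((1/3) ^ n - (1/3) ^ (n + Suc m))" by (simp add: algebra_simps)
    finally show ?case .
  qed
  have le: "l2_norm \<beta> (\<lambda>k. x (n + m) k - x n k) \<le> 3/2 * (1/3) ^ n" for n m
  proof -
    have "3/2 * (a - b) \<le> 3/2 * a" if "0 \<le> b" for a b :: real using that by simp
    from order_trans[OF dist this] show ?thesis by simp
  qed
  have "\<exists>l. (\<lambda>n. x n k) \<longlonglongrightarrow> l" for k
  proof -
    have *: "cmod (x (n + m) k - x n k) \<le> 3/2 / sqrt (\<beta> k) * (1/3) ^ n" for n m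
      using order_trans[OF cmod_le_l2_norm[OF diff[OF mem[of "n+m"] mem[of n]], of k] le[of n m]] pos[of k]
      by (simp add: field_simps)
    have "summable (\<lambda>n. x (Suc n) k - x n k)"
    proof (rule summable_comparison_test')
      show "summable (\<lambda>n. 3/2 / sqrt (\<beta> k) * (1/3) ^ n)"
        by (intro summable_mult summable_geometric) simp
      show "norm (x (Suc n) k - x n k) \<le> 3/2 / sqrt (\<beta> k) * (1/3) ^ n" for n
        using *[of n 1] by simp
    qed
    then have "convergent (\<lambda>n. \<Sum>i<n. x (Suc i) k - x i k)"
      by (simp add: summable_iff_convergent)
    then obtain l where "(\<lambda>n. x n k - x 0 k) \<longlonglongrightarrow> l"
      unfolding convergent_def by (subst (asm) sum_lessThan_telescope) blast
    then have "(\<lambda>n. x n k - x 0 k + x 0 k) \<longlonglongrightarrow> l + x 0 k"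
      by (intro tendsto_intros)
    then show ?thesis by auto
  qed
  then obtain y where y: "\<And>k. (\<lambda>n. x n k) \<longlonglongrightarrow> y k" by metis
  have *: "(\<lambda>k. y k - x n k) \<in> l2 \<beta>" "l2_norm \<beta> (\<lambda>k. y k - x n k) \<le> 3/2 * (1/3) ^ n" for n
  proof -
    have A: "(\<lambda>m. x m k - x n k) \<longlonglongrightarrow> y k - x n k" for k
      by (intro tendsto_intros y)
    have B: "m \<ge> n \<Longrightarrow> (\<lambda>k. x m k - x n k) \<in> l2 \<beta> \<and> l2_norm \<beta> (\<lambda>k. x m k - x n k) \<le> 3/2 * (1/3) ^ n" for m
      using le[of n "m - n"] diff[OF mem mem] by simp
    show "(\<lambda>k. y k - x n k) \<in> l2 \<beta>" "l2_norm \<beta> (\<lambda>k. y k - x n k) \<le> 3/2 * (1/3) ^ n"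
      using l2_norm_fatou[where y="\<lambda>m k. x m k - x n k" and M=n, OF _ A B] by auto
  qed
  have "y \<in> l2 \<beta>" using l2_add(1)[OF *(1)[of 0] mem[of 0]] by simp
  with * show thesis using that by blast
qed

text \<open>\<open>M\<close> is the infimum of all valid constants, so \<open>2/3 * M\<close> is not
  valid and some unit vector exceeds it. The factor 2/3 has to beat the 1/2 that measures the
  remaining steps in \<open>uniform_boundedness\<close>.\<close>

lemma almost_norming:
  assumes bdd: "\<exists>C. \<forall>x\<in>l2 \<beta>. q x \<le> C * l2_norm \<beta> x"
    and scale: "\<And>s x. x \<in> l2 \<beta> \<Longrightarrow> q (\<lambda>k. s * x k) = cmod s * q x"
    and "0 \<le> D" and large: "\<not> (\<forall>x\<in>l2 \<beta>. q x \<le> D * l2_norm \<beta> x)"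
  obtains M u where "M > D" "u \<in> l2 \<beta>" "l2_norm \<beta> u = 1" "q u > 2/3 * M"
    "\<And>x. x \<in> l2 \<beta> \<Longrightarrow> q x \<le> M * l2_norm \<beta> x"
proof -
  define S where "S = {C. \<forall>x\<in>l2 \<beta>. q x \<le> C * l2_norm \<beta> x}"
  define M where "M = Inf S"
  have low: "C > D" if "C \<in> S" for C
  proof (rule ccontr)
    assume "\<not> C > D"
    then have "q x \<le> D * l2_norm \<beta> x" if "x \<in> l2 \<beta>" for x
      using \<open>C \<in> S\<close> that mult_right_mono[of C D "l2_norm \<beta> x"] l2_norm_nonneg[OF that]
      unfolding S_def by force
    with large show False by blast
  qed
  have ne: "S \<noteq> {}" using bdd unfolding S_def by auto
  have bb: "bdd_below S" using low by (meson bdd_belowI less_imp_le)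
  have M: "q x \<le> M * l2_norm \<beta> x" if x: "x \<in> l2 \<beta>" for x
  proof (cases "l2_norm \<beta> x = 0")
    case True
    then show ?thesis using ne x unfolding S_def by auto
  next
    case False
    then have "l2_norm \<beta> x > 0" using l2_norm_nonneg[OF x] by linarith
    then have "q x / l2_norm \<beta> x \<le> M"
      unfolding M_def using x by (intro cInf_greatest[OF ne]) (auto simp: S_def field_simps)
    with \<open>l2_norm \<beta> x > 0\<close> show ?thesis by (simp add: field_simps)
  qed
  then have MD: "M > D" using low unfolding S_def by auto
  have "2/3 * M < M" using MD assms(3) by simp
  then have "2/3 * M \<notin> S" using cInf_lower[OF _ bb] unfolding M_def by (meson linorder_not_less)
  then obtain v where v: "v \<in> l2 \<beta>" "q v > 2/3 * M * l2_norm \<beta> v" unfolding S_def by force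
  have "l2_norm \<beta> v > 0"
    using v M[OF v(1)] l2_norm_nonneg[OF v(1)] by (cases "l2_norm \<beta> v = 0") auto
  then show thesis
    using v MD M
    by (intro that[of M "\<lambda>k. complex_of_real (1 / l2_norm \<beta> v) * v k"])
       (simp_all only: l2_scale scale, simp_all add: field_simps norm_divide)
qed

text \<open>Sokal's proof: a sequence of steps of length \<open>3\<^sup>-\<^sup>n\<close>, the sign of each chosen so that the
  \<open>n\<close>-th seminorm does not decrease too much.\<close>

theorem uniform_boundedness:
  fixes p :: "'i \<Rightarrow> (nat \<Rightarrow> complex) \<Rightarrow> real"
  assumes add: "\<And>i x y. x \<in> l2 \<beta> \<Longrightarrow> y \<in> l2 \<beta> \<Longrightarrow> p i (\<lambda>k. x k + y k) \<le> p i x + p i y"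
    and scale: "\<And>i s x. x \<in> l2 \<beta> \<Longrightarrow> p i (\<lambda>k. s * x k) = cmod s * p i x"
    and cont: "\<And>i. \<exists>C. \<forall>x\<in>l2 \<beta>. p i x \<le> C * l2_norm \<beta> x"
    and ptw: "\<And>x. x \<in> l2 \<beta> \<Longrightarrow> \<exists>B. \<forall>i. p i x \<le> B"
  shows "\<exists>C\<ge>0. \<forall>i. \<forall>x\<in>l2 \<beta>. p i x \<le> C * l2_norm \<beta> x"
proof (rule ccontr)
  assume "\<not> ?thesis"
  then have "\<exists>i. \<not> (\<forall>x\<in>l2 \<beta>. p i x \<le> 4 ^ n * l2_norm \<beta> x)" for n :: nat
    by (meson zero_le_numeral zero_le_power)
  then obtain I where I: "\<And>n::nat. \<not> (\<forall>x\<in>l2 \<beta>. p (I n) x \<le> 4 ^ n * l2_norm \<beta> x)" by metis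
  have "\<exists>M u. M > 4 ^ n \<and> u \<in> l2 \<beta> \<and> l2_norm \<beta> u = 1 \<and> p (I n) u > 2/3 * M \<and>
      (\<forall>x\<in>l2 \<beta>. p (I n) x \<le> M * l2_norm \<beta> x)" for n
    using almost_norming[OF cont scale _ I[of n]] by (metis zero_le_numeral zero_le_power)
  then obtain M u where M: "\<And>n. M n > 4 ^ n" and u: "\<And>n. u n \<in> l2 \<beta>" "\<And>n. l2_norm \<beta> (u n) = 1"
    and pu: "\<And>n. p (I n) (u n) > 2/3 * M n"
    and pM: "\<And>n x. x \<in> l2 \<beta> \<Longrightarrow> p (I n) x \<le> M n * l2_norm \<beta> x" by metis
  define st where "st n x s = (\<lambda>k. x k + s * u n k)" for n s and x :: "nat \<Rightarrow> complex"
  have step: "\<exists>s. cmod s = (1/3) ^ n \<and> p (I n) (st n x s) \<ge> (1/3) ^ n * p (I n) (u n)"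
    if x: "x \<in> l2 \<beta>" for n x
  proof -
    let ?s = "(1/3) ^ n :: complex"
    have cm: "cmod ?s = (1/3) ^ n" by (simp add: norm_power norm_divide)
    have mem: "st n x s \<in> l2 \<beta>" for s unfolding st_def by (intro l2_add l2_scale x u)
    \<comment> \<open>The two candidates differ by twice the step, so by the triangle inequality one
      of them has at least the seminorm of the step itself, whatever \<open>x\<close> is.\<close>
    have "2 * ((1/3) ^ n * p (I n) (u n)) = p (I n) (\<lambda>k. (2 * ?s) * u n k)"
      unfolding scale[OF u(1)] by (simp add: norm_mult cm)
    also have "(\<lambda>k. (2 * ?s) * u n k) = (\<lambda>k. st n x ?s k + (-1) * st n x (-?s) k)"
      by (auto simp: st_def algebra_simps)
    also have "p (I n) \<dots> \<le> p (I n) (st n x ?s) + p (I n) (\<lambda>k. (-1) * st n x (-?s) k)"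
      by (intro add l2_scale mem)
    also have "p (I n) (\<lambda>k. (-1) * st n x (-?s) k) = p (I n) (st n x (-?s))"
      by (subst scale[OF mem]) simp
    finally have "p (I n) (st n x ?s) \<ge> (1/3) ^ n * p (I n) (u n) \<or>
        p (I n) (st n x (-?s)) \<ge> (1/3) ^ n * p (I n) (u n)" by linarith
    with cm show ?thesis by (metis norm_minus_cancel)
  qed
  define P where "P = (\<lambda>(n::nat) (x::nat \<Rightarrow> complex). x \<in> l2 \<beta>)"
  define Q where "Q = (\<lambda>n x y. (\<exists>s. cmod s = (1/3) ^ n \<and> y = st n x s) \<and>
      p (I n) y \<ge> (1/3) ^ n * p (I n) (u n))"
  have mem: "st n x s \<in> l2 \<beta>" if "x \<in> l2 \<beta>" for n x s
    unfolding st_def by (intro l2_add l2_scale that u)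
  have ex: "\<exists>x. P 0 x" using l2_zero unfolding P_def by blast
  have sx: "\<exists>y. P (Suc n) y \<and> Q n x y" if "P n x" for n x
    using step[of x n] that mem[of x n] unfolding P_def Q_def by blast
  obtain x where x: "\<And>n. P n (x n)" "\<And>n. Q n (x n) (x (Suc n))"
    using dependent_nat_choice[of P Q] ex sx by metis
  have xm: "x n \<in> l2 \<beta>" for n using x(1) unfolding P_def .
  have inc: "l2_norm \<beta> (\<lambda>k. x (Suc n) k - x n k) \<le> (1/3) ^ n" for n
  proof -
    obtain s where s: "cmod s = (1/3) ^ n" "x (Suc n) = st n (x n) s"
      using x(2)[of n] unfolding Q_def by blast
    then have "(\<lambda>k. x (Suc n) k - x n k) = (\<lambda>k. s * u n k)" by (auto simp: st_def)
    then show ?thesis by (simp add: l2_scale(2)[OF u(1)] u s)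
  qed
  obtain y where y: "y \<in> l2 \<beta>" "\<And>n. l2_norm \<beta> (\<lambda>k. y k - x n k) \<le> 3/2 * (1/3) ^ n"
    using l2_complete[OF xm inc] by blast
  obtain B where B: "\<And>i. p i y \<le> B" using ptw[OF y(1)] by blast
  \<comment> \<open>At \<open>x (Suc n)\<close> the seminorm is at least 2/3 of
    \<open>(1/3) ^ n * M n\<close>, and moving to the limit \<open>y\<close> loses at most 1/2 of
    it. The remaining 1/6 accounts for the 6, and \<open>M n > 4 ^ n\<close> for the growth.\<close>
  have "(4/3) ^ n \<le> 6 * B" for n
  proof -
    let ?d = "\<lambda>k. x (Suc n) k + (-1) * y k"
    have dm: "?d \<in> l2 \<beta>" by (intro l2_add l2_scale xm y)
    have dn: "l2_norm \<beta> ?d \<le> 1/2 * (1/3) ^ n"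
    proof -
      have "l2_norm \<beta> ?d = l2_norm \<beta> (\<lambda>k. y k - x (Suc n) k)"
        unfolding l2_norm_def by (simp add: norm_minus_commute)
      with y(2)[of "Suc n"] show ?thesis by simp
    qed
    have "(1/3) ^ n * (2/3 * M n) \<le> (1/3) ^ n * p (I n) (u n)"
      using pu[of n] by (intro mult_left_mono) auto
    also have "\<dots> \<le> p (I n) (x (Suc n))" using x(2)[of n] unfolding Q_def by blast
    also have "\<dots> = p (I n) (\<lambda>k. ?d k + y k)" by simp
    also have "\<dots> \<le> p (I n) ?d + p (I n) y" by (intro add dm y)
    also have "\<dots> \<le> M n * (1/2 * (1/3) ^ n) + B"
    proof -
      have "M n > 0" using M[of n] by (meson less_trans zero_less_numeral zero_less_power)
      then have "p (I n) ?d \<le> M n * (1/2 * (1/3) ^ n)"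
        using pM[OF dm, of n] dn mult_left_mono[of "l2_norm \<beta> ?d" "1/2 * (1/3) ^ n" "M n"] by linarith
      with B[of "I n"] show ?thesis by linarith
    qed
    finally have "(1/3) ^ n * M n \<le> 6 * B" by (simp add: algebra_simps)
    moreover have "(4/3) ^ n = (1/3) ^ n * (4::real) ^ n"
      by (simp add: power_divide)
    moreover have "(1/3) ^ n * (4::real) ^ n \<le> (1/3) ^ n * M n"
      using M[of n] by (intro mult_left_mono) auto
    ultimately show ?thesis by linarith
  qed
  moreover obtain n where "(4/3::real) ^ n > 6 * B" using real_arch_pow[of "4/3" "6 * B"] by auto
  ultimately show False by (meson linorder_not_less)
qed

end

section \<open>Taylor coefficients and means over circles\<close>

lemma taylor_coeff_fps: "taylor_coeff f k = fps_nth (fps_expansion f 0) k"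
  by (simp add: taylor_coeff_def fps_expansion_def)

lemma taylor_coeff_eqI: "f has_fps_expansion F \<Longrightarrow> taylor_coeff f k = fps_nth F k"
  by (simp add: taylor_coeff_fps fps_expansion_eqI)

lemma has_fps_expansion_taylor:
  "f holomorphic_on unit_disc \<Longrightarrow> f has_fps_expansion fps_expansion f 0"
  by (intro analytic_at_imp_has_fps_expansion_0) (auto simp: analytic_at intro!: exI[of _ unit_disc])

lemma taylor_sums:
  assumes "f holomorphic_on unit_disc" "cmod z < 1"
  shows "(\<lambda>k. taylor_coeff f k * z ^ k) sums f z"
  using holomorphic_power_series[OF assms(1), of z] assms(2) by (simp add: taylor_coeff_def)

lemma power_series_taylor:
  assumes "\<And>z. cmod z < 1 \<Longrightarrow> (\<lambda>k. c k * z ^ k) sums f z"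
  shows "f holomorphic_on unit_disc" "taylor_coeff f = c"
proof -
  show f: "f holomorphic_on unit_disc"
    using assms by (intro power_series_holomorphic[where a=c]) auto
  have *: "f has_fps_expansion Abs_fps c"
  proof (rule has_fps_expansionI)
    show "\<forall>\<^sub>F z in nhds 0. (\<lambda>n. fps_nth (Abs_fps c) n * z ^ n) sums f z"
      using assms by (intro eventually_nhds_in_open[of unit_disc, THEN eventually_mono]) auto
  qed
  show "taylor_coeff f = c" using taylor_coeff_eqI[OF *] by auto
qed

lemma taylor_coeff_cong:
  assumes "\<And>z. z \<in> unit_disc \<Longrightarrow> f z = g z"
  shows "taylor_coeff f k = taylor_coeff g k"
  unfolding taylor_coeff_def
  by (intro arg_cong2[where f="(/)"] higher_deriv_cong_ev refl
       eventually_nhds_in_open[of unit_disc, THEN eventually_mono]) (auto simp: assms)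

lemma taylor_coeff_add:
  assumes "f holomorphic_on unit_disc" "g holomorphic_on unit_disc"
  shows "taylor_coeff (\<lambda>z. f z + g z) k = taylor_coeff f k + taylor_coeff g k"
  using taylor_coeff_eqI[OF has_fps_expansion_add[OF assms[THEN has_fps_expansion_taylor]], of k]
  by (simp add: taylor_coeff_fps)

lemma taylor_coeff_cmult:
  assumes "f holomorphic_on unit_disc"
  shows "taylor_coeff (\<lambda>z. c * f z) k = c * taylor_coeff f k"
  using taylor_coeff_eqI[OF has_fps_expansion_cmult_left[OF assms[THEN has_fps_expansion_taylor]], of c k]
  by (simp add: taylor_coeff_fps)

lemma taylor_coeff_mult:
  assumes "f holomorphic_on unit_disc" "g holomorphic_on unit_disc"
  shows "taylor_coeff (\<lambda>z. f z * g z) k = (\<Sum>i\<le>k. taylor_coeff f i * taylor_coeff g (k - i))"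
  using taylor_coeff_eqI[OF has_fps_expansion_mult[OF assms[THEN has_fps_expansion_taylor]], of k]
  by (simp add: taylor_coeff_fps fps_mult_nth atMost_atLeast0)

text \<open>Since \<open>\<psi> 0 = 0\<close>, the power \<open>\<psi> z ^ j\<close> vanishes to
  order at least \<open>j\<close> at 0 and contributes nothing to the coefficients below
  \<open>j\<close>. The matrix of the weighted composition is therefore lower triangular.\<close>

lemma taylor_coeff_weighted_composition:
  assumes w: "w holomorphic_on unit_disc" and f: "f holomorphic_on unit_disc"
    and \<psi>: "\<psi> holomorphic_on unit_disc" and \<psi>0: "\<psi> 0 = 0"
  shows "taylor_coeff (\<lambda>z. w z * f (\<psi> z)) i =
    (\<Sum>j\<le>i. taylor_coeff f j * taylor_coeff (\<lambda>z. w z * \<psi> z ^ j) i)"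
proof -
  define W F P where "W = fps_expansion w 0" and "F = fps_expansion f 0" and "P = fps_expansion \<psi> 0"
  have W: "w has_fps_expansion W" and F: "f has_fps_expansion F" and P: "\<psi> has_fps_expansion P"
    unfolding W_def F_def P_def by (intro has_fps_expansion_taylor assms)+
  have P0: "fps_nth P 0 = 0" using \<psi>0 unfolding P_def fps_expansion_def by simp
  have "taylor_coeff (\<lambda>z. w z * f (\<psi> z)) i = fps_nth (W * (F oo P)) i"
    using taylor_coeff_eqI[OF has_fps_expansion_mult[OF W has_fps_expansion_compose[OF F P P0]]]
    by (simp add: o_def)
  \<comment> \<open>The inner range is enlarged from \<open>j \<le> i - a\<close> to
    \<open>j \<le> i\<close> by vanishing terms, so that the two sums can be interchanged.\<close>
  also have "\<dots> = (\<Sum>a\<le>i. fps_nth W a * (\<Sum>j\<le>i. fps_nth F j * fps_nth (P ^ j) (i - a)))"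
    unfolding fps_mult_nth fps_compose_nth atLeast0AtMost
    by (intro sum.cong refl arg_cong2[where f="(*)"] sum.mono_neutral_left)
       (auto simp: startsby_zero_power_prefix[OF P0])
  also have "\<dots> = (\<Sum>j\<le>i. fps_nth F j * (\<Sum>a\<le>i. fps_nth W a * fps_nth (P ^ j) (i - a)))"
    unfolding sum_distrib_left by (subst sum.swap) (simp add: mult_ac)
  also have "\<dots> = (\<Sum>j\<le>i. taylor_coeff f j * taylor_coeff (\<lambda>z. w z * \<psi> z ^ j) i)"
    using taylor_coeff_eqI[OF has_fps_expansion_mult[OF W has_fps_expansion_power[OF P]]]
    by (simp add: fps_mult_nth atLeast0AtMost F_def taylor_coeff_fps)
  finally show ?thesis .
qed

lemma taylor_abs_summable:
  assumes "f holomorphic_on unit_disc" "0 \<le> r" "r < 1"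
  shows "summable (\<lambda>k. cmod (taylor_coeff f k) * r ^ k)"
proof -
  obtain s where s: "r < s" "s < 1" using assms(3) dense by blast
  have "summable (\<lambda>k. taylor_coeff f k * of_real s ^ k)"
    using taylor_sums[OF assms(1), of "of_real s"] s assms(2) sums_summable by force
  then have "summable (\<lambda>k. norm (taylor_coeff f k * of_real r ^ k))"
    by (rule powser_insidea) (use s assms in auto)
  then show ?thesis using assms(2) by (simp add: norm_mult norm_power)
qed

text \<open>A mean over \<open>N\<close> equally spaced points instead of an integral: orthogonality
  of roots of unity makes Parseval exact for polynomials of degree below \<open>N\<close>, and a
  pointwise bound on a multiplier passes to the mean termwise.\<close>

definition circle_mean :: "real \<Rightarrow> nat \<Rightarrow> (complex \<Rightarrow> complex) \<Rightarrow> real" where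
  "circle_mean r N f = (\<Sum>j<N. (cmod (f (of_real r * cis (2 * pi * real j / N))))\<^sup>2) / N"

lemma circle_mean_polynomial:
  assumes "N > 0" and f: "\<And>z. f z = (\<Sum>k<N. c k * z ^ k)"
  shows "circle_mean r N f = (\<Sum>k<N. (cmod (c k))\<^sup>2 * (r\<^sup>2) ^ k)"
proof -
  define a where "a = (\<lambda>k. c k * of_real (r ^ k))"
  define x where "x = (\<lambda>k l. cis (2 * pi * (real k - real l) / N))"
  have ortho: "(\<Sum>j<N. x k l ^ j) = (if k = l then of_nat N else 0)" if "k < N" "l < N" for k l
  proof (cases "k = l")
    case True then show ?thesis by (simp add: x_def)
  next
    case False
    have "x k l ^ N = cis (real N * (2 * pi * (real k - real l) / N))"
      by (simp only: x_def Complex.DeMoivre)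
    also have "real N * (2 * pi * (real k - real l) / N) = 2 * pi * real_of_int (int k - int l)"
      using assms(1) by simp
    also have "cis (2 * pi * real_of_int (int k - int l)) = 1"
      by (rule cis_multiple_2pi) (rule Ints_of_int)
    finally have 1: "x k l ^ N = 1" .
    \<comment> \<open>A difference \<open>k - l\<close> divisible by \<open>N\<close> has to vanish,
      as both indices are below \<open>N\<close>.\<close>
    have 2: "x k l \<noteq> 1"
    proof
      assume "x k l = 1"
      then have "cos (2 * pi * (real k - real l) / N) = 1"
        by (simp add: x_def complex_eq_iff)
      then obtain m :: int where "2 * pi * (real k - real l) / N = of_int m * 2 * pi"
        using cos_one_2pi_int by blast
      then have "2 * pi * (real k - real l) = 2 * pi * (of_int m * N)"
        using assms(1) by (simp add: divide_eq_eq mult_ac)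
      then have "real k - real l = of_int m * N"
        by (subst (asm) mult_cancel_left) simp
      then have m: "int k - int l = m * int N" 
        by (subst of_int_eq_iff[where 'a=real, symmetric]) simp
      with False have "m \<noteq> 0" by auto
      then have "int N \<le> \<bar>m\<bar> * int N" using mult_right_mono[of 1 "\<bar>m\<bar>" "int N"] by auto
      also have "\<dots> = \<bar>int k - int l\<bar>" by (simp add: m abs_mult)
      also have "\<dots> < int N" using that by auto
      finally show False by simp
    qed
    have "(\<Sum>j<N. x k l ^ j) = (x k l ^ N - 1) / (x k l - 1)"
      by (rule geometric_sum[OF 2])
    then show ?thesis using 1 False by simp
  qed
  have "complex_of_real (\<Sum>j<N. (cmod (f (of_real r * cis (2 * pi * real j / N))))\<^sup>2)
      = (\<Sum>j<N. \<Sum>k<N. \<Sum>l<N. a k * cnj (a l) * x k l ^ j)"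
    unfolding of_real_sum
  proof (rule sum.cong[OF refl])
    fix j
    let ?z = "cis (2 * pi * real j / N)"
    have zx: "?z ^ k * cnj (?z ^ l) = x k l ^ j" for k l
    proof -
      have "?z ^ k * cnj (?z ^ l) = cis (real k * (2 * pi * real j / N) - real l * (2 * pi * real j / N))"
        by (simp only: Complex.DeMoivre cis_cnj cis_mult) (simp only: diff_conv_add_uminus)
      also have "real k * (2 * pi * real j / N) - real l * (2 * pi * real j / N)
          = real j * (2 * pi * (real k - real l) / N)"
        by (simp add: algebra_simps diff_divide_distrib)
      finally show ?thesis by (simp only: x_def Complex.DeMoivre)
    qed
    have "f (of_real r * ?z) = (\<Sum>k<N. a k * ?z ^ k)"
      by (simp add: f a_def power_mult_distrib mult_ac)
    then have "complex_of_real ((cmod (f (of_real r * ?z)))\<^sup>2)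
        = (\<Sum>k<N. a k * ?z ^ k) * cnj (\<Sum>l<N. a l * ?z ^ l)"
      by (simp only: complex_norm_square)
    also have "\<dots> = (\<Sum>k<N. \<Sum>l<N. a k * cnj (a l) * x k l ^ j)"
      unfolding cnj_sum sum_product zx[symmetric] by (intro sum.cong refl) simp
    finally show "complex_of_real ((cmod (f (of_real r * ?z)))\<^sup>2)
        = (\<Sum>k<N. \<Sum>l<N. a k * cnj (a l) * x k l ^ j)" .
  qed
  also have "\<dots> = (\<Sum>k<N. \<Sum>l<N. a k * cnj (a l) * (\<Sum>j<N. x k l ^ j))"
    unfolding sum_distrib_left by (subst sum.swap, rule sum.cong[OF refl], rule sum.swap)
  also have "\<dots> = (\<Sum>k<N. \<Sum>l<N. if k = l then a k * cnj (a l) * of_nat N else 0)"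
    by (intro sum.cong refl) (simp add: ortho)
  also have "\<dots> = (\<Sum>k<N. a k * cnj (a k)) * of_nat N"
    by (simp add: sum_distrib_right)
  also have "\<dots> = complex_of_real ((\<Sum>k<N. (cmod (a k))\<^sup>2) * N)"
    by (simp only: of_real_mult of_real_sum complex_norm_square of_real_of_nat_eq)
  finally have "(\<Sum>j<N. (cmod (f (of_real r * cis (2 * pi * real j / N))))\<^sup>2) = (\<Sum>k<N. (cmod (a k))\<^sup>2) * N"
    using of_real_eq_iff by blast
  moreover have "(cmod (a k))\<^sup>2 = (cmod (c k))\<^sup>2 * (r\<^sup>2) ^ k" for k
    unfolding a_def norm_mult norm_of_real power_mult_distrib power2_abs
    by (simp add: power_mult[symmetric] mult.commute)
  ultimately show ?thesis using assms(1) by (simp add: circle_mean_def)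
qed

text \<open>The bound is the tail of one convergent series and is uniform on the closed disc of
  radius \<open>r\<close>. The case \<open>N = 0\<close> serves as a bound for \<open>f\<close>
  itself.\<close>

lemma taylor_remainder:
  assumes f: "f holomorphic_on unit_disc" and r: "0 \<le> r" "r < 1" and z: "cmod z \<le> r"
  shows "cmod (f z - (\<Sum>k<N. taylor_coeff f k * z ^ k))
    \<le> (\<Sum>k. cmod (taylor_coeff f k) * r ^ k) - (\<Sum>k<N. cmod (taylor_coeff f k) * r ^ k)"
proof -
  define b where "b = (\<lambda>k. cmod (taylor_coeff f k) * r ^ k)"
  define S where "S = (\<lambda>N. \<Sum>k<N. taylor_coeff f k * z ^ k)"
  have b: "summable b" unfolding b_def by (rule taylor_abs_summable[OF f r])
  have b0: "b k \<ge> 0" for k using r by (simp add: b_def)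
  have lim: "S \<longlonglongrightarrow> f z"
    using taylor_sums[OF f, of z] z r unfolding S_def sums_def by simp
  have "cmod (f z - S N) \<le> suminf b - (\<Sum>k<N. b k)"
  proof (rule Lim_bounded[OF tendsto_norm[OF tendsto_diff[OF lim tendsto_const]], of N], intro allI impI)
    fix n assume "N \<le> n"
    have "S n - S N = (\<Sum>k=N..<n. taylor_coeff f k * z ^ k)"
      unfolding S_def lessThan_atLeast0 using sum_diff_nat_ivl[OF _ \<open>N \<le> n\<close>, of 0] by simp
    also have "cmod \<dots> \<le> (\<Sum>k=N..<n. b k)"
      unfolding b_def using z
      by (intro sum_norm_le) (simp add: norm_mult norm_power mult_left_mono power_mono)
    also have "\<dots> = (\<Sum>k<n. b k) - (\<Sum>k<N. b k)"
      unfolding lessThan_atLeast0 using sum_diff_nat_ivl[OF _ \<open>N \<le> n\<close>, of 0 b] by simp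
    also have "\<dots> \<le> suminf b - (\<Sum>k<N. b k)"
      using sum_le_suminf[OF b, of "{..<n}"] b0 by simp
    finally show "cmod (S n - S N) \<le> suminf b - (\<Sum>k<N. b k)" .
  qed
  then show ?thesis by (simp add: b_def S_def)
qed

lemma taylor_remainder_tendsto:
  assumes f: "f holomorphic_on unit_disc" and r: "0 \<le> r" "r < 1"
  shows "(\<lambda>N. (\<Sum>k. cmod (taylor_coeff f k) * r ^ k) - (\<Sum>k<N. cmod (taylor_coeff f k) * r ^ k)) \<longlonglongrightarrow> 0"
  using tendsto_diff[OF tendsto_const summable_LIMSEQ[OF taylor_abs_summable[OF f r]],
      of "\<Sum>k. cmod (taylor_coeff f k) * r ^ k"] by simp

text \<open>The same \<open>N\<close> counts sample points and terms of the truncation, so Parseval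
  is exact for the truncation \<open>S N\<close>. On the circle both moduli are at most
  \<open>K\<close>, hence their squares differ by at most \<open>2 * K\<close> times the
  remainder.\<close>

lemma circle_mean_tendsto:
  assumes f: "f holomorphic_on unit_disc" and r: "0 \<le> r" "r < 1"
  shows "(\<lambda>N. circle_mean r N f - (\<Sum>k<N. (cmod (taylor_coeff f k))\<^sup>2 * (r\<^sup>2) ^ k)) \<longlonglongrightarrow> 0"
proof -
  define b where "b = (\<lambda>k. cmod (taylor_coeff f k) * r ^ k)"
  define S where "S = (\<lambda>N z. \<Sum>k<N. taylor_coeff f k * z ^ k)"
  have b: "summable b" unfolding b_def by (rule taylor_abs_summable[OF f r])
  have b0: "b k \<ge> 0" for k using r by (simp add: b_def)
  define K where "K = suminf b"
  have Sle: "cmod (S N z) \<le> K" if "cmod z = r" for N z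
  proof -
    have "cmod (S N z) \<le> (\<Sum>k<N. b k)"
      unfolding S_def b_def using that by (intro sum_norm_le) (simp add: norm_mult norm_power)
    also have "\<dots> \<le> K" unfolding K_def by (intro sum_le_suminf b b0) auto
    finally show ?thesis .
  qed
  have dle: "cmod (f z - S N z) \<le> K - (\<Sum>k<N. b k)" if "cmod z = r" for z N
    using taylor_remainder[OF f r, of z N] that unfolding K_def S_def b_def by simp
  have fle: "cmod (f z) \<le> K" if "cmod z = r" for z
    using dle[OF that, of 0] by (simp add: S_def)
  have main: "\<bar>circle_mean r N f - (\<Sum>k<N. (cmod (taylor_coeff f k))\<^sup>2 * (r\<^sup>2) ^ k)\<bar>
      \<le> 2 * K * (K - (\<Sum>k<N. b k))" if N: "N > 0" for N
  proof -
    define z where "z = (\<lambda>j. of_real r * cis (2 * pi * real j / N))"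
    have z: "cmod (z j) = r" for j using r by (simp add: z_def norm_mult)
    have "circle_mean r N f - (\<Sum>k<N. (cmod (taylor_coeff f k))\<^sup>2 * (r\<^sup>2) ^ k)
        = circle_mean r N f - circle_mean r N (S N)"
      using circle_mean_polynomial[OF N, of "S N" "taylor_coeff f" r] by (simp add: S_def)
    also have "\<dots> = (\<Sum>j<N. (cmod (f (z j)))\<^sup>2 - (cmod (S N (z j)))\<^sup>2) / N"
      by (simp add: circle_mean_def z_def sum_subtractf diff_divide_distrib)
    also have "\<bar>\<dots>\<bar> \<le> (\<Sum>j<N. 2 * K * (K - (\<Sum>k<N. b k))) / N"
    proof -
      have "\<bar>(cmod (f (z j)))\<^sup>2 - (cmod (S N (z j)))\<^sup>2\<bar> \<le> 2 * K * (K - (\<Sum>k<N. b k))" for j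
      proof -
        have "\<bar>(cmod (f (z j)))\<^sup>2 - (cmod (S N (z j)))\<^sup>2\<bar>
            = (cmod (f (z j)) + cmod (S N (z j))) * \<bar>cmod (f (z j)) - cmod (S N (z j))\<bar>"
        proof -
          have "\<bar>a\<^sup>2 - b\<^sup>2\<bar> = (a + b) * \<bar>a - b\<bar>" if "0 \<le> a" "0 \<le> b" for a b :: real
          proof -
            have "a\<^sup>2 - b\<^sup>2 = (a + b) * (a - b)" by (simp add: power2_eq_square algebra_simps)
            then show ?thesis using that by (simp add: abs_mult)
          qed
          then show ?thesis by simp
        qed
        also have "\<dots> \<le> (2 * K) * (K - (\<Sum>k<N. b k))"
        proof (rule mult_mono)
          show "cmod (f (z j)) + cmod (S N (z j)) \<le> 2 * K"
            using add_mono[OF fle[OF z] Sle[OF z]] by simp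
          show "\<bar>cmod (f (z j)) - cmod (S N (z j))\<bar> \<le> K - (\<Sum>k<N. b k)"
            by (rule order_trans[OF norm_triangle_ineq3 dle[OF z]])
          show "0 \<le> 2 * K" using order_trans[OF norm_ge_zero fle[OF z, of j]] by simp
        qed simp
        finally show ?thesis by simp
      qed
      then show ?thesis
        using N by (simp only: abs_divide abs_of_nat)
          (intro divide_right_mono order_trans[OF sum_abs] sum_mono, auto)
    qed
    finally show ?thesis using N by simp
  qed
  have "(\<lambda>N. 2 * K * (K - (\<Sum>k<N. b k))) \<longlonglongrightarrow> 0"
    using tendsto_mult_right_zero[OF taylor_remainder_tendsto[OF f r], of "2 * K"] unfolding K_def b_def .
  then show ?thesis
    by (rule Lim_null_comparison[rotated])
       (use main in \<open>auto simp: eventually_sequentially intro!: exI[of _ 1]\<close>)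
qed

section \<open>Subordination in the Hardy space\<close>

lemma H2_iff: "f \<in> H2 \<beta> \<longleftrightarrow> f holomorphic_on unit_disc \<and> taylor_coeff f \<in> l2 \<beta>"
  by (simp add: H2_def l2_def)

lemma l2_norm_sq:
  assumes "positive_weight \<beta>" "c \<in> l2 \<beta>"
  shows "(l2_norm \<beta> c)\<^sup>2 = (\<Sum>k. \<beta> k * (cmod (c k))\<^sup>2)"
  using assms suminf_nonneg[of "\<lambda>k. \<beta> k * (cmod (c k))\<^sup>2"]
  by (simp add: l2_norm_def l2_def positive_weight.term_nonneg)

interpretation hardy: positive_weight "\<lambda>_. 1"
  by unfold_locales simp

text \<open>Boundary values are avoided: both sides are compared on circles of radius \<open>r < 1\<close>.\<close>

lemma hardy_mult_bounded:
  assumes u: "u holomorphic_on unit_disc" and M: "\<And>z. z \<in> unit_disc \<Longrightarrow> cmod (u z) \<le> M"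
    and g: "g \<in> hardy"
  shows "(\<lambda>z. u z * g z) \<in> hardy"
    "l2_norm (\<lambda>_. 1) (taylor_coeff (\<lambda>z. u z * g z)) \<le> M * l2_norm (\<lambda>_. 1) (taylor_coeff g)"
proof -
  define c where "c = taylor_coeff (\<lambda>z. u z * g z)"
  define B where "B = M * l2_norm (\<lambda>_. 1) (taylor_coeff g)"
  have M0: "0 \<le> M" using order_trans[OF norm_ge_zero M[of 0]] by simp
  have gh: "g holomorphic_on unit_disc" and gl: "taylor_coeff g \<in> l2 (\<lambda>_. 1)"
    using g by (auto simp: H2_iff)
  have ug: "(\<lambda>z. u z * g z) holomorphic_on unit_disc" by (intro holomorphic_intros u gh)
  have B0: "0 \<le> B" using M0 hardy.l2_norm_nonneg[OF gl] by (simp add: B_def)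
  have A: "(\<Sum>k<n. (cmod (c k))\<^sup>2 * (r\<^sup>2) ^ k) \<le> B\<^sup>2" if r: "0 \<le> r" "r < 1" for n r
  proof -
    let ?D = "\<lambda>f N. circle_mean r N f - (\<Sum>k<N. (cmod (taylor_coeff f k))\<^sup>2 * (r\<^sup>2) ^ k)"
    \<comment> \<open>The inequality between the means holds for every \<open>N\<close>; the two
      Parseval errors are carried along and disappear as \<open>N\<close> grows.\<close>
    have "(\<lambda>N. B\<^sup>2 + M\<^sup>2 * ?D g N - ?D (\<lambda>z. u z * g z) N) \<longlonglongrightarrow> B\<^sup>2 + M\<^sup>2 * 0 - 0"
      by (intro tendsto_intros circle_mean_tendsto ug gh r)
    moreover have "(\<Sum>k<n. (cmod (c k))\<^sup>2 * (r\<^sup>2) ^ k) \<le> B\<^sup>2 + M\<^sup>2 * ?D g N - ?D (\<lambda>z. u z * g z) N"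
      if N: "N \<ge> n" for N
    proof -
      have "circle_mean r N (\<lambda>z. u z * g z) \<le> M\<^sup>2 * circle_mean r N g"
        unfolding circle_mean_def norm_mult power_mult_distrib times_divide_eq_right sum_distrib_left
        using r by (intro divide_right_mono sum_mono mult_right_mono power_mono M)
                   (auto simp: norm_mult)
      moreover have "(\<Sum>k<n. (cmod (c k))\<^sup>2 * (r\<^sup>2) ^ k) \<le> (\<Sum>k<N. (cmod (c k))\<^sup>2 * (r\<^sup>2) ^ k)"
        using N by (intro sum_mono2) auto
      moreover have "M\<^sup>2 * (\<Sum>k<N. (cmod (taylor_coeff g k))\<^sup>2 * (r\<^sup>2) ^ k) \<le> B\<^sup>2"
      proof -
        have "(\<Sum>k<N. (cmod (taylor_coeff g k))\<^sup>2 * (r\<^sup>2) ^ k) \<le> (\<Sum>k<N. 1 * (cmod (taylor_coeff g k))\<^sup>2)"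
          using r by (intro sum_mono) (simp add: mult_left_le power_le_one)
        also have "\<dots> \<le> (l2_norm (\<lambda>_. 1) (taylor_coeff g))\<^sup>2"
          by (rule hardy.partial_le_l2_norm[OF gl])
        finally show ?thesis unfolding B_def power_mult_distrib by (intro mult_left_mono) auto
      qed
      ultimately show ?thesis by (simp add: c_def algebra_simps)
    qed
    ultimately show ?thesis
      by (intro LIMSEQ_le_const[of _ "B\<^sup>2"]) auto
  qed
  have "(\<Sum>k<n. 1 * (cmod (c k))\<^sup>2) \<le> B\<^sup>2" for n
  proof -
    \<comment> \<open>The radii start at 0 and increase to 1; for fixed \<open>n\<close> the finite
      sum is continuous in the radius.\<close>
    let ?r = "\<lambda>m. 1 - 1 / real (Suc m)"
    have "(\<lambda>m. \<Sum>k<n. (cmod (c k))\<^sup>2 * ((?r m)\<^sup>2) ^ k) \<longlonglongrightarrow> (\<Sum>k<n. (cmod (c k))\<^sup>2 * ((1 - 0)\<^sup>2) ^ k)"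
      by (intro tendsto_intros LIMSEQ_Suc[OF lim_1_over_n])
    moreover have "(\<Sum>k<n. (cmod (c k))\<^sup>2 * ((?r m)\<^sup>2) ^ k) \<le> B\<^sup>2" for m
      by (rule A) auto
    ultimately show ?thesis
      by (intro LIMSEQ_le_const2[of _ "\<Sum>k<n. 1 * (cmod (c k))\<^sup>2"]) auto
  qed
  then show "(\<lambda>z. u z * g z) \<in> hardy"
    "l2_norm (\<lambda>_. 1) (taylor_coeff (\<lambda>z. u z * g z)) \<le> M * l2_norm (\<lambda>_. 1) (taylor_coeff g)"
    using hardy.l2_normI[OF B0, of c] ug by (auto simp: H2_iff c_def B_def)
qed

text \<open>Uniform convergence near 0 already gives convergence of every Taylor coefficient, so
  \<open>hardy.l2_norm_fatou\<close> applies. The radius 1/2 is an arbitrary choice.\<close>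

lemma hardy_fatou:
  assumes F: "\<And>n. F n \<in> hardy" and f: "f holomorphic_on unit_disc"
    and e: "\<And>n z. cmod z < 1/2 \<Longrightarrow> cmod (F n z - f z) \<le> e n" "e \<longlonglongrightarrow> 0"
    and B: "0 \<le> B" "\<And>n. l2_norm (\<lambda>_. 1) (taylor_coeff (F n)) \<le> B"
  shows "f \<in> hardy" "l2_norm (\<lambda>_. 1) (taylor_coeff f) \<le> B"
proof -
  have u: "uniform_limit (ball 0 (1/2)) F f sequentially"
  proof (rule uniform_limitI)
    fix d :: real assume "d > 0"
    from order_tendstoD(2)[OF e(2) this]
    show "\<forall>\<^sub>F n in sequentially. \<forall>z\<in>ball 0 (1/2). dist (F n z) (f z) < d"
    proof eventually_elim
      case (elim n)
      have "dist (F n z) (f z) < d" if "z \<in> ball 0 (1/2)" for z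
        using e(1)[of z n] that elim by (simp add: dist_norm)
      then show ?case by blast
    qed
  qed
  have "(\<lambda>n. taylor_coeff (F n) k) \<longlonglongrightarrow> taylor_coeff f k" for k
    unfolding taylor_coeff_def
  proof (intro tendsto_divide tendsto_const higher_deriv_complex_uniform_limit[OF u])
    show "\<forall>\<^sub>F n in sequentially. F n holomorphic_on ball 0 (1/2)"
    proof (intro always_eventually allI)
      fix n
      have "F n holomorphic_on unit_disc" using F by (simp add: H2_iff)
      then show "F n holomorphic_on ball 0 (1/2)" by (rule holomorphic_on_subset) auto
    qed
  qed auto
  from hardy.l2_norm_fatou[OF B(1) this, of 0] F B(2) f
  show "f \<in> hardy" "l2_norm (\<lambda>_. 1) (taylor_coeff f) \<le> B" by (auto simp: H2_iff)
qed

section \<open>Szego kernels and the subordination principle\<close>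

lemma cnj_mult_neq_1:
  assumes "cmod a < 1" "cmod z < 1" shows "1 - cnj a * z \<noteq> 0"
proof
  assume "1 - cnj a * z = 0"
  then have "cmod (cnj a * z) = 1" by (metis eq_iff_diff_eq_0 norm_one)
  moreover have "cmod (cnj a * z) < 1"
    using mult_strict_mono[of "cmod a" 1 "cmod z" 1] assms by (simp add: norm_mult)
  ultimately show False by simp
qed

lemma szego_kernel_sums:
  assumes "cmod a < 1" "cmod z < 1"
  shows "(\<lambda>k. cnj a ^ k * z ^ k) sums (1 / (1 - cnj a * z))"
proof -
  have "cmod (cnj a * z) < 1"
    using mult_strict_mono[of "cmod a" 1 "cmod z" 1] assms by (simp add: norm_mult)
  then show ?thesis unfolding power_mult_distrib[symmetric] by (rule geometric_sums)
qed

lemma szego_kernel_bound: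
  assumes "cmod a < 1" "cmod z \<le> 1" shows "1 - cmod a \<le> cmod (1 - cnj a * z)" "cmod (1 - cnj a * z) \<le> 1 + cmod a"
proof -
  have "cmod (cnj a * z) \<le> cmod a" using assms by (simp add: norm_mult mult_left_le)
  then show "1 - cmod a \<le> cmod (1 - cnj a * z)" "cmod (1 - cnj a * z) \<le> 1 + cmod a"
    using norm_triangle_ineq2[of 1 "cnj a * z"] norm_triangle_ineq4[of 1 "cnj a * z"] by auto
qed

lemma szego_kernel_holomorphic:
  assumes "cmod a < 1" shows "(\<lambda>z. 1 / (1 - cnj a * z)) holomorphic_on unit_disc"
  using cnj_mult_neq_1[OF assms] by (intro holomorphic_intros) (auto simp: dist_norm)

text \<open>The case of a polynomial, by induction on its degree: if \<open>p(z) = c\<^sub>0 + z q(z)\<close> then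
  \<open>(p \<circ> \<psi>) k\<^sub>a = c\<^sub>0 k\<^sub>a + \<psi> (q \<circ> \<psi>) k\<^sub>a\<close>, and the second summand is orthogonal to the Szego kernel
  \<open>k\<^sub>a\<close> because it vanishes at \<open>a\<close>.\<close>

lemma hardy_subordination_polynomial:
  assumes \<psi>: "\<psi> holomorphic_on unit_disc" "\<psi> ` unit_disc \<subseteq> unit_disc"
    and a: "cmod a < 1" "\<psi> a = 0"
  shows "(\<lambda>z. (\<Sum>k<N. c k * \<psi> z ^ k) * (1 / (1 - cnj a * z))) \<in> hardy \<and>
    (l2_norm (\<lambda>_. 1) (taylor_coeff (\<lambda>z. (\<Sum>k<N. c k * \<psi> z ^ k) * (1 / (1 - cnj a * z)))))\<^sup>2
      \<le> (\<Sum>k<N. (cmod (c k))\<^sup>2) / (1 - (cmod a)\<^sup>2)"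
proof (induction N arbitrary: c)
  case 0
  have "taylor_coeff (\<lambda>z. 0) = (\<lambda>k. 0)" by (rule power_series_taylor(2)) auto
  then show ?case by (simp add: H2_iff hardy.l2_zero)
next
  case (Suc N)
  define G where "G = (\<lambda>z. (\<Sum>k<N. c (Suc k) * \<psi> z ^ k) * (1 / (1 - cnj a * z)))"
  define H where "H = (\<lambda>z. \<psi> z * G z)"
  define t where "t = taylor_coeff (\<lambda>z. (\<Sum>k<Suc N. c k * \<psi> z ^ k) * (1 / (1 - cnj a * z)))"
  define d where "d = taylor_coeff H"
  have G: "G \<in> hardy" "(l2_norm (\<lambda>_. 1) (taylor_coeff G))\<^sup>2 \<le> (\<Sum>k<N. (cmod (c (Suc k)))\<^sup>2) / (1 - (cmod a)\<^sup>2)"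
    using Suc[of "\<lambda>k. c (Suc k)"] unfolding G_def by auto
  \<comment> \<open>Multiplication by the self-map is a contraction of the Hardy space, so the bound
    for \<open>G\<close> passes to \<open>H\<close> without a loss that would accumulate in the
    induction.\<close>
  have "z \<in> unit_disc \<Longrightarrow> cmod (\<psi> z) \<le> 1" for z using \<psi>(2) by (force simp: image_subset_iff)
  from hardy_mult_bounded[OF \<psi>(1) this G(1)]
  have H: "H \<in> hardy" "l2_norm (\<lambda>_. 1) d \<le> l2_norm (\<lambda>_. 1) (taylor_coeff G)"
    by (auto simp: H_def d_def)
  have Hh: "H holomorphic_on unit_disc" and d: "d \<in> l2 (\<lambda>_. 1)" using H by (auto simp: H2_iff d_def)
  have eq: "(\<lambda>z. (\<Sum>k<Suc N. c k * \<psi> z ^ k) * (1 / (1 - cnj a * z))) = (\<lambda>z. c 0 * (1 / (1 - cnj a * z)) + H z)"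
  proof
    fix z
    have "(\<Sum>k<Suc N. c k * \<psi> z ^ k) = c 0 + \<psi> z * (\<Sum>k<N. c (Suc k) * \<psi> z ^ k)"
      by (simp add: sum.lessThan_Suc_shift sum_distrib_left algebra_simps del: sum.lessThan_Suc)
    then show "(\<Sum>k<Suc N. c k * \<psi> z ^ k) * (1 / (1 - cnj a * z)) = c 0 * (1 / (1 - cnj a * z)) + H z"
      by (simp add: H_def G_def algebra_simps)
  qed
  have hol: "(\<lambda>z. (\<Sum>k<Suc N. c k * \<psi> z ^ k) * (1 / (1 - cnj a * z))) holomorphic_on unit_disc"
    unfolding eq by (intro holomorphic_on_add holomorphic_on_mult holomorphic_on_const Hh
        szego_kernel_holomorphic a)
  have t: "t k = c 0 * cnj a ^ k + d k" for k
  proof -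
    have K: "taylor_coeff (\<lambda>z. 1 / (1 - cnj a * z)) k = cnj a ^ k"
      using power_series_taylor(2)[OF szego_kernel_sums[OF a(1)]] by simp
    show ?thesis
      unfolding t_def eq d_def
        taylor_coeff_add[OF holomorphic_on_mult[OF holomorphic_on_const
          szego_kernel_holomorphic[OF a(1)]] Hh]
        taylor_coeff_cmult[OF szego_kernel_holomorphic[OF a(1)]] K ..
  qed
  have a2: "(cmod a)\<^sup>2 < 1" using a by (simp add: power_less_one_iff)
  have s1: "(\<lambda>k. (cmod (c 0))\<^sup>2 * ((cmod a)\<^sup>2) ^ k) sums ((cmod (c 0))\<^sup>2 * (1 / (1 - (cmod a)\<^sup>2)))"
    using a2 by (intro sums_mult geometric_sums) simp
  have s2: "(\<lambda>k. 1 * (cmod (d k))\<^sup>2) sums (l2_norm (\<lambda>_. 1) d)\<^sup>2"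
    using d unfolding l2_norm_sq[OF hardy.positive_weight_axioms d] l2_def by (simp add: summable_sums)
  \<comment> \<open>This series collects the cross terms of \<open>(cmod (t k))\<^sup>2\<close>. Its
    sum is governed by \<open>H a\<close>, which is 0, so orthogonality enters as a Taylor series
    evaluated at \<open>a\<close>.\<close>
  have s3: "(\<lambda>k. 2 * Re (cnj (c 0) * (d k * a ^ k))) sums (2 * Re (cnj (c 0) * H a))"
    unfolding d_def by (intro sums_mult sums_Re taylor_sums Hh a)
  have Ha: "H a = 0" using a by (simp add: H_def)
  have "(cmod (t k))\<^sup>2 = (cmod (c 0))\<^sup>2 * ((cmod a)\<^sup>2) ^ k + 1 * (cmod (d k))\<^sup>2
      + 2 * Re (cnj (c 0) * (d k * a ^ k))" for k
  proof -
    have "(cmod (x + y))\<^sup>2 = (cmod x)\<^sup>2 + (cmod y)\<^sup>2 + 2 * Re (cnj x * y)" for x y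
      by (simp only: cmod_power2) (simp add: power2_eq_square algebra_simps)
    from this[of "c 0 * cnj a ^ k" "d k"]
    show ?thesis unfolding t
      by (simp add: norm_mult norm_power power_mult_distrib power_mult[symmetric] mult_ac)
  qed
  then have tsum: "(\<lambda>k. 1 * (cmod (t k))\<^sup>2) sums ((cmod (c 0))\<^sup>2 * (1 / (1 - (cmod a)\<^sup>2)) + (l2_norm (\<lambda>_. 1) d)\<^sup>2)"
    using sums_add[OF sums_add[OF s1 s2] s3] by (simp add: Ha)
  then have tl: "t \<in> l2 (\<lambda>_. 1)" by (auto simp: l2_def sums_iff)
  have "(l2_norm (\<lambda>_. 1) t)\<^sup>2 = (cmod (c 0))\<^sup>2 * (1 / (1 - (cmod a)\<^sup>2)) + (l2_norm (\<lambda>_. 1) d)\<^sup>2"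
    unfolding l2_norm_sq[OF hardy.positive_weight_axioms tl] using tsum by (simp add: sums_iff)
  also have "\<dots> \<le> (cmod (c 0))\<^sup>2 * (1 / (1 - (cmod a)\<^sup>2)) + (\<Sum>k<N. (cmod (c (Suc k)))\<^sup>2) / (1 - (cmod a)\<^sup>2)"
    using order_trans[OF power_mono[OF H(2) hardy.l2_norm_nonneg[OF d], of 2] G(2)] by simp
  also have "\<dots> = (\<Sum>k<Suc N. (cmod (c k))\<^sup>2) / (1 - (cmod a)\<^sup>2)"
    by (simp add: sum.lessThan_Suc_shift add_divide_distrib del: sum.lessThan_Suc)
  finally show ?case using hol tl unfolding H2_iff t_def by blast
qed

lemma holomorphic_compose_disc:
  "f holomorphic_on unit_disc \<Longrightarrow> \<psi> holomorphic_on unit_disc \<Longrightarrow> \<psi> ` unit_disc \<subseteq> unit_disc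
    \<Longrightarrow> (\<lambda>z. f (\<psi> z)) holomorphic_on unit_disc"
  using holomorphic_on_compose_gen[of \<psi> unit_disc f unit_disc] by (simp add: o_def)

text \<open>Compactness keeps the image of a smaller disc away from the circle, so Taylor remainders
  of an outer function are uniform on that image.\<close>

lemma self_map_bound:
  assumes \<psi>: "\<psi> holomorphic_on unit_disc" "\<psi> ` unit_disc \<subseteq> unit_disc" and \<rho>: "0 \<le> \<rho>" "\<rho> < 1"
  obtains r where "0 \<le> r" "r < 1" "\<And>z. cmod z \<le> \<rho> \<Longrightarrow> cmod (\<psi> z) \<le> r"
proof -
  have "continuous_on (cball 0 \<rho>) \<psi>"
    using holomorphic_on_imp_continuous_on[OF \<psi>(1)] by (rule continuous_on_subset) (use \<rho> in auto)
  then have "continuous_on (cball 0 \<rho>) (\<lambda>z. cmod (\<psi> z))" by (intro continuous_intros)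
  then obtain x where x: "x \<in> cball 0 \<rho>" "\<And>z. z \<in> cball 0 \<rho> \<Longrightarrow> cmod (\<psi> z) \<le> cmod (\<psi> x)"
    using continuous_attains_sup[OF compact_cball, of 0 \<rho> "\<lambda>z. cmod (\<psi> z)"] \<rho> by auto
  have "x \<in> unit_disc" using x(1) \<rho> by auto
  then have "cmod (\<psi> x) < 1" using \<psi>(2) by (force simp: image_subset_iff)
  then show thesis using x(2) that[of "cmod (\<psi> x)"] by auto
qed

text \<open>For \<open>a = 0\<close> this is Littlewood subordination; in general the extra factor
  is the Hardy norm of the Szego kernel at \<open>a\<close>. The outer function is truncated to a
  polynomial, and the truncations converge near 0 because \<open>self_map_bound\<close> keeps
  \<open>\<psi> z\<close> in a compact disc there.\<close>

lemma hardy_subordination: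
  assumes \<psi>: "\<psi> holomorphic_on unit_disc" "\<psi> ` unit_disc \<subseteq> unit_disc"
    and a: "cmod a < 1" "\<psi> a = 0" and f: "f \<in> hardy"
  shows "(\<lambda>z. f (\<psi> z) * (1 / (1 - cnj a * z))) \<in> hardy"
    "l2_norm (\<lambda>_. 1) (taylor_coeff (\<lambda>z. f (\<psi> z) * (1 / (1 - cnj a * z))))
      \<le> l2_norm (\<lambda>_. 1) (taylor_coeff f) / sqrt (1 - (cmod a)\<^sup>2)"
proof -
  have fh: "f holomorphic_on unit_disc" and fl: "taylor_coeff f \<in> l2 (\<lambda>_. 1)"
    using f by (auto simp: H2_iff)
  define F where "F = (\<lambda>N z. (\<Sum>k<N. taylor_coeff f k * \<psi> z ^ k) * (1 / (1 - cnj a * z)))"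
  define B where "B = l2_norm (\<lambda>_. 1) (taylor_coeff f) / sqrt (1 - (cmod a)\<^sup>2)"
  have a2: "(cmod a)\<^sup>2 < 1" using a by (simp add: power_less_one_iff)
  have B0: "0 \<le> B" using hardy.l2_norm_nonneg[OF fl] a2 by (simp add: B_def)
  have F: "F N \<in> hardy" "l2_norm (\<lambda>_. 1) (taylor_coeff (F N)) \<le> B" for N
  proof -
    note P = hardy_subordination_polynomial[OF \<psi> a, of "taylor_coeff f" N]
    show "F N \<in> hardy" using P by (simp add: F_def)
    have "(l2_norm (\<lambda>_. 1) (taylor_coeff (F N)))\<^sup>2 \<le> (\<Sum>k<N. 1 * (cmod (taylor_coeff f k))\<^sup>2) / (1 - (cmod a)\<^sup>2)"
      using P by (simp add: F_def)
    also have "\<dots> \<le> (l2_norm (\<lambda>_. 1) (taylor_coeff f))\<^sup>2 / (1 - (cmod a)\<^sup>2)"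
      using a2 by (intro divide_right_mono hardy.partial_le_l2_norm fl) simp
    also have "\<dots> = B\<^sup>2" using a2 by (simp add: B_def power_divide)
    finally show "l2_norm (\<lambda>_. 1) (taylor_coeff (F N)) \<le> B" using B0 power2_le_imp_le by blast
  qed
  obtain r where r: "0 \<le> r" "r < 1" "\<And>z. cmod z \<le> 1/2 \<Longrightarrow> cmod (\<psi> z) \<le> r"
    using self_map_bound[OF \<psi>, of "1/2"] by auto
  define e where "e = (\<lambda>N. ((\<Sum>k. cmod (taylor_coeff f k) * r ^ k)
      - (\<Sum>k<N. cmod (taylor_coeff f k) * r ^ k)) * (1 / (1 - cmod a)))"
  have e: "e \<longlonglongrightarrow> 0"
    unfolding e_def by (rule tendsto_mult_left_zero[OF taylor_remainder_tendsto[OF fh r(1,2)]])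
  have le: "cmod (F N z - f (\<psi> z) * (1 / (1 - cnj a * z))) \<le> e N" if z: "cmod z < 1/2" for N z
  proof -
    have "cmod (F N z - f (\<psi> z) * (1 / (1 - cnj a * z)))
        = cmod (f (\<psi> z) - (\<Sum>k<N. taylor_coeff f k * \<psi> z ^ k)) * (1 / cmod (1 - cnj a * z))"
      unfolding F_def left_diff_distrib[symmetric] norm_mult norm_divide norm_one
      by (simp add: norm_minus_commute)
    also have "\<dots> \<le> e N"
      unfolding e_def
    proof (rule mult_mono)
      show R: "cmod (f (\<psi> z) - (\<Sum>k<N. taylor_coeff f k * \<psi> z ^ k))
        \<le> (\<Sum>k. cmod (taylor_coeff f k) * r ^ k) - (\<Sum>k<N. cmod (taylor_coeff f k) * r ^ k)"
        using z by (intro taylor_remainder[OF fh r(1,2) r(3)]) simp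
      show "0 \<le> (\<Sum>k. cmod (taylor_coeff f k) * r ^ k) - (\<Sum>k<N. cmod (taylor_coeff f k) * r ^ k)"
        using R norm_ge_zero order_trans by blast
      show "1 / cmod (1 - cnj a * z) \<le> 1 / (1 - cmod a)"
        using szego_kernel_bound(1)[OF a(1), of z] z a by (intro frac_le) auto
    qed simp
    finally show ?thesis .
  qed
  have "(\<lambda>z. f (\<psi> z) * (1 / (1 - cnj a * z))) holomorphic_on unit_disc"
    by (rule holomorphic_on_mult[OF holomorphic_compose_disc[OF fh \<psi>] szego_kernel_holomorphic[OF a(1)]])
  note * = hardy_fatou[OF F(1) this le e B0 F(2)]
  show "(\<lambda>z. f (\<psi> z) * (1 / (1 - cnj a * z))) \<in> hardy" by (rule *(1))
  show "l2_norm (\<lambda>_. 1) (taylor_coeff (\<lambda>z. f (\<psi> z) * (1 / (1 - cnj a * z))))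
      \<le> l2_norm (\<lambda>_. 1) (taylor_coeff f) / sqrt (1 - (cmod a)\<^sup>2)"
    using *(2) unfolding B_def .
qed

section \<open>Disc automorphisms and weighted composition on the Hardy space\<close>

definition moebius :: "complex \<Rightarrow> complex \<Rightarrow> complex" where
  "moebius b z = (b - z) / (1 - cnj b * z)"

lemma moebius_identity:
  assumes "cmod b < 1" "cmod z < 1"
  shows "1 - (cmod (moebius b z))\<^sup>2 = (1 - (cmod b)\<^sup>2) * (1 - (cmod z)\<^sup>2) / (cmod (1 - cnj b * z))\<^sup>2"
proof -
  have "(cmod (1 - cnj b * z))\<^sup>2 - (cmod (b - z))\<^sup>2 = (1 - (cmod b)\<^sup>2) * (1 - (cmod z)\<^sup>2)"
    by (simp only: cmod_power2) (simp add: power2_eq_square algebra_simps)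
  then show ?thesis
    using cnj_mult_neq_1[OF assms] by (simp add: moebius_def norm_divide power_divide field_simps)
qed

lemma moebius_less_1:
  assumes "cmod b < 1" "cmod z < 1" shows "cmod (moebius b z) < 1"
proof -
  have "0 < (1 - (cmod b)\<^sup>2) * (1 - (cmod z)\<^sup>2) / (cmod (1 - cnj b * z))\<^sup>2"
    using assms cnj_mult_neq_1[OF assms]
    by (intro divide_pos_pos mult_pos_pos) (auto simp: power_less_one_iff)
  then have "(cmod (moebius b z))\<^sup>2 < 1" using moebius_identity[OF assms] by linarith
  then show ?thesis by (simp add: power_less_one_iff)
qed

lemma moebius_image: "cmod b < 1 \<Longrightarrow> moebius b ` unit_disc \<subseteq> unit_disc"
  using moebius_less_1[of b] by auto

lemma moebius_holomorphic: "cmod b < 1 \<Longrightarrow> moebius b holomorphic_on unit_disc"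
  unfolding moebius_def using cnj_mult_neq_1[of b] by (intro holomorphic_intros) auto

text \<open>With numerator \<open>b - z\<close> the map is an involution exchanging \<open>b\<close>
  and 0, so it is its own inverse when a normalisation of \<phi> has to be undone.\<close>

lemma moebius_moebius:
  assumes "cmod b < 1" "cmod z < 1" shows "moebius b (moebius b z) = z"
proof -
  have n0: "1 - cnj b * z \<noteq> 0" "1 - cnj b * b \<noteq> 0" using assms cnj_mult_neq_1 by blast+
  have num: "b - moebius b z = (1 - cnj b * b) * z / (1 - cnj b * z)"
    using n0 by (simp add: moebius_def field_simps)
  have den: "1 - cnj b * moebius b z = (1 - cnj b * b) / (1 - cnj b * z)"
    using n0 by (simp add: moebius_def field_simps)
  show ?thesis
    using n0 by (subst moebius_def) (simp add: num den)
qed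

lemma moebius_self: "moebius b b = 0"
  by (simp add: moebius_def)

lemma moebius_automorphism: "cmod b < 1 \<Longrightarrow> disc_automorphism (moebius b)"
  unfolding disc_automorphism_def
  using moebius_holomorphic[of b] moebius_image[of b] moebius_moebius[of b]
  by (intro conjI exI[of _ "moebius b"]) auto

text \<open>As \<open>moebius b\<close> vanishes at \<open>b\<close>,
  \<open>hardy_subordination\<close> bounds the composition times the Szego kernel at
  \<open>b\<close>. Multiplying by \<open>1 - cnj b * z\<close>, of modulus at most 2, removes the
  kernel.\<close>

lemma hardy_moebius:
  assumes b: "cmod b < 1" and f: "f \<in> hardy"
  shows "(\<lambda>z. f (moebius b z)) \<in> hardy"
    "l2_norm (\<lambda>_. 1) (taylor_coeff (\<lambda>z. f (moebius b z)))
      \<le> 2 / sqrt (1 - (cmod b)\<^sup>2) * l2_norm (\<lambda>_. 1) (taylor_coeff f)"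
proof -
  let ?g = "\<lambda>z. f (moebius b z) * (1 / (1 - cnj b * z))"
  let ?u = "\<lambda>z. (1 - cnj b * z) * ?g z"
  note s = hardy_subordination[OF moebius_holomorphic[OF b] moebius_image[OF b] b moebius_self f]
  have u: "(\<lambda>z. 1 - cnj b * z) holomorphic_on unit_disc" by (intro holomorphic_intros)
  have bd: "cmod (1 - cnj b * z) \<le> 2" if "z \<in> unit_disc" for z
    using szego_kernel_bound(2)[OF b, of z] that b by simp
  note m = hardy_mult_bounded[OF u bd s(1)]
  have eq: "?u z = f (moebius b z)" if "z \<in> unit_disc" for z
    using cnj_mult_neq_1[OF b, of z] that by simp
  then have tc: "taylor_coeff ?u = taylor_coeff (\<lambda>z. f (moebius b z))"
    by (intro ext taylor_coeff_cong)
  have "f holomorphic_on unit_disc" using f by (simp add: H2_iff)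
  then have "(\<lambda>z. f (moebius b z)) holomorphic_on unit_disc"
    using moebius_holomorphic[OF b] moebius_image[OF b] by (rule holomorphic_compose_disc)
  then show "(\<lambda>z. f (moebius b z)) \<in> hardy" using m(1) unfolding H2_iff tc by simp
  show "l2_norm (\<lambda>_. 1) (taylor_coeff (\<lambda>z. f (moebius b z)))
      \<le> 2 / sqrt (1 - (cmod b)\<^sup>2) * l2_norm (\<lambda>_. 1) (taylor_coeff f)"
    using order_trans[OF m(2) mult_left_mono[OF s(2), of 2]] unfolding tc by simp
qed

text \<open>Following \<phi> by the automorphism that sends \<open>\<phi> a\<close> to 0 gives a map
  vanishing at \<open>a\<close>, as \<open>hardy_subordination\<close> asks; replacing
  \<open>f\<close> by its composition with the same automorphism compensates. The bound splits into
  a factor governed by |\<phi> a| and the norm of the Szego kernel at \<open>a\<close>.\<close>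

lemma hardy_weighted_composition:
  assumes \<phi>: "\<phi> holomorphic_on unit_disc" "\<phi> ` unit_disc \<subseteq> unit_disc"
    and a: "cmod a < 1" and f: "f \<in> hardy"
  shows "(\<lambda>z. f (\<phi> z) * (1 / (1 - cnj a * z))) \<in> hardy"
    "l2_norm (\<lambda>_. 1) (taylor_coeff (\<lambda>z. f (\<phi> z) * (1 / (1 - cnj a * z))))
      \<le> 2 / sqrt (1 - (cmod (\<phi> a))\<^sup>2) * l2_norm (\<lambda>_. 1) (taylor_coeff f) / sqrt (1 - (cmod a)\<^sup>2)"
proof -
  define b where "b = \<phi> a"
  have b: "cmod b < 1" using \<phi>(2) a by (force simp: b_def image_subset_iff)
  define \<psi> where "\<psi> = (\<lambda>z. moebius b (\<phi> z))"
  have \<psi>: "\<psi> holomorphic_on unit_disc" "\<psi> ` unit_disc \<subseteq> unit_disc" "\<psi> a = 0"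
    using holomorphic_compose_disc[OF moebius_holomorphic[OF b] \<phi>] moebius_image[OF b] \<phi>(2)
    by (auto simp: \<psi>_def b_def moebius_self)
  note m = hardy_moebius[OF b f]
  note s = hardy_subordination[OF \<psi>(1,2) a \<psi>(3) m(1)]
  have eq: "f (moebius b (\<psi> z)) * (1 / (1 - cnj a * z)) = f (\<phi> z) * (1 / (1 - cnj a * z))"
    if "z \<in> unit_disc" for z
  proof -
    have "cmod (\<phi> z) < 1" using \<phi>(2) that by (force simp: image_subset_iff)
    then show ?thesis by (simp add: \<psi>_def moebius_moebius[OF b])
  qed
  have tc: "taylor_coeff (\<lambda>z. f (moebius b (\<psi> z)) * (1 / (1 - cnj a * z)))
      = taylor_coeff (\<lambda>z. f (\<phi> z) * (1 / (1 - cnj a * z)))"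
    by (intro ext taylor_coeff_cong eq)
  have "f holomorphic_on unit_disc" using f by (simp add: H2_iff)
  then have "(\<lambda>z. f (\<phi> z) * (1 / (1 - cnj a * z))) holomorphic_on unit_disc"
    by (rule holomorphic_on_mult[OF holomorphic_compose_disc[OF _ \<phi>] szego_kernel_holomorphic[OF a]])
  then show "(\<lambda>z. f (\<phi> z) * (1 / (1 - cnj a * z))) \<in> hardy" using s(1) unfolding H2_iff tc by simp
  have "1 - (cmod a)\<^sup>2 > 0" using a by (simp add: power_less_one_iff)
  then show "l2_norm (\<lambda>_. 1) (taylor_coeff (\<lambda>z. f (\<phi> z) * (1 / (1 - cnj a * z))))
      \<le> 2 / sqrt (1 - (cmod (\<phi> a))\<^sup>2) * l2_norm (\<lambda>_. 1) (taylor_coeff f) / sqrt (1 - (cmod a)\<^sup>2)"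
    using order_trans[OF s(2) divide_right_mono[OF m(2), of "sqrt (1 - (cmod a)\<^sup>2)"]]
    unfolding tc unfolding b_def by simp
qed

section \<open>Weighted power series spaces and the comparison of weights\<close>

definition power_series :: "(nat \<Rightarrow> complex) \<Rightarrow> complex \<Rightarrow> complex" where
  "power_series c z = (\<Sum>k. c k * z ^ k)"

text \<open>\<open>summable_inverse\<close> is the form in which the growth condition on \<beta> is
  used: at \<open>r = (cmod a)\<^sup>2\<close> the series is the squared norm of the reproducing
  kernel at \<open>a\<close>.\<close>

locale disc_weight = positive_weight +
  assumes summable_inverse: "0 \<le> r \<Longrightarrow> r < 1 \<Longrightarrow> summable (\<lambda>k. r ^ k / \<beta> k)"
begin

lemma l2_summable:
  assumes c: "c \<in> l2 \<beta>" and z: "cmod z < 1"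
  shows "summable (\<lambda>k. c k * z ^ k)"
proof (rule summable_comparison_test')
  have z2: "(cmod z)\<^sup>2 < 1" using z by (simp add: power_less_one_iff)
  show "summable (\<lambda>k. \<beta> k * (cmod (c k))\<^sup>2 + ((cmod z)\<^sup>2) ^ k / \<beta> k)"
    using c z2 by (intro summable_add summable_inverse) (simp_all add: l2_def)
  fix k
  \<comment> \<open>The weight is split evenly between coefficient and power, so that
    \<open>x * y \<le> x\<^sup>2 + y\<^sup>2\<close> separates the norm of \<open>c\<close> from the
    kernel series.\<close>
  define x y where "x = sqrt (\<beta> k) * cmod (c k)" and "y = cmod z ^ k / sqrt (\<beta> k)"
  have "0 \<le> x * y" using pos[of k] by (simp add: x_def y_def)
  then have "x * y \<le> x\<^sup>2 + y\<^sup>2"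
    using sum_squares_bound[of x y] by linarith
  moreover have "x * y = cmod (c k * z ^ k)"
    using pos[of k] by (simp add: x_def y_def norm_mult norm_power)
  moreover have "x\<^sup>2 = \<beta> k * (cmod (c k))\<^sup>2" "y\<^sup>2 = ((cmod z)\<^sup>2) ^ k / \<beta> k"
    using pos[of k] by (simp_all add: x_def y_def power_mult_distrib power_divide power_mult[symmetric] mult.commute)
  ultimately show "norm (c k * z ^ k) \<le> \<beta> k * (cmod (c k))\<^sup>2 + ((cmod z)\<^sup>2) ^ k / \<beta> k" by simp
qed

lemma power_series_sums:
  "c \<in> l2 \<beta> \<Longrightarrow> cmod z < 1 \<Longrightarrow> (\<lambda>k. c k * z ^ k) sums power_series c z"
  unfolding power_series_def using l2_summable by (simp add: summable_sums)

lemma taylor_coeff_power_series: "c \<in> l2 \<beta> \<Longrightarrow> taylor_coeff (power_series c) = c"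
  using power_series_taylor(2) power_series_sums by blast

lemma power_series_mem_H2: "c \<in> l2 \<beta> \<Longrightarrow> power_series c \<in> H2 \<beta>"
  using power_series_taylor(1)[OF power_series_sums] by (simp add: H2_iff taylor_coeff_power_series)

lemma power_series_taylor_coeff: "f \<in> H2 \<beta> \<Longrightarrow> cmod z < 1 \<Longrightarrow> power_series (taylor_coeff f) z = f z"
  unfolding power_series_def using taylor_sums[of f z] by (simp add: H2_iff sums_iff)

end

lemma disc_weight_one: "disc_weight (\<lambda>_. 1)"
  by unfold_locales (simp_all add: summable_geometric)

interpretation hardy: disc_weight "\<lambda>_. 1"
  by (rule disc_weight_one)

text \<open>\<open>a k\<close> collects the masses \<open>(1/2) ^ i\<close> over the fibre of
  \<open>n\<close> at \<open>k\<close>. The positions of the humps may thus repeat and come in any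
  order, and the total mass is still at most 2.\<close>

lemma summable_dominating:
  fixes n :: "nat \<Rightarrow> nat"
  shows "\<exists>a :: nat \<Rightarrow> real. (\<forall>k. 0 \<le> a k) \<and> summable a \<and> (\<forall>i. (1/2) ^ i \<le> a (n i))"
proof -
  define t where "t = (\<lambda>k i. if n i = k then (1/2::real) ^ i else 0)"
  define a where "a = (\<lambda>k. \<Sum>i. t k i)"
  have g: "summable (\<lambda>i. (1/2::real) ^ i)" by (rule summable_geometric) simp
  have t: "summable (t k)" for k
    by (rule summable_comparison_test'[OF g]) (simp add: t_def)
  have t0: "0 \<le> t k i" for k i by (simp add: t_def)
  have a0: "0 \<le> a k" for k unfolding a_def by (intro suminf_nonneg t t0)
  have an: "(1/2) ^ i \<le> a (n i)" for i
    using sum_le_suminf[OF t, of "{i}" "n i"] t0 unfolding a_def by (simp add: t_def)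
  have "summable a"
  proof (rule summableI_nonneg_bounded[OF a0])
    fix K
    have "(\<Sum>k<K. a k) = (\<Sum>i. \<Sum>k<K. t k i)"
      unfolding a_def using t by (intro suminf_sum[symmetric]) simp
    also have "\<dots> \<le> (\<Sum>i. (1/2) ^ i)"
    proof (rule suminf_le)
      show "(\<Sum>k<K. t k i) \<le> (1/2) ^ i" for i
        unfolding t_def by (simp add: sum.delta')
    qed (rule summable_sum[OF t] g)+
    finally show "(\<Sum>k<K. a k) \<le> (\<Sum>i. (1/2) ^ i)" .
  qed
  with a0 an show ?thesis by blast
qed

text \<open>A gliding hump argument. The humps have nonnegative Taylor coefficients, so they cannot cancel.\<close>

lemma (in disc_weight) weight_almost_decreasing:
  assumes "H_infinity \<subseteq> multipliers (H2 \<beta>)"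
  obtains C where "C > 0" "\<And>n k. \<beta> (n + k) \<le> C * \<beta> k"
proof (rule ccontr)
  assume "\<not> thesis"
  \<comment> \<open>The humps of \<open>w\<close> and \<open>f\<close> have size
    \<open>(1/2) ^ i\<close> up to the weight, so their product has squared size
    \<open>(1/16) ^ i\<close>; the factor \<open>32 ^ i\<close> leaves a growth of
    \<open>2 ^ i\<close>.\<close>
  then have "\<exists>n k. \<beta> (n + k) > 32 ^ i * \<beta> k" for i :: nat
    using that[of "32 ^ i"] by (meson linorder_not_less zero_less_numeral zero_less_power)
  then obtain n k where nk: "\<And>i::nat. \<beta> (n i + k i) > 32 ^ i * \<beta> (k i)" by metis
  from summable_dominating[of n] obtain a :: "nat \<Rightarrow> real"
    where "(\<forall>k. 0 \<le> a k) \<and> summable a \<and> (\<forall>i. (1/2) ^ i \<le> a (n i))" ..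
  then have a: "\<And>k. 0 \<le> a k" "summable a" "\<And>i. (1/2) ^ i \<le> a (n i)" by auto
  from summable_dominating[of k] obtain b :: "nat \<Rightarrow> real"
    where "(\<forall>k. 0 \<le> b k) \<and> summable b \<and> (\<forall>i. (1/2) ^ i \<le> b (k i))" ..
  then have b: "\<And>k. 0 \<le> b k" "summable b" "\<And>i. (1/2) ^ i \<le> b (k i)" by auto
  define w where "w = power_series (\<lambda>k. complex_of_real (a k))"
  \<comment> \<open>Dividing by the root of the weight turns the squared norm of \<open>f\<close>
    into the sum of the squares of \<open>b\<close>.\<close>
  define c where "c = (\<lambda>k. b k / sqrt (\<beta> k))"
  have c0: "0 \<le> c k" for k using b(1)[of k] pos[of k] by (simp add: c_def)
  have an: "summable (\<lambda>k. cmod (complex_of_real (a k) * z ^ k))" if "cmod z < 1" for z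
    by (rule summable_comparison_test'[OF a(2)])
       (use a(1) that in \<open>simp add: norm_mult norm_power mult_left_le power_le_one\<close>)
  have ws: "(\<lambda>k. complex_of_real (a k) * z ^ k) sums w z" if "cmod z < 1" for z
    unfolding w_def power_series_def by (rule summable_sums[OF summable_norm_cancel[OF an[OF that]]])
  note wt = power_series_taylor[OF ws]
  have "cmod (w z) \<le> suminf a" if "z \<in> unit_disc" for z
  proof -
    have z: "cmod z < 1" using that by simp
    have "cmod (w z) \<le> (\<Sum>k. cmod (complex_of_real (a k) * z ^ k))"
      unfolding w_def power_series_def by (rule summable_norm[OF an[OF z]])
    also have "\<dots> \<le> suminf a"
      by (rule suminf_le[OF _ an[OF z] a(2)])
         (use a(1) z in \<open>simp add: norm_mult norm_power mult_left_le power_le_one\<close>)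
    finally show ?thesis .
  qed
  then have "w \<in> H_infinity" using wt(1)
    by (auto simp: H_infinity_def bounded_iff intro!: exI[of _ "suminf a"])
  have "summable (\<lambda>k. (b k)\<^sup>2)"
  proof (rule summable_comparison_test_ev[OF _ b(2)])
    have "\<forall>\<^sub>F k in sequentially. b k < 1"
      using summable_LIMSEQ_zero[OF b(2)] by (rule order_tendstoD) simp
    then show "\<forall>\<^sub>F k in sequentially. norm ((b k)\<^sup>2) \<le> b k"
      by eventually_elim (use b(1) in \<open>simp add: power2_eq_square mult_left_le\<close>)
  qed
  moreover have "\<beta> k * (cmod (complex_of_real (c k)))\<^sup>2 = (b k)\<^sup>2" for k
    using pos[of k] b(1)[of k] by (simp add: c_def power_divide norm_divide)
  ultimately have cl: "(\<lambda>k. complex_of_real (c k)) \<in> l2 \<beta>" by (simp add: l2_def)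
  define f where "f = power_series (\<lambda>k. complex_of_real (c k))"
  have f: "f \<in> H2 \<beta>" "taylor_coeff f = (\<lambda>k. complex_of_real (c k))"
    using power_series_mem_H2[OF cl] taylor_coeff_power_series[OF cl] by (auto simp: f_def)
  have wf: "(\<lambda>z. w z * f z) \<in> H2 \<beta>"
    using assms \<open>w \<in> H_infinity\<close> f(1) unfolding multipliers_def by blast
  define t where "t = taylor_coeff (\<lambda>z. w z * f z)"
  have tl: "t \<in> l2 \<beta>" using wf by (simp add: H2_iff t_def)
  have fh: "f holomorphic_on unit_disc" using f(1) by (simp add: H2_iff)
  have tm: "t m = complex_of_real (\<Sum>i\<le>m. a i * c (m - i))" for m
    using taylor_coeff_mult[OF wt(1) fh, of m] by (simp add: t_def wt(2) f(2))
  have "2 ^ i \<le> (l2_norm \<beta> t)\<^sup>2" for i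
  proof -
    define m where "m = n i + k i"
    have "(1/4::real) ^ i = (1/2) ^ i * (1/2) ^ i" by (subst power_mult_distrib[symmetric]) simp
    then have "(1/4) ^ i / sqrt (\<beta> (k i)) = (1/2) ^ i * ((1/2) ^ i / sqrt (\<beta> (k i)))"
      by simp
    also have "\<dots> \<le> a (n i) * c (m - n i)"
      using a b pos[of "k i"] unfolding c_def m_def
      by (intro mult_mono) (auto intro!: divide_right_mono)
    also have "\<dots> \<le> (\<Sum>i\<le>m. a i * c (m - i))"
      using a(1) c0 by (intro member_le_sum) (auto simp: m_def)
    finally have le: "(1/4) ^ i / sqrt (\<beta> (k i)) \<le> cmod (t m)"
      unfolding tm norm_of_real by (rule order_trans[OF _ abs_ge_self])
    have two: "(2::real) ^ i = (1/16) ^ i * 32 ^ i" by (subst power_mult_distrib[symmetric]) simp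
    have sixteen: "((1/4::real) ^ i)\<^sup>2 = (1/16) ^ i"
      by (subst power_mult[symmetric], subst mult.commute, subst power_mult) (simp add: power2_eq_square)
    have "2 ^ i = (1/16) ^ i / \<beta> (k i) * (32 ^ i * \<beta> (k i))"
      unfolding two using pos[of "k i"] by simp
    also have "\<dots> \<le> (1/16) ^ i / \<beta> (k i) * \<beta> m"
      using nk[of i] pos[of "k i"] unfolding m_def by (intro mult_left_mono) auto
    also have "\<dots> = \<beta> m * ((1/4) ^ i / sqrt (\<beta> (k i)))\<^sup>2"
    proof -
      have "((1/4) ^ i / sqrt (\<beta> (k i)))\<^sup>2 = ((1/4) ^ i)\<^sup>2 / \<beta> (k i)"
        by (subst power_divide) (use pos[of "k i"] in simp)
      then show ?thesis unfolding sixteen by simp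
    qed
    also have "\<dots> \<le> \<beta> m * (cmod (t m))\<^sup>2"
      using le pos[of m] pos[of "k i"] by (intro mult_left_mono power_mono) auto
    also have "\<dots> \<le> (\<Sum>k<Suc m. \<beta> k * (cmod (t k))\<^sup>2)"
      by (rule member_le_sum) auto
    also have "\<dots> \<le> (l2_norm \<beta> t)\<^sup>2" by (rule partial_le_l2_norm[OF tl])
    finally show ?thesis .
  qed
  moreover obtain i where "(l2_norm \<beta> t)\<^sup>2 < 2 ^ i" using real_arch_pow[of 2] by auto
  ultimately show False by (meson linorder_not_less)
qed

text \<open>Summation by parts: for decreasing nonnegative weights, the weighted sum of
  \<open>y i - x i\<close> is a nonnegative combination of its unweighted partial sums.\<close>

lemma sum_decreasing_weight_mono:
  fixes b x y :: "nat \<Rightarrow> real"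
  assumes "decseq b" "\<And>k. 0 \<le> b k" "\<And>n. (\<Sum>i<n. x i) \<le> (\<Sum>i<n. y i)"
  shows "(\<Sum>i<n. b i * x i) \<le> (\<Sum>i<n. b i * y i)"
proof -
  define d where "d = (\<lambda>i. y i - x i)"
  have D: "0 \<le> (\<Sum>i<n. d i)" for n using assms(3) by (simp add: d_def sum_subtractf)
  \<comment> \<open>Strengthened so that the induction closes: on the left the whole partial sum
    carries the smallest weight so far.\<close>
  have "b n * (\<Sum>i<Suc n. d i) \<le> (\<Sum>i<Suc n. b i * d i)" for n
  proof (induction n)
    case (Suc n)
    have "b (Suc n) * (\<Sum>i<Suc n. d i) \<le> b n * (\<Sum>i<Suc n. d i)"
      by (rule mult_right_mono[OF decseq_SucD[OF assms(1)] D])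
    with Suc show ?case by (simp add: algebra_simps)
  qed simp
  then have "0 \<le> (\<Sum>i<Suc n. b i * d i)" for n
    using D assms(2) by (meson mult_nonneg_nonneg order_trans)
  then have "0 \<le> (\<Sum>i<n. b i * d i)" by (cases n) auto
  then show ?thesis by (simp add: d_def algebra_simps sum_subtractf)
qed

text \<open>Abel summation replaces Kacnelson's theorem on the subordination of weights: for a lower
  triangular matrix, the first \<open>n\<close> coefficients of the image depend only on the first \<open>n\<close>
  coefficients of the argument, so its bound on the unweighted space holds for every section.\<close>

lemma (in disc_weight) weighted_composition_transfer:
  assumes w: "w holomorphic_on unit_disc"
    and \<psi>: "\<psi> holomorphic_on unit_disc" "\<psi> 0 = 0"
    and \<psi>d: "\<psi> ` unit_disc \<subseteq> unit_disc"
    and hardy: "\<And>f. f \<in> hardy \<Longrightarrow> (\<lambda>z. w z * f (\<psi> z)) \<in> hardy"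
    and C0: "C0 > 0" "\<And>n k. \<beta> (n + k) \<le> C0 * \<beta> k"
    and f: "f \<in> H2 \<beta>"
  shows "(\<lambda>z. w z * f (\<psi> z)) \<in> H2 \<beta>"
proof -
  define m where "m = (\<lambda>i j. taylor_coeff (\<lambda>z. w z * \<psi> z ^ j) i)"
  define T where "T = (\<lambda>c i. \<Sum>j\<le>i. c j * m i j)"
  have TC: "taylor_coeff (\<lambda>z. w z * f (\<psi> z)) = T (taylor_coeff f)"
    if "f holomorphic_on unit_disc" for f
    unfolding T_def m_def using taylor_coeff_weighted_composition[OF w that \<psi>] by blast
  \<comment> \<open>Truncated norms of the image stand in for the closed graph theorem: each is
    continuous because it involves finitely many coefficients, and the hypothesis on the Hardy space
    bounds them pointwise.\<close>
  define p where "p = (\<lambda>n c. L2_set (\<lambda>i. cmod (T c i)) {..<n::nat})"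
  have "\<exists>C\<ge>0. \<forall>n. \<forall>c\<in>l2 (\<lambda>_. 1). p n c \<le> C * l2_norm (\<lambda>_. 1) c"
  proof (rule hardy.uniform_boundedness)
    fix n and x y :: "nat \<Rightarrow> complex"
    have "T (\<lambda>k. x k + y k) i = T x i + T y i" for i
      by (simp add: T_def sum.distrib distrib_right)
    then have "p n (\<lambda>k. x k + y k) \<le> L2_set (\<lambda>i. cmod (T x i) + cmod (T y i)) {..<n}"
      unfolding p_def by (intro L2_set_mono) (auto intro: norm_triangle_ineq)
    also have "\<dots> \<le> p n x + p n y" unfolding p_def by (rule L2_set_triangle_ineq)
    finally show "p n (\<lambda>k. x k + y k) \<le> p n x + p n y" .
  next
    fix n s and x :: "nat \<Rightarrow> complex"
    have "T (\<lambda>k. s * x k) i = s * T x i" for i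
      by (simp add: T_def sum_distrib_left mult.assoc)
    then show "p n (\<lambda>k. s * x k) = cmod s * p n x"
      unfolding p_def by (simp add: norm_mult L2_set_right_distrib)
  next
    fix n
    have "p n x \<le> (\<Sum>i<n. \<Sum>j\<le>i. cmod (m i j)) * l2_norm (\<lambda>_. 1) x" if x: "x \<in> l2 (\<lambda>_. 1)" for x
    proof -
      have "p n x \<le> (\<Sum>i<n. cmod (T x i))" unfolding p_def by (intro L2_set_le_sum) auto
      also have "\<dots> \<le> (\<Sum>i<n. \<Sum>j\<le>i. l2_norm (\<lambda>_. 1) x * cmod (m i j))"
        unfolding T_def using hardy.cmod_le_l2_norm[OF x]
        by (intro sum_mono sum_norm_le) (simp add: norm_mult mult_right_mono)
      finally show ?thesis by (simp add: sum_distrib_left sum_distrib_right mult.commute)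
    qed
    then show "\<exists>C. \<forall>x\<in>l2 (\<lambda>_. 1). p n x \<le> C * l2_norm (\<lambda>_. 1) x" by blast
  next
    fix x assume x: "x \<in> l2 (\<lambda>_. 1)"
    let ?g = "\<lambda>z. w z * power_series x (\<psi> z)"
    have g: "?g \<in> hardy" by (intro hardy hardy.power_series_mem_H2 x)
    have "taylor_coeff ?g = T x"
      using TC[of "power_series x"] hardy.power_series_mem_H2[OF x] hardy.taylor_coeff_power_series[OF x]
      by (simp add: H2_iff)
    then have "T x \<in> l2 (\<lambda>_. 1)" using g by (simp add: H2_iff)
    from hardy.L2_set_le_l2_norm[OF this] have "p n x \<le> l2_norm (\<lambda>_. 1) (T x)" for n
      unfolding p_def by simp
    then show "\<exists>B. \<forall>n. p n x \<le> B" by blast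
  qed
  then obtain C where C: "C \<ge> 0" "\<And>n c. c \<in> l2 (\<lambda>_. 1) \<Longrightarrow> p n c \<le> C * l2_norm (\<lambda>_. 1) c" by blast
  \<comment> \<open>Here \<open>c\<close> is an arbitrary sequence, since the coefficients of
    \<open>f\<close> lie in \<open>l2 \<beta>\<close> and perhaps not in the unweighted space.
    Cutting \<open>c\<close> off at \<open>n\<close> leaves the first \<open>n\<close> entries of
    \<open>T c\<close> unchanged.\<close>
  have sections: "(\<Sum>i<n. (cmod (T c i))\<^sup>2) \<le> (\<Sum>i<n. C\<^sup>2 * (cmod (c i))\<^sup>2)" for n c
  proof -
    define c' where "c' = (\<lambda>i. if i < n then c i else 0)"
    have s: "(\<lambda>i. 1 * (cmod (c' i))\<^sup>2) sums (\<Sum>i<n. 1 * (cmod (c' i))\<^sup>2)"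
      by (rule sums_finite) (auto simp: c'_def)
    then have c': "c' \<in> l2 (\<lambda>_. 1)" by (auto simp: l2_def sums_iff)
    have n2: "(l2_norm (\<lambda>_. 1) c')\<^sup>2 = (\<Sum>i<n. (cmod (c i))\<^sup>2)"
      unfolding l2_norm_sq[OF hardy.positive_weight_axioms c'] using s by (simp add: sums_iff c'_def)
    have "(\<Sum>i<n. (cmod (T c i))\<^sup>2) = (\<Sum>i<n. (cmod (T c' i))\<^sup>2)"
      by (intro sum.cong refl arg_cong[where f="\<lambda>x. (cmod x)\<^sup>2"]) (simp add: T_def c'_def)
    also have "\<dots> = (p n c')\<^sup>2" by (simp add: p_def L2_set_def sum_nonneg)
    also have "\<dots> \<le> (C * l2_norm (\<lambda>_. 1) c')\<^sup>2"
      using C(2)[OF c', of n] by (intro power_mono) (simp_all add: p_def)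
    also have "\<dots> = (\<Sum>i<n. C\<^sup>2 * (cmod (c i))\<^sup>2)"
      by (simp add: power_mult_distrib n2 sum_distrib_left)
    finally show ?thesis .
  qed
  \<comment> \<open>The least decreasing majorant of \<beta>; by the almost monotonicity of \<beta>,
    passing to it and back costs the single factor \<open>C0\<close>.\<close>
  define \<gamma> where "\<gamma> = (\<lambda>k. SUP n. \<beta> (n + k))"
  have bdd: "bdd_above (range (\<lambda>n. \<beta> (n + k)))" for k using C0(2) by (intro bdd_aboveI2)
  have \<gamma>l: "\<beta> k \<le> \<gamma> k" for k unfolding \<gamma>_def using cSUP_upper[OF _ bdd[of k], of 0] by simp
  have \<gamma>u: "\<gamma> k \<le> C0 * \<beta> k" for k unfolding \<gamma>_def by (rule cSUP_least) (use C0 in auto)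
  have \<gamma>d: "decseq \<gamma>"
  proof (rule decseq_SucI)
    fix k
    have "\<beta> (n + Suc k) \<le> \<gamma> k" for n
      unfolding \<gamma>_def using cSUP_upper[OF _ bdd[of k], of "Suc n"] by simp
    then show "\<gamma> (Suc k) \<le> \<gamma> k" by (subst \<gamma>_def) (auto intro: cSUP_least)
  qed
  have \<gamma>0: "0 \<le> \<gamma> k" for k using \<gamma>l[of k] pos[of k] by linarith
  have fh: "f holomorphic_on unit_disc" and c: "taylor_coeff f \<in> l2 \<beta>" using f by (auto simp: H2_iff)
  let ?c = "taylor_coeff f"
  have "(\<Sum>i<n. \<beta> i * (cmod (T ?c i))\<^sup>2) \<le> (C * sqrt C0 * l2_norm \<beta> ?c)\<^sup>2" for n
  proof -
    have "(\<Sum>i<n. \<beta> i * (cmod (T ?c i))\<^sup>2) \<le> (\<Sum>i<n. \<gamma> i * (cmod (T ?c i))\<^sup>2)"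
      using \<gamma>l by (intro sum_mono mult_right_mono) auto
    also have "\<dots> \<le> (\<Sum>i<n. \<gamma> i * (C\<^sup>2 * (cmod (?c i))\<^sup>2))"
      by (rule sum_decreasing_weight_mono[OF \<gamma>d \<gamma>0 sections])
    also have "\<dots> \<le> (\<Sum>i<n. (C0 * \<beta> i) * (C\<^sup>2 * (cmod (?c i))\<^sup>2))"
      using \<gamma>u by (intro sum_mono mult_right_mono) auto
    also have "\<dots> = C0 * C\<^sup>2 * (\<Sum>i<n. \<beta> i * (cmod (?c i))\<^sup>2)"
      by (simp add: sum_distrib_left mult_ac)
    also have "\<dots> \<le> C0 * C\<^sup>2 * (l2_norm \<beta> ?c)\<^sup>2"
      using C0 by (intro mult_left_mono partial_le_l2_norm c) auto
    finally show ?thesis using C0 by (simp add: power_mult_distrib mult_ac)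
  qed
  then have "T ?c \<in> l2 \<beta>"
    using l2_norm_nonneg[OF c] C(1) C0 by (intro l2_normI(1)[of "C * sqrt C0 * l2_norm \<beta> ?c"]) auto
  moreover have "(\<lambda>z. w z * f (\<psi> z)) holomorphic_on unit_disc"
    by (rule holomorphic_on_mult[OF w holomorphic_compose_disc[OF fh \<psi>(1) \<psi>d]])
  ultimately show ?thesis by (simp add: H2_iff TC[OF fh])
qed

text \<open>The automorphism acts on both spaces: \<open>hardy_moebius\<close> carries the
  hypothesis on \<open>w\<close> from \<phi> to the normalised \<psi>, and its action on
  \<open>H2 \<beta>\<close>, granted by admissibility, carries the conclusion back to
  \<phi>.\<close>

theorem (in disc_weight) cond_multipliers_hardy_subset:
  assumes \<phi>: "\<phi> holomorphic_on unit_disc" "\<phi> ` unit_disc \<subseteq> unit_disc"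
    and adm: "admissible (H2 \<beta>) (H2_inner \<beta>)"
  shows "cond_multipliers hardy \<phi> \<subseteq> cond_multipliers (H2 \<beta>) \<phi>"
proof
  fix w assume w: "w \<in> cond_multipliers hardy \<phi>"
  define b where "b = \<phi> 0"
  have b: "cmod b < 1" using \<phi>(2) by (force simp: b_def image_subset_iff)
  define \<psi> where "\<psi> = (\<lambda>z. moebius b (\<phi> z))"
  have \<psi>: "\<psi> holomorphic_on unit_disc" "\<psi> ` unit_disc \<subseteq> unit_disc" "\<psi> 0 = 0"
    using holomorphic_compose_disc[OF moebius_holomorphic[OF b] \<phi>] moebius_image[OF b] \<phi>(2)
    by (auto simp: \<psi>_def b_def moebius_self)
  have sub: "hardy \<subseteq> H2 \<beta>" and mult: "multipliers (H2 \<beta>) = H_infinity"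
    and aut: "\<And>\<tau>. disc_automorphism \<tau> \<Longrightarrow> bounded_composition_operator (H2 \<beta>) (H2_inner \<beta>) \<tau>"
    using adm unfolding admissible_def by blast+
  obtain C where C: "C > 0" "\<And>n k. \<beta> (n + k) \<le> C * \<beta> k"
    by (rule weight_almost_decreasing) (auto simp: mult)
  have wh: "w \<in> hardy" and wm: "\<And>f. f \<in> hardy \<Longrightarrow> (\<lambda>z. w z * f (\<phi> z)) \<in> hardy"
    using w by (auto simp: cond_multipliers_def)
  have w_hol: "w holomorphic_on unit_disc" using wh by (simp add: H2_iff)
  have tr: "(\<lambda>z. w z * f (\<psi> z)) \<in> hardy" if "f \<in> hardy" for f
    using wm[OF hardy_moebius(1)[OF b that]] by (simp add: \<psi>_def)
  have "(\<lambda>z. w z * f (\<phi> z)) \<in> H2 \<beta>" if f: "f \<in> H2 \<beta>" for f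
  proof -
    have fh: "f holomorphic_on unit_disc" using f by (simp add: H2_iff)
    have "f \<circ> moebius b \<in> H2 \<beta>"
      using aut[OF moebius_automorphism[OF b]] f by (simp add: bounded_composition_operator_def)
    from weighted_composition_transfer[OF w_hol \<psi>(1,3,2) tr C this]
    have "(\<lambda>z. w z * (f \<circ> moebius b) (\<psi> z)) \<in> H2 \<beta>" .
    moreover have "w z * (f \<circ> moebius b) (\<psi> z) = w z * f (\<phi> z)" if "z \<in> unit_disc" for z
    proof -
      have "cmod (\<phi> z) < 1" using \<phi>(2) that by (force simp: image_subset_iff)
      then show ?thesis by (simp add: \<psi>_def moebius_moebius[OF b])
    qed
    then have "taylor_coeff (\<lambda>z. w z * (f \<circ> moebius b) (\<psi> z)) = taylor_coeff (\<lambda>z. w z * f (\<phi> z))"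
      by (intro ext taylor_coeff_cong)
    moreover have "(\<lambda>z. w z * f (\<phi> z)) holomorphic_on unit_disc"
      by (rule holomorphic_on_mult[OF w_hol holomorphic_compose_disc[OF fh \<phi>]])
    ultimately show ?thesis by (simp add: H2_iff)
  qed
  then show "w \<in> cond_multipliers (H2 \<beta>) \<phi>"
    using wh sub by (auto simp: cond_multipliers_def)
qed

section \<open>Reproducing kernels\<close>

context disc_weight
begin

definition kernel_coeff :: "complex \<Rightarrow> nat \<Rightarrow> complex" where
  "kernel_coeff a k = cnj a ^ k / of_real (\<beta> k)"

definition kernel_norm :: "complex \<Rightarrow> real" where
  "kernel_norm a = sqrt (\<Sum>k. ((cmod a)\<^sup>2) ^ k / \<beta> k)"

lemma kernel_summable: "cmod a < 1 \<Longrightarrow> summable (\<lambda>k. ((cmod a)\<^sup>2) ^ k / \<beta> k)"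
  by (intro summable_inverse) (auto simp: power_less_one_iff)

lemma kernel_coeff_sq: "\<beta> k * (cmod (kernel_coeff a k))\<^sup>2 = ((cmod a)\<^sup>2) ^ k / \<beta> k"
proof -
  have "(cmod (kernel_coeff a k))\<^sup>2 = ((cmod a)\<^sup>2) ^ k / (\<beta> k)\<^sup>2"
    by (simp add: kernel_coeff_def norm_divide norm_power power_divide power_mult[symmetric] mult.commute)
  then show ?thesis using pos[of k] by (simp add: power2_eq_square)
qed

lemma kernel_coeff_l2: "cmod a < 1 \<Longrightarrow> kernel_coeff a \<in> l2 \<beta>"
  by (simp add: l2_def kernel_coeff_sq kernel_summable)

lemma l2_norm_kernel: "l2_norm \<beta> (kernel_coeff a) = kernel_norm a"
  by (simp add: l2_norm_def kernel_norm_def kernel_coeff_sq)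

lemma kernel_norm_pos:
  assumes "cmod a < 1" shows "kernel_norm a > 0"
  unfolding kernel_norm_def
  using suminf_pos2[OF kernel_summable[OF assms], of 0] pos by (simp add: less_imp_le)

lemma kernel_value:
  assumes "cmod a < 1" shows "power_series (kernel_coeff a) a = of_real ((kernel_norm a)\<^sup>2)"
proof -
  have "kernel_coeff a k * a ^ k = of_real (((cmod a)\<^sup>2) ^ k / \<beta> k)" for k
  proof -
    have "cnj a ^ k * a ^ k = of_real (((cmod a)\<^sup>2) ^ k)"
      unfolding power_mult_distrib[symmetric] of_real_power[of "(cmod a)\<^sup>2"] complex_norm_square
      by (simp add: mult.commute)
    then show ?thesis by (simp add: kernel_coeff_def)
  qed
  then have "power_series (kernel_coeff a) a = of_real (\<Sum>k. ((cmod a)\<^sup>2) ^ k / \<beta> k)"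
    unfolding power_series_def by (simp only: suminf_of_real[OF kernel_summable[OF assms]])
  moreover have "0 \<le> (\<Sum>k. ((cmod a)\<^sup>2) ^ k / \<beta> k)"
    using pos by (intro suminf_nonneg kernel_summable[OF assms]) (simp add: less_imp_le)
  ultimately show ?thesis unfolding kernel_norm_def by (simp del: of_real_power)
qed

lemma evaluation_bound:
  assumes c: "c \<in> l2 \<beta>" and z: "cmod z < 1"
  shows "cmod (power_series c z) \<le> l2_norm \<beta> c * kernel_norm z"
proof (rule LIMSEQ_le_const2)
  show "(\<lambda>n. cmod (\<Sum>k<n. c k * z ^ k)) \<longlonglongrightarrow> cmod (power_series c z)"
    using power_series_sums[OF c z] unfolding sums_def by (rule tendsto_norm)
  have "cmod (\<Sum>k<n. c k * z ^ k) \<le> l2_norm \<beta> c * kernel_norm z" for n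
  proof -
    let ?x = "\<lambda>k. sqrt (\<beta> k) * cmod (c k)" and ?y = "\<lambda>k. sqrt (\<beta> k) * cmod (kernel_coeff z k)"
    have "cmod (\<Sum>k<n. c k * z ^ k) \<le> (\<Sum>k<n. \<bar>?x k\<bar> * \<bar>?y k\<bar>)"
    proof (rule sum_norm_le)
      fix k
      have "\<bar>?x k\<bar> * \<bar>?y k\<bar> = cmod (c k * z ^ k)"
      proof -
        have "\<bar>?x k\<bar> * \<bar>?y k\<bar> = (sqrt (\<beta> k) * sqrt (\<beta> k)) * (cmod (c k) * cmod (kernel_coeff z k))"
          using pos[of k] by (simp add: abs_mult mult_ac)
        then show ?thesis
          using pos[of k] by (simp add: kernel_coeff_def norm_mult norm_divide norm_power)
      qed
      then show "norm (c k * z ^ k) \<le> \<bar>?x k\<bar> * \<bar>?y k\<bar>" by simp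
    qed
    also have "\<dots> \<le> L2_set ?x {..<n} * L2_set ?y {..<n}" by (rule L2_set_mult_ineq)
    also have "\<dots> \<le> l2_norm \<beta> c * kernel_norm z"
      unfolding l2_norm_kernel[symmetric] using l2_norm_nonneg[OF c]
      by (intro mult_mono L2_set_le_l2_norm c kernel_coeff_l2 z) auto
    finally show ?thesis .
  qed
  then show "\<exists>N. \<forall>n\<ge>N. cmod (\<Sum>k<n. c k * z ^ k) \<le> l2_norm \<beta> c * kernel_norm z" by blast
qed

lemma H2_inner_kernel:
  assumes f: "f \<in> H2 \<beta>" and a: "cmod a < 1"
  shows "H2_inner \<beta> f (power_series (kernel_coeff a)) = f a"
proof -
  have "of_real (\<beta> k) * taylor_coeff f k * cnj (kernel_coeff a k) = taylor_coeff f k * a ^ k" for k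
    using pos[of k] by (simp add: kernel_coeff_def)
  then have "H2_inner \<beta> f (power_series (kernel_coeff a)) = power_series (taylor_coeff f) a"
    unfolding H2_inner_def power_series_def[of "taylor_coeff f"]
      taylor_coeff_power_series[OF kernel_coeff_l2[OF a]] by (simp only:)
  then show ?thesis using power_series_taylor_coeff[OF f a] by simp
qed

text \<open>\<open>repr_kernel\<close> is a choice among functions that agree on the disc. Testing
  it and the explicit kernel against each other identifies the norm without identifying the
  functions.\<close>

lemma norm_repr_kernel:
  assumes adm: "admissible (H2 \<beta>) (H2_inner \<beta>)" and a: "cmod a < 1"
  shows "inner_norm (H2_inner \<beta>) (repr_kernel (H2 \<beta>) (H2_inner \<beta>) a) = kernel_norm a"
proof -
  interpret analytic_hilbert_space "H2 \<beta>" "H2_inner \<beta>" using adm by (simp add: admissible_def)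
  define E where "E = power_series (kernel_coeff a)"
  define K where "K = repr_kernel (H2 \<beta>) (H2_inner \<beta>) a"
  have E: "E \<in> H2 \<beta>" "\<And>f. f \<in> H2 \<beta> \<Longrightarrow> f a = H2_inner \<beta> f E"
    using power_series_mem_H2[OF kernel_coeff_l2[OF a]] H2_inner_kernel[OF _ a] by (auto simp: E_def)
  have K: "K \<in> H2 \<beta> \<and> (\<forall>f\<in>H2 \<beta>. f a = H2_inner \<beta> f K)"
    unfolding K_def repr_kernel_def by (rule someI[of _ E]) (use E in blast)
  then have "H2_inner \<beta> K K = K a" "K a = H2_inner \<beta> K E" "E a = H2_inner \<beta> E K"
    using E by auto
  moreover have "H2_inner \<beta> K E = cnj (H2_inner \<beta> E K)" using K E by (intro ip_cnj) auto
  ultimately have "Re (H2_inner \<beta> K K) = Re (E a)" by simp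
  also have "\<dots> = (kernel_norm a)\<^sup>2" unfolding E_def kernel_value[OF a] by simp
  finally show ?thesis
    using kernel_norm_pos[OF a] by (simp add: inner_norm_def K_def)
qed

text \<open>Uniform boundedness for the evaluations at \<open>\<phi> z\<close> weighted by
  \<open>u z\<close>, tested on the kernel at \<open>\<phi> z\<close>. Finiteness for each single
  \<open>f\<close> thus becomes an estimate on kernel norms; \<open>u\<close> is 1 in the proof of
  2) and \<open>cmod (w z) / kernel_norm z\<close> in the proof of 3).\<close>

lemma weighted_evaluation_bounded:
  assumes \<phi>: "\<phi> ` unit_disc \<subseteq> unit_disc" and u: "\<And>z. z \<in> unit_disc \<Longrightarrow> 0 \<le> u z"
    and bd: "\<And>f. f \<in> H2 \<beta> \<Longrightarrow> \<exists>B. \<forall>z\<in>unit_disc. u z * cmod (f (\<phi> z)) \<le> B"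
  shows "\<exists>C. \<forall>z\<in>unit_disc. u z * kernel_norm (\<phi> z) \<le> C"
proof -
  \<comment> \<open>The index ranges over all complex numbers; outside the disc the functional is
    set to 0.\<close>
  define p where "p = (\<lambda>z c. if z \<in> unit_disc then u z * cmod (power_series c (\<phi> z)) else 0)"
  have \<phi>1: "cmod (\<phi> z) < 1" if "z \<in> unit_disc" for z using \<phi> that by (force simp: image_subset_iff)
  have "\<exists>C\<ge>0. \<forall>z. \<forall>c\<in>l2 \<beta>. p z c \<le> C * l2_norm \<beta> c"
  proof (rule uniform_boundedness)
    fix z and x y :: "nat \<Rightarrow> complex" assume xy: "x \<in> l2 \<beta>" "y \<in> l2 \<beta>"
    have "power_series (\<lambda>k. x k + y k) v = power_series x v + power_series y v" if "cmod v < 1" for v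
      unfolding power_series_def distrib_right
      using suminf_add[OF l2_summable[OF xy(1) that] l2_summable[OF xy(2) that]] by simp
    then show "p z (\<lambda>k. x k + y k) \<le> p z x + p z y"
      using \<phi>1[of z] u[of z] norm_triangle_ineq[of "power_series x (\<phi> z)" "power_series y (\<phi> z)"]
      by (auto simp: p_def mult_left_mono simp flip: distrib_left)
  next
    fix z s and x :: "nat \<Rightarrow> complex" assume x: "x \<in> l2 \<beta>"
    have "power_series (\<lambda>k. s * x k) v = s * power_series x v" if "cmod v < 1" for v
      unfolding power_series_def mult.assoc using suminf_mult[OF l2_summable[OF x that]] by simp
    then show "p z (\<lambda>k. s * x k) = cmod s * p z x"
      using \<phi>1[of z] by (simp add: p_def norm_mult)
  next
    fix z
    have "p z x \<le> (if z \<in> unit_disc then u z * kernel_norm (\<phi> z) else 0) * l2_norm \<beta> x"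
      if "x \<in> l2 \<beta>" for x
      using evaluation_bound[OF that \<phi>1[of z]] u[of z]
      by (auto simp: p_def mult.assoc mult.commute[of "kernel_norm _"] intro: mult_left_mono)
    then show "\<exists>C. \<forall>x\<in>l2 \<beta>. p z x \<le> C * l2_norm \<beta> x" by blast
  next
    fix x assume "x \<in> l2 \<beta>"
    from bd[OF power_series_mem_H2[OF this]]
    obtain B where B: "\<And>z. z \<in> unit_disc \<Longrightarrow> u z * cmod (power_series x (\<phi> z)) \<le> B" by blast
    have "p z x \<le> max 0 B" for z using B[of z] by (auto simp: p_def)
    then show "\<exists>B. \<forall>z. p z x \<le> B" by blast
  qed
  then obtain C where C: "\<And>z c. c \<in> l2 \<beta> \<Longrightarrow> p z c \<le> C * l2_norm \<beta> c" by blast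
  have "u z * kernel_norm (\<phi> z) \<le> C" if z: "z \<in> unit_disc" for z
  proof -
    have "u z * (kernel_norm (\<phi> z))\<^sup>2 \<le> C * kernel_norm (\<phi> z)"
      using C[OF kernel_coeff_l2[OF \<phi>1[OF z]], of z] z
      unfolding l2_norm_kernel by (simp add: p_def kernel_value[OF \<phi>1[OF z]] norm_power)
    then show ?thesis using kernel_norm_pos[OF \<phi>1[OF z]] by (simp add: power2_eq_square)
  qed
  then show ?thesis by blast
qed

end

text \<open>Root test: for \<open>r < s < 1\<close> the weight eventually exceeds
  \<open>s ^ k\<close>, which leaves a geometric series of ratio \<open>r / s\<close>.\<close>

lemma disc_weight_liminf:
  assumes pos: "\<And>k. \<beta> k > 0" and lim: "liminf (\<lambda>k. ereal (\<beta> k powr (1 / real k))) \<ge> 1"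
  shows "disc_weight \<beta>"
proof
  show "\<beta> k > 0" for k by (rule pos)
  fix r :: real assume r: "0 \<le> r" "r < 1"
  then obtain s where s: "r < s" "s < 1" using dense by blast
  have "\<forall>\<^sub>F k in sequentially. ereal s < ereal (\<beta> k powr (1 / real k))"
    by (rule less_LiminfD[OF less_le_trans[OF _ lim]]) (use s in simp)
  then have "\<forall>\<^sub>F k in sequentially. norm (r ^ k / \<beta> k) \<le> (r / s) ^ k"
    using eventually_gt_at_top[of 0]
  proof eventually_elim
    case (elim k)
    have "s ^ k \<le> (\<beta> k powr (1 / real k)) ^ k" using elim s r by (intro power_mono) auto
    \<comment> \<open>Requires \<open>k > 0\<close>: at 0 the exponent \<open>1 / real k\<close> is
      0 and the root carries no information on \<beta>.\<close>
    also have "\<dots> = \<beta> k"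
      using elim pos[of k] by (simp add: powr_realpow[symmetric] powr_powr)
    finally have "r ^ k / \<beta> k \<le> r ^ k / s ^ k"
      using r s pos[of k] by (intro divide_left_mono) auto
    then show ?case using r pos[of k] by (simp add: power_divide)
  qed
  moreover have "summable (\<lambda>k. (r / s) ^ k)" using r s by (intro summable_geometric) simp
  ultimately show "summable (\<lambda>k. r ^ k / \<beta> k)" by (rule summable_comparison_test_ev)
qed

text \<open>In the forward direction the test functions are restricted to the Hardy space: its
  kernel norm \<open>1 / sqrt (1 - \<bar>z\<bar>\<^sup>2)\<close> blows up at the circle, so a bound
  on it confines \<phi> to a smaller disc. Conversely, on a smaller closed disc every
  \<open>f\<close> is bounded, hence \<open>f \<circ> \<phi>\<close> is a multiplier.\<close>

theorem (in disc_weight) cond_multipliers_eq_space_iff: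
  assumes \<phi>: "\<phi> holomorphic_on unit_disc" "\<phi> ` unit_disc \<subseteq> unit_disc"
    and sub: "hardy \<subseteq> H2 \<beta>" and mult: "multipliers (H2 \<beta>) = H_infinity"
    and comp: "\<And>f. f \<in> H2 \<beta> \<Longrightarrow> f \<circ> \<phi> \<in> H2 \<beta>"
  shows "cond_multipliers (H2 \<beta>) \<phi> = H2 \<beta> \<longleftrightarrow> sup_norm \<phi> < 1"
proof
  have \<phi>1: "cmod (\<phi> z) < 1" if "z \<in> unit_disc" for z using \<phi>(2) that by (force simp: image_subset_iff)
  assume eq: "cond_multipliers (H2 \<beta>) \<phi> = H2 \<beta>"
  have "\<exists>B. \<forall>z\<in>unit_disc. 1 * cmod (f (\<phi> z)) \<le> B" if "f \<in> hardy" for f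
  proof -
    have f: "f \<in> H2 \<beta>" using that sub by blast
    have "(\<lambda>z. (f \<circ> \<phi>) z * g z) \<in> H2 \<beta>" if g: "g \<in> H2 \<beta>" for g
    proof -
      have "g \<in> cond_multipliers (H2 \<beta>) \<phi>" using g eq by blast
      then have "(\<lambda>z. g z * f (\<phi> z)) \<in> H2 \<beta>" using f by (simp add: cond_multipliers_def)
      then show ?thesis by (simp add: mult.commute)
    qed
    then have "f \<circ> \<phi> \<in> multipliers (H2 \<beta>)" using comp[OF f] by (simp add: multipliers_def)
    then have "bounded ((f \<circ> \<phi>) ` unit_disc)" unfolding mult by (simp add: H_infinity_def)
    then show ?thesis unfolding bounded_iff by auto
  qed
  from hardy.weighted_evaluation_bounded[OF \<phi>(2) _ this]
  obtain C where "\<forall>z\<in>unit_disc. 1 * hardy.kernel_norm (\<phi> z) \<le> C" by auto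
  then have C: "\<And>z. z \<in> unit_disc \<Longrightarrow> hardy.kernel_norm (\<phi> z) \<le> C" by simp
  have C0: "C > 0"
    using less_le_trans[OF hardy.kernel_norm_pos[OF \<phi>1[of 0]] C[of 0]] by simp
  have "cmod (\<phi> z) \<le> sqrt (1 - 1 / C\<^sup>2)" if z: "z \<in> unit_disc" for z
  proof -
    have lt: "(cmod (\<phi> z))\<^sup>2 < 1" using \<phi>1[OF z] by (simp add: power_less_one_iff)
    have "(hardy.kernel_norm (\<phi> z))\<^sup>2 = 1 / (1 - (cmod (\<phi> z))\<^sup>2)"
      using lt suminf_geometric[of "(cmod (\<phi> z))\<^sup>2"] by (simp add: hardy.kernel_norm_def)
    moreover have "(hardy.kernel_norm (\<phi> z))\<^sup>2 \<le> C\<^sup>2"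
      using C[OF z] hardy.kernel_norm_pos[OF \<phi>1[OF z]] by (intro power_mono) auto
    ultimately have "1 / (1 - (cmod (\<phi> z))\<^sup>2) \<le> C\<^sup>2" by simp
    then have "(cmod (\<phi> z))\<^sup>2 \<le> 1 - 1 / C\<^sup>2" using lt C0 by (simp add: field_simps)
    then show ?thesis by (rule real_le_rsqrt)
  qed
  then have "sup_norm \<phi> \<le> sqrt (1 - 1 / C\<^sup>2)" unfolding sup_norm_def by (intro cSUP_least) auto
  also have "\<dots> < 1" using C0 by simp
  finally show "sup_norm \<phi> < 1" .
next
  have \<phi>1: "cmod (\<phi> z) < 1" if "z \<in> unit_disc" for z using \<phi>(2) that by (force simp: image_subset_iff)
  assume sup: "sup_norm \<phi> < 1"
  have bdd: "bdd_above ((\<lambda>z. cmod (\<phi> z)) ` unit_disc)"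
    using \<phi>1 by (intro bdd_aboveI2[of _ _ 1] less_imp_le) auto
  have le: "cmod (\<phi> z) \<le> sup_norm \<phi>" if "z \<in> unit_disc" for z
    unfolding sup_norm_def by (rule cSUP_upper[OF that bdd])
  have "(\<lambda>z. w z * f (\<phi> z)) \<in> H2 \<beta>" if w: "w \<in> H2 \<beta>" and f: "f \<in> H2 \<beta>" for w f
  proof -
    have fh: "f holomorphic_on unit_disc" using f by (simp add: H2_iff)
    have "continuous_on (cball 0 (sup_norm \<phi>)) f"
      using holomorphic_on_imp_continuous_on[OF fh] by (rule continuous_on_subset) (use sup in auto)
    then have "bounded (f ` cball 0 (sup_norm \<phi>))"
      by (intro compact_imp_bounded compact_continuous_image compact_cball)
    then have "bounded ((\<lambda>z. f (\<phi> z)) ` unit_disc)"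
      by (rule bounded_subset) (use le in auto)
    then have "(\<lambda>z. f (\<phi> z)) \<in> multipliers (H2 \<beta>)"
      unfolding mult using holomorphic_compose_disc[OF fh \<phi>] by (simp add: H_infinity_def)
    then show ?thesis using w by (simp add: multipliers_def mult.commute)
  qed
  then show "cond_multipliers (H2 \<beta>) \<phi> = H2 \<beta>" by (auto simp: cond_multipliers_def)
qed

section \<open>Finite Blaschke products\<close>

lemma blaschke_factor_bound:
  assumes a: "cmod a < 1" and z: "cmod z < 1"
  shows "1 - cmod ((z - a) / (1 - cnj a * z)) \<le> 2 * (1 - (cmod a)\<^sup>2) / (1 - cmod a)\<^sup>2 * (1 - cmod z)"
    "cmod ((z - a) / (1 - cnj a * z)) < 1"
proof -
  have eq: "cmod ((z - a) / (1 - cnj a * z)) = cmod (moebius a z)"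
    by (simp add: moebius_def norm_divide norm_minus_commute)
  let ?t = "cmod (moebius a z)"
  have t: "?t < 1" by (rule moebius_less_1[OF a z])
  then show "cmod ((z - a) / (1 - cnj a * z)) < 1" unfolding eq .
  have a2: "0 \<le> 1 - (cmod a)\<^sup>2" using a by (simp add: power_le_one)
  have "1 - ?t \<le> 1 - ?t\<^sup>2" using t by (simp add: power2_eq_square mult_left_le)
  also have "\<dots> = (1 - (cmod a)\<^sup>2) * (1 - (cmod z)\<^sup>2) / (cmod (1 - cnj a * z))\<^sup>2"
    by (rule moebius_identity[OF a z])
  also have "\<dots> \<le> (1 - (cmod a)\<^sup>2) * (2 * (1 - cmod z)) / (1 - cmod a)\<^sup>2"
  proof (intro frac_le mult_left_mono power_mono mult_nonneg_nonneg)
    have "1 - (cmod z)\<^sup>2 = (1 + cmod z) * (1 - cmod z)" by (simp add: power2_eq_square algebra_simps)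
    also have "\<dots> \<le> 2 * (1 - cmod z)" using z by (intro mult_right_mono) auto
    finally show "1 - (cmod z)\<^sup>2 \<le> 2 * (1 - cmod z)" .
    show "1 - cmod a \<le> cmod (1 - cnj a * z)" using szego_kernel_bound(1)[OF a, of z] z by simp
  qed (use a z a2 in auto)
  finally show "1 - cmod ((z - a) / (1 - cnj a * z))
      \<le> 2 * (1 - (cmod a)\<^sup>2) / (1 - cmod a)\<^sup>2 * (1 - cmod z)"
    unfolding eq by (simp only: times_divide_eq_left times_divide_eq_right mult_ac)
qed

text \<open>For factors of modulus \<open>x\<close> and \<open>y\<close> at most 1 the defects add
  up, \<open>1 - x * y \<le> (1 - x) + (1 - y)\<close>, so the constants of the single factors are
  summed.\<close>

lemma blaschke_list_bound:
  assumes "set as \<subseteq> unit_disc"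
  shows "\<exists>M>0. \<forall>z. cmod z < 1 \<longrightarrow> cmod (\<Prod>a\<leftarrow>as. (z - a) / (1 - cnj a * z)) \<le> 1 \<and>
    1 - cmod (\<Prod>a\<leftarrow>as. (z - a) / (1 - cnj a * z)) \<le> M * (1 - cmod z)"
  using assms
proof (induction as)
  case Nil
  then show ?case by (intro exI[of _ 1]) auto
next
  case (Cons a as)
  then obtain M where M: "M > 0" "\<And>z. cmod z < 1 \<Longrightarrow> cmod (\<Prod>a\<leftarrow>as. (z - a) / (1 - cnj a * z)) \<le> 1"
    "\<And>z. cmod z < 1 \<Longrightarrow> 1 - cmod (\<Prod>a\<leftarrow>as. (z - a) / (1 - cnj a * z)) \<le> M * (1 - cmod z)" by auto
  have a: "cmod a < 1" using Cons by simp
  define K where "K = 2 * (1 - (cmod a)\<^sup>2) / (1 - cmod a)\<^sup>2"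
  have K: "0 \<le> K" using a by (simp add: K_def power_le_one)
  show ?case
  proof (intro exI[of _ "K + M"] conjI allI impI)
    show "0 < K + M" using K M(1) by simp
    fix z assume z: "cmod z < 1"
    define x y where "x = cmod ((z - a) / (1 - cnj a * z))"
      and "y = cmod (\<Prod>a\<leftarrow>as. (z - a) / (1 - cnj a * z))"
    have x: "0 \<le> x" "x \<le> 1" "1 - x \<le> K * (1 - cmod z)"
      using blaschke_factor_bound[OF a z] by (simp_all add: x_def K_def)
    have y: "0 \<le> y" "y \<le> 1" "1 - y \<le> M * (1 - cmod z)"
      using M(2,3)[OF z] by (simp_all add: y_def)
    have xy: "cmod (\<Prod>a\<leftarrow>a # as. (z - a) / (1 - cnj a * z)) = x * y"
      by (simp only: x_def y_def norm_mult list.map prod_list.Cons)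
    show "cmod (\<Prod>a\<leftarrow>a # as. (z - a) / (1 - cnj a * z)) \<le> 1"
      unfolding xy using mult_mono[of x 1 y 1] x y by simp
    have "0 \<le> (1 - x) * (1 - y)" using x y by simp
    then have "1 - x * y \<le> (1 - x) + (1 - y)" by (simp add: algebra_simps)
    then show "1 - cmod (\<Prod>a\<leftarrow>a # as. (z - a) / (1 - cnj a * z)) \<le> (K + M) * (1 - cmod z)"
      unfolding xy distrib_right using x y by linarith
  qed
qed

lemma finite_blaschke_product_bound:
  assumes "finite_blaschke_product \<phi>"
  obtains M where "M > 0" "\<And>z. z \<in> unit_disc \<Longrightarrow> 1 - cmod (\<phi> z) \<le> M * (1 - cmod z)"
proof -
  from assms obtain c as where c: "cmod c = 1" "set as \<subseteq> unit_disc"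
    "\<And>z. z \<in> unit_disc \<Longrightarrow> \<phi> z = c * (\<Prod>a\<leftarrow>as. (z - a) / (1 - cnj a * z))"
    unfolding finite_blaschke_product_def by blast
  obtain M where "M > 0"
    "\<And>z. cmod z < 1 \<Longrightarrow> 1 - cmod (\<Prod>a\<leftarrow>as. (z - a) / (1 - cnj a * z)) \<le> M * (1 - cmod z)"
    using blaschke_list_bound[OF c(2)] by blast
  with c that[of M] show thesis by (simp add: norm_mult)
qed

text \<open>Approach to the circle from inside, uniformly in the argument. Limits of moduli along
  this filter make sense without boundary values.\<close>

definition at_circle :: "complex filter" where
  "at_circle = filtercomap cmod (at_left 1)"

lemma eventually_at_circle: "eventually P at_circle \<longleftrightarrow> (\<exists>r<1. \<forall>z. r < cmod z \<and> cmod z < 1 \<longrightarrow> P z)"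
  unfolding at_circle_def eventually_filtercomap eventually_at_left_field
proof safe
  fix Q b assume "\<forall>x. Q (cmod x) \<longrightarrow> P x" "b < (1::real)" "\<forall>y>b. y < 1 \<longrightarrow> Q y"
  then show "\<exists>r<1. \<forall>z. r < cmod z \<and> cmod z < 1 \<longrightarrow> P z" by blast
next
  fix r assume "r < (1::real)" "\<forall>z. r < cmod z \<and> cmod z < 1 \<longrightarrow> P z"
  then show "\<exists>Q. (\<exists>b<1. \<forall>y>b. y < 1 \<longrightarrow> Q y) \<and> (\<forall>x. Q (cmod x) \<longrightarrow> P x)"
    by (intro exI[of _ "\<lambda>y. r < y \<and> y < 1"]) blast
qed

text \<open>The maximum principle is used on discs of radius \<open>s < 1\<close> close to 1, as
  \<open>g\<close> need not extend to the circle.\<close>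

lemma at_circle_maximum:
  assumes g: "g holomorphic_on unit_disc" and lim: "((\<lambda>z. cmod (g z)) \<longlongrightarrow> 1) at_circle"
    and z: "cmod z < 1"
  shows "cmod (g z) \<le> 1"
proof (rule field_le_epsilon)
  fix e :: real assume "e > 0"
  then have "\<forall>\<^sub>F z in at_circle. cmod (g z) < 1 + e" using lim by (intro order_tendstoD) auto
  then obtain r where r: "r < 1" "\<And>z. r < cmod z \<Longrightarrow> cmod z < 1 \<Longrightarrow> cmod (g z) < 1 + e"
    unfolding eventually_at_circle by blast
  obtain s where s: "max r (cmod z) < s" "s < 1" using dense[of "max r (cmod z)" 1] r z by auto
  then have s0: "s > 0" using norm_ge_zero[of z] by linarith
  show "cmod (g z) \<le> 1 + e"
  proof (rule maximum_modulus_frontier[of g "ball 0 s"])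
    show "g holomorphic_on interior (ball 0 s)"
      using g by (rule holomorphic_on_subset) (use s in auto)
    show "continuous_on (closure (ball 0 s)) g"
      using holomorphic_on_imp_continuous_on[OF g] by (rule continuous_on_subset) (use s s0 in auto)
    show "cmod (g w) \<le> 1 + e" if "w \<in> frontier (ball 0 s)" for w
      using r(2)[of w] that s s0 by (simp add: sphere_def)
  qed (use s in auto)
qed

lemma blaschke_factor_tendsto:
  assumes a: "cmod a < 1"
  shows "((\<lambda>z. cmod ((z - a) / (1 - cnj a * z))) \<longlongrightarrow> 1) at_circle"
proof -
  let ?K = "2 * (1 - (cmod a)\<^sup>2) / (1 - cmod a)\<^sup>2"
  have ev: "\<forall>\<^sub>F z in at_circle. cmod z < 1" unfolding eventually_at_circle by (intro exI[of _ 0]) auto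
  have "(cmod \<longlongrightarrow> 1) at_circle"
    unfolding at_circle_def filterlim_def using filtermap_filtercomap[of cmod "at_left 1"]
    by (rule order_trans) (simp add: at_within_def)
  then have "((\<lambda>z. 1 - ?K * (1 - cmod z)) \<longlongrightarrow> 1 - ?K * (1 - 1)) at_circle" by (intro tendsto_intros)
  then have low: "((\<lambda>z. 1 - ?K * (1 - cmod z)) \<longlongrightarrow> 1) at_circle" by simp
  show ?thesis
  proof (rule tendsto_sandwich[OF _ _ low tendsto_const])
    show "\<forall>\<^sub>F z in at_circle. 1 - ?K * (1 - cmod z) \<le> cmod ((z - a) / (1 - cnj a * z))"
      using ev by eventually_elim (use blaschke_factor_bound(1)[OF a] in force)
    show "\<forall>\<^sub>F z in at_circle. cmod ((z - a) / (1 - cnj a * z)) \<le> 1"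
      using ev by eventually_elim (use blaschke_factor_bound(2)[OF a] in force)
  qed
qed

text \<open>The maximum principle applies to \<open>g\<close> and to \<open>1 / g\<close>, so the
  modulus is identically 1 and \<open>g\<close> is constant.\<close>

lemma nonvanishing_unimodular:
  assumes g: "g holomorphic_on unit_disc" and lim: "((\<lambda>z. cmod (g z)) \<longlongrightarrow> 1) at_circle"
    and nz: "\<And>z. z \<in> unit_disc \<Longrightarrow> g z \<noteq> 0"
  shows "cmod (g 0) = 1 \<and> (\<forall>z\<in>unit_disc. g z = g 0)"
proof -
  have "(\<lambda>z. 1 / g z) holomorphic_on unit_disc" using g nz by (intro holomorphic_intros)
  moreover have "((\<lambda>z. cmod (1 / g z)) \<longlongrightarrow> 1) at_circle"
    using tendsto_divide[OF tendsto_const lim, of 1] by (simp add: norm_divide)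
  ultimately have ge: "1 \<le> cmod (g z)" if "z \<in> unit_disc" for z
    using at_circle_maximum[of "\<lambda>z. 1 / g z" z] nz[OF that] that by (simp add: norm_divide field_simps)
  have eq: "cmod (g z) = 1" if "z \<in> unit_disc" for z
    using at_circle_maximum[OF g lim, of z] ge[OF that] that by simp
  have "g constant_on unit_disc"
    by (rule maximum_modulus_principle[OF g, of unit_disc 0]) (auto simp: eq)
  then show ?thesis using eq[of 0] unfolding constant_on_def by auto
qed

text \<open>The modulus is close to 1 near the circle, so all zeros lie in a compact disc. The
  second claim supplies the nonconstancy needed to divide out a zero.\<close>

lemma circle_zeros_finite:
  assumes g: "g holomorphic_on unit_disc" and lim: "((\<lambda>z. cmod (g z)) \<longlongrightarrow> 1) at_circle"
  shows "finite {z\<in>unit_disc. g z = 0}" "z \<in> unit_disc \<Longrightarrow> g z = 0 \<Longrightarrow> \<not> g constant_on unit_disc"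
proof -
  have "\<forall>\<^sub>F z in at_circle. 0 < cmod (g z)" using lim by (rule order_tendstoD) simp
  then obtain r where r: "r < 1" "\<And>z. r < cmod z \<Longrightarrow> cmod z < 1 \<Longrightarrow> g z \<noteq> 0"
    unfolding eventually_at_circle by auto
  define s where "s = max r 0"
  have s: "0 \<le> s" "s < 1" "r \<le> s" using r by (auto simp: s_def)
  \<comment> \<open>A point between radius \<open>s\<close> and the circle; \<open>g\<close> does
    not vanish there, so a single zero already makes \<open>g\<close> nonconstant.\<close>
  define v where "v = complex_of_real ((1 + s) / 2)"
  have "cmod v = (1 + s) / 2" unfolding v_def norm_of_real using s by simp
  then have v: "v \<in> unit_disc" "g v \<noteq> 0" using s r(2)[of v] by auto
  show nc: "\<not> g constant_on unit_disc" if "z \<in> unit_disc" "g z = 0" for z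
    using that v unfolding constant_on_def by metis
  show "finite {z\<in>unit_disc. g z = 0}"
  proof (cases "\<exists>z\<in>unit_disc. g z = 0")
    case True
    then have "finite {z\<in>cball 0 s. g z = 0}"
      using nc s by (intro holomorphic_compact_finite_zeros[OF g]) auto
    moreover have "{z\<in>unit_disc. g z = 0} \<subseteq> {z\<in>cball 0 s. g z = 0}"
      using r(2) s by (force simp: not_le)
    ultimately show ?thesis by (rule rev_finite_subset)
  next
    case False
    then have "{z\<in>unit_disc. g z = 0} = {}" by blast
    then show ?thesis by (simp only: finite.emptyI)
  qed
qed

text \<open>Induction on the number of distinct zeros: a zero is divided out with its full order,
  which removes it from the zero set and keeps the limit of the modulus at the circle.\<close>

lemma finite_blaschke_productI:
  assumes "g holomorphic_on unit_disc" "((\<lambda>z. cmod (g z)) \<longlongrightarrow> 1) at_circle"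
  shows "finite_blaschke_product g"
  using assms
proof (induction "card {z\<in>unit_disc. g z = 0}" arbitrary: g rule: less_induct)
  case less
  note g = less.prems
  show ?case
  proof (cases "\<exists>a\<in>unit_disc. g a = 0")
    case False
    then have "\<And>z. z \<in> unit_disc \<Longrightarrow> g z \<noteq> 0" by blast
    from nonvanishing_unimodular[OF g this]
    obtain c where "cmod c = 1" "\<forall>z\<in>unit_disc. g z = c" by blast
    then show ?thesis
      unfolding finite_blaschke_product_def by (intro exI[of _ c] exI[of _ "[]"]) simp
  next
    case True
    then obtain a where a: "a \<in> unit_disc" "g a = 0" by blast
    then have a1: "cmod a < 1" by simp
    obtain h r n where h: "0 < n" "0 < r" "ball a r \<subseteq> unit_disc" "h holomorphic_on ball a r"
      "\<And>w. w \<in> ball a r \<Longrightarrow> g w = (w - a) ^ n * h w" "\<And>w. w \<in> ball a r \<Longrightarrow> h w \<noteq> 0"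
      by (rule holomorphic_factor_zero_nonconstant[OF g(1) open_ball connected_ball a
            circle_zeros_finite(2)[OF g a]]) (rule that; assumption)
    \<comment> \<open>The value \<open>h a\<close> fills the removable singularity of the
      quotient.\<close>
    define k where "k = (\<lambda>z. if z = a then h a else g z / (z - a) ^ n)"
    have kh: "k z = h z" if "z \<in> ball a r" for z using h(5)[OF that] by (simp add: k_def)
    have "k holomorphic_on ball a r" using h(4) kh holomorphic_cong by blast
    moreover have "k holomorphic_on (unit_disc - {a})"
    proof -
      have "(\<lambda>z. g z / (z - a) ^ n) holomorphic_on (unit_disc - {a})"
        by (intro holomorphic_intros holomorphic_on_subset[OF g(1)]) auto
      then show ?thesis by (rule holomorphic_transform) (simp add: k_def)
    qed
    ultimately have "k holomorphic_on (ball a r \<union> (unit_disc - {a}))"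
      by (intro holomorphic_on_Un) (auto intro: open_delete)
    moreover have "ball a r \<union> (unit_disc - {a}) = unit_disc" using h(2,3) by auto
    ultimately have kd: "k holomorphic_on unit_disc" by simp
    \<comment> \<open>The factor \<open>(1 - cnj a * z) ^ n\<close> turns division by
      \<open>(z - a) ^ n\<close> into division by a power of the Blaschke factor, whose modulus
      tends to 1 at the circle.\<close>
    define G where "G = (\<lambda>z. k z * (1 - cnj a * z) ^ n)"
    have Gh: "G holomorphic_on unit_disc" unfolding G_def by (intro holomorphic_intros kd)
    have gG: "g z = ((z - a) / (1 - cnj a * z)) ^ n * G z" if z: "z \<in> unit_disc" for z
      using cnj_mult_neq_1[OF a1, of z] z a h(1) by (auto simp: G_def k_def power_divide)
    have ev: "\<forall>\<^sub>F z in at_circle. cmod a < cmod z \<and> cmod z < 1"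
      unfolding eventually_at_circle using a1 by blast
    have "((\<lambda>z. cmod (g z) / cmod ((z - a) / (1 - cnj a * z)) ^ n) \<longlongrightarrow> 1 / 1 ^ n) at_circle"
      by (intro tendsto_intros g(2) blaschke_factor_tendsto a1) simp
    moreover have "\<forall>\<^sub>F z in at_circle. cmod (g z) / cmod ((z - a) / (1 - cnj a * z)) ^ n = cmod (G z)"
      using ev
    proof eventually_elim
      case (elim z)
      have "(z - a) / (1 - cnj a * z) \<noteq> 0" using elim cnj_mult_neq_1[OF a1, of z] by auto
      then show ?case using gG[of z] elim by (simp add: norm_mult norm_power)
    qed
    ultimately have Gl: "((\<lambda>z. cmod (G z)) \<longlongrightarrow> 1) at_circle"
      using tendsto_cong by fastforce
    have "G a \<noteq> 0" using h(2) h(6)[of a] cnj_mult_neq_1[OF a1 a1] by (simp add: G_def k_def)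
    then have "{z\<in>unit_disc. G z = 0} \<subset> {z\<in>unit_disc. g z = 0}" using gG a by auto
    then have "card {z\<in>unit_disc. G z = 0} < card {z\<in>unit_disc. g z = 0}"
      by (rule psubset_card_mono[OF circle_zeros_finite(1)[OF g]])
    from less.hyps[OF this Gh Gl] obtain c as where c: "cmod c = 1" "set as \<subseteq> unit_disc"
      "\<And>z. z \<in> unit_disc \<Longrightarrow> G z = c * (\<Prod>a\<leftarrow>as. (z - a) / (1 - cnj a * z))"
      unfolding finite_blaschke_product_def by auto
    have "g z = c * (\<Prod>a\<leftarrow>replicate n a @ as. (z - a) / (1 - cnj a * z))" if "z \<in> unit_disc" for z
      using gG[OF that] c(3)[OF that] by (simp add: map_replicate_const[symmetric] prod_list_replicate)
    then show ?thesis
      unfolding finite_blaschke_product_def using c(1,2) a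
      by (intro exI[of _ c] exI[of _ "replicate n a @ as"]) auto
  qed
qed

text \<open>If no such \<open>r\<close> existed, the modulus of \<phi> would exceed every level
  below 1 near the circle, hence tend to 1, and \<open>finite_blaschke_productI\<close> would
  apply.\<close>

lemma not_finite_blaschke_product:
  assumes \<phi>: "\<phi> holomorphic_on unit_disc" "\<phi> ` unit_disc \<subseteq> unit_disc" and nb: "\<not> finite_blaschke_product \<phi>"
  obtains r where "0 \<le> r" "r < 1" "\<And>d. d > 0 \<Longrightarrow> \<exists>z. 1 - d < cmod z \<and> cmod z < 1 \<and> cmod (\<phi> z) \<le> r"
proof (rule ccontr)
  assume nt: "\<not> thesis"
  have "((\<lambda>z. cmod (\<phi> z)) \<longlongrightarrow> 1) at_circle"
  proof (rule order_tendstoI)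
    fix y :: real assume "1 < y"
    have "\<forall>\<^sub>F z in at_circle. cmod z < 1" unfolding eventually_at_circle by (intro exI[of _ 0]) auto
    then show "\<forall>\<^sub>F z in at_circle. cmod (\<phi> z) < y"
    proof eventually_elim
      case (elim z)
      then have "cmod (\<phi> z) < 1" using \<phi>(2) by (force simp: image_subset_iff)
      then show ?case using \<open>1 < y\<close> by simp
    qed
  next
    fix y :: real assume "y < 1"
    \<comment> \<open>\<open>max y 0\<close> because the radius \<open>r\<close> sought is
      nonnegative, while \<open>y\<close> may be negative.\<close>
    have "\<exists>d>0. \<forall>z. 1 - d < cmod z \<longrightarrow> cmod z < 1 \<longrightarrow> max y 0 < cmod (\<phi> z)"
      using nt that[of "max y 0"] \<open>y < 1\<close> by (force simp: not_le)
    then obtain d where d: "d > 0" "\<And>z. 1 - d < cmod z \<Longrightarrow> cmod z < 1 \<Longrightarrow> max y 0 < cmod (\<phi> z)" by blast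
    then show "\<forall>\<^sub>F z in at_circle. y < cmod (\<phi> z)"
      unfolding eventually_at_circle by (intro exI[of _ "1 - d"]) auto
  qed
  from finite_blaschke_productI[OF \<phi>(1) this] nb show False by blast
qed

section \<open>Conditional multipliers\<close>

text \<open>A geometric tail, with the factor 16/15 rounded up to 2.\<close>

lemma suminf_tail_bound:
  fixes x :: "nat \<Rightarrow> complex"
  assumes s: "summable x" and b: "\<And>n. n \<ge> N \<Longrightarrow> cmod (x n) \<le> D * (1/16) ^ n"
  shows "cmod (suminf x - (\<Sum>n<N. x n)) \<le> 2 * D * (1/16) ^ N"
proof -
  have le: "cmod (x (n + N)) \<le> D * (1/16) ^ N * (1/16) ^ n" for n
    using b[of "n + N"] by (simp add: power_add mult_ac)
  have g: "(\<lambda>n. D * (1/16) ^ N * (1/16) ^ n) sums (D * (1/16) ^ N * (1 / (1 - 1/16)))"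
    by (intro sums_mult geometric_sums) simp
  have sn: "summable (\<lambda>n. cmod (x (n + N)))"
    by (rule summable_comparison_test'[OF sums_summable[OF g], of 0]) (use le in simp)
  have D0: "0 \<le> D * (1/16) ^ N" using order_trans[OF norm_ge_zero b[of N]] by simp
  have "suminf x - (\<Sum>n<N. x n) = (\<Sum>n. x (n + N))"
    using suminf_minus_initial_segment[OF s, of N] by simp
  also have "cmod \<dots> \<le> (\<Sum>n. cmod (x (n + N)))" by (rule summable_norm[OF sn])
  also have "\<dots> \<le> D * (1/16) ^ N * (1 / (1 - 1/16))"
    using suminf_le[OF le sn sums_summable[OF g]] g by (simp add: sums_iff)
  also have "\<dots> \<le> 2 * D * (1/16) ^ N" using D0 by simp
  finally show ?thesis .
qed

text \<open>Heights of ratio 4 let the term of height \<open>4 ^ m\<close> dominate at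
  \<open>\<zeta> m\<close>: earlier terms add up to less than 2/3 of it and later ones to at most 1.
  The choice \<open>(1/64) ^ n\<close> then makes the operator norms of order
  \<open>(1/2) ^ n\<close> and the terms at a fixed point of order
  \<open>(1/16) ^ n\<close>.\<close>

lemma exists_unbounded_cond_multiplier:
  assumes \<phi>: "\<phi> holomorphic_on unit_disc" "\<phi> ` unit_disc \<subseteq> unit_disc" and nb: "\<not> finite_blaschke_product \<phi>"
  obtains w where "w \<in> cond_multipliers hardy \<phi>" "w \<notin> H_infinity"
proof -
  obtain r where r: "0 \<le> r" "r < 1" "\<And>d. d > 0 \<Longrightarrow> \<exists>z. 1 - d < cmod z \<and> cmod z < 1 \<and> cmod (\<phi> z) \<le> r"
    by (rule not_finite_blaschke_product[OF \<phi> nb]) (rule that; assumption)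
  define q where "q = (\<lambda>z. 1 - (cmod z)\<^sup>2)"
  have small: "\<exists>z. cmod z < 1 \<and> cmod (\<phi> z) \<le> r \<and> q z \<le> e" if "e > 0" for e
  proof -
    obtain z where z: "1 - e / 2 < cmod z" "cmod z < 1" "cmod (\<phi> z) \<le> r" using r(3)[of "e / 2"] \<open>e > 0\<close> by auto
    have "q z = (1 + cmod z) * (1 - cmod z)" by (simp add: q_def power2_eq_square algebra_simps)
    also have "\<dots> \<le> 2 * (1 - cmod z)" using z by (intro mult_right_mono) auto
    finally have "q z \<le> e" using z by simp
    with z show ?thesis by blast
  qed
  define P where "P = (\<lambda>(n::nat) z. cmod z < 1 \<and> cmod (\<phi> z) \<le> r \<and> q z \<le> (1/64) ^ n)"
  \<comment> \<open>Each new point is much closer to the circle than its predecessor, so that the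
    terms of later points stay small at earlier ones.\<close>
  define Q where "Q = (\<lambda>(n::nat) z z'. q z' \<le> (1/64) ^ Suc n * (1 - cmod z))"
  have P0: "\<exists>z. P 0 z" using small[of 1] by (auto simp: P_def)
  have PS: "\<exists>z'. P (Suc n) z' \<and> Q n z z'" if "P n z" for n z
  proof -
    have z: "cmod z < 1" using that by (simp add: P_def)
    obtain z' where z': "cmod z' < 1" "cmod (\<phi> z') \<le> r" "q z' \<le> (1/64) ^ Suc n * (1 - cmod z)"
      using small[of "(1/64) ^ Suc n * (1 - cmod z)"] z by auto
    have "(1/64) ^ Suc n * (1 - cmod z) \<le> (1/64) ^ Suc n" by (intro mult_left_le) auto
    with z'(3) have "q z' \<le> (1/64) ^ Suc n" by (rule order_trans)
    with z' show ?thesis unfolding P_def Q_def by blast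
  qed
  obtain \<zeta> where \<zeta>: "\<And>n. P n (\<zeta> n)" "\<And>n. Q n (\<zeta> n) (\<zeta> (Suc n))"
    using dependent_nat_choice[of P Q] P0 PS by metis
  have z1: "cmod (\<zeta> n) < 1" and z\<phi>: "cmod (\<phi> (\<zeta> n)) \<le> r" and zq: "q (\<zeta> n) \<le> (1/64) ^ n" for n
    using \<zeta>(1)[of n] by (auto simp: P_def)
  have qu: "1 - cmod (\<zeta> n) \<le> q (\<zeta> n)" for n
    using z1[of n] by (simp add: q_def power2_eq_square mult_left_le)
  have q0: "0 < q (\<zeta> n)" for n using qu[of n] z1[of n] by linarith
  have dec: "decseq (\<lambda>n. 1 - cmod (\<zeta> n))"
  proof (rule decseq_SucI)
    fix n
    have "1 - cmod (\<zeta> (Suc n)) \<le> (1/64) ^ Suc n * (1 - cmod (\<zeta> n))"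
      using qu[of "Suc n"] \<zeta>(2)[of n] by (simp add: Q_def)
    also have "\<dots> \<le> 1 * (1 - cmod (\<zeta> n))"
      using z1[of n] by (intro mult_right_mono power_le_one) auto
    finally show "1 - cmod (\<zeta> (Suc n)) \<le> 1 - cmod (\<zeta> n)" by simp
  qed
  have qsep: "q (\<zeta> n) \<le> (1/64) ^ n * (1 - cmod (\<zeta> m))" if mn: "m < n" for m n
  proof -
    obtain k where k: "n = Suc k" "m \<le> k" using mn by (cases n) auto
    have "q (\<zeta> n) \<le> (1/64) ^ n * (1 - cmod (\<zeta> k))" using \<zeta>(2)[of k] by (simp add: Q_def k)
    also have "\<dots> \<le> (1/64) ^ n * (1 - cmod (\<zeta> m))"
      using decseqD[OF dec k(2)] by (intro mult_left_mono) auto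
    finally show ?thesis .
  qed
  define s where "s = (\<lambda>n z. 4 ^ n * of_real (q (\<zeta> n)) * (1 / (1 - cnj (\<zeta> n) * z)))"
  have sn: "cmod (s n z) = 4 ^ n * q (\<zeta> n) / cmod (1 - cnj (\<zeta> n) * z)" for n z
    using q0[of n] by (simp add: s_def norm_mult norm_divide norm_power)
  have lowz: "1 - cmod z \<le> cmod (1 - cnj (\<zeta> n) * z)" if "cmod z < 1" for n z
  proof -
    have "cmod (cnj (\<zeta> n) * z) \<le> cmod z" using z1[of n] by (simp add: norm_mult mult_left_le_one_le)
    then show ?thesis using norm_triangle_ineq2[of 1 "cnj (\<zeta> n) * z"] by simp
  qed
  have four: "4 ^ n * (1/64) ^ n = (1/16::real) ^ n" for n
    by (subst power_mult_distrib[symmetric]) simp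
  have s_bound: "cmod (s n z) \<le> 1 / (1 - cmod z) * (1/16) ^ n" if "cmod z < 1" for n z
  proof -
    have "cmod (s n z) \<le> 4 ^ n * (1/64) ^ n / (1 - cmod z)"
      unfolding sn using lowz[OF that, of n] zq[of n] q0[of n] that
      by (intro frac_le mult_left_mono) auto
    then show ?thesis unfolding four by simp
  qed
  have s_summable: "summable (\<lambda>n. s n z)" if "cmod z < 1" for z
  proof (rule summable_comparison_test'[OF _ s_bound[OF that]])
    show "summable (\<lambda>n. 1 / (1 - cmod z) * (1/16) ^ n)"
      by (intro summable_mult summable_geometric) simp
  qed
  define w where "w = (\<lambda>z. \<Sum>n. s n z)"
  have tail: "cmod (w z - (\<Sum>n<N. s n z)) \<le> 2 * (1 / (1 - cmod z)) * (1/16) ^ N" if "cmod z < 1" for N z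
    unfolding w_def by (rule suminf_tail_bound[OF s_summable[OF that] s_bound[OF that]])
  have sh: "s n holomorphic_on unit_disc" for n
    unfolding s_def by (intro holomorphic_on_mult holomorphic_on_const szego_kernel_holomorphic z1)
  have p16: "(\<lambda>N. K * (1/16::real) ^ N) \<longlonglongrightarrow> 0" for K
    by (rule tendsto_mult_right_zero[OF LIMSEQ_power_zero]) simp
  have wh: "w holomorphic_on unit_disc"
  proof (rule holomorphic_uniform_sequence[OF open_ball])
    show "(\<lambda>z. \<Sum>n<N. s n z) holomorphic_on unit_disc" for N by (intro holomorphic_intros sh)
    fix x :: complex assume x: "x \<in> unit_disc"
    define d where "d = (1 - cmod x) / 2"
    have d: "d > 0" using x by (simp add: d_def)
    have cz: "cmod z \<le> 1 - d" if "z \<in> cball x d" for z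
      using that norm_triangle_ineq2[of z x] by (simp add: dist_norm norm_minus_commute d_def field_simps)
    have "uniform_limit (cball x d) (\<lambda>N z. \<Sum>n<N. s n z) w sequentially"
    proof (rule uniform_limitI)
      fix e :: real assume "e > 0"
      from order_tendstoD(2)[OF p16[of "2 * (1 / d)"] this]
      show "\<forall>\<^sub>F N in sequentially. \<forall>z\<in>cball x d. dist (\<Sum>n<N. s n z) (w z) < e"
      proof eventually_elim
        case (elim N)
        have "dist (\<Sum>n<N. s n z) (w z) < e" if z: "z \<in> cball x d" for z
        proof -
          have "dist (\<Sum>n<N. s n z) (w z) \<le> 2 * (1 / (1 - cmod z)) * (1/16) ^ N"
            using tail[of z N] cz[OF z] d by (simp add: dist_norm norm_minus_commute)
          also have "\<dots> \<le> 2 * (1 / d) * (1/16) ^ N"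
            using cz[OF z] d by (intro mult_right_mono mult_left_mono frac_le) auto
          finally show ?thesis using elim by simp
        qed
        then show ?case by blast
      qed
    qed
    then show "\<exists>d>0. cball x d \<subseteq> unit_disc \<and> uniform_limit (cball x d) (\<lambda>N z. \<Sum>n<N. s n z) w sequentially"
      using d cz by (intro exI[of _ d]) force
  qed
  define R where "R = 2 / sqrt (1 - r\<^sup>2)"
  have r2: "r\<^sup>2 < 1" using r by (simp add: power_less_one_iff)
  have mem: "(\<lambda>z. w z * f (\<phi> z)) \<in> hardy" if f: "f \<in> hardy" for f
  proof -
    have fh: "f holomorphic_on unit_disc" and fl: "taylor_coeff f \<in> l2 (\<lambda>_. 1)"
      using f by (auto simp: H2_iff)
    define nf where "nf = l2_norm (\<lambda>_. 1) (taylor_coeff f)"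
    have nf0: "0 \<le> nf" unfolding nf_def by (rule hardy.l2_norm_nonneg[OF fl])
    have fph: "(\<lambda>z. f (\<phi> z)) holomorphic_on unit_disc" by (rule holomorphic_compose_disc[OF fh \<phi>])
    define t where "t = (\<lambda>n z. s n z * f (\<phi> z))"
    have t: "t n \<in> hardy \<and> l2_norm (\<lambda>_. 1) (taylor_coeff (t n)) \<le> R * nf * (1/2) ^ n" for n
    proof -
      let ?k = "\<lambda>z. f (\<phi> z) * (1 / (1 - cnj (\<zeta> n) * z))"
      let ?c = "4 ^ n * complex_of_real (q (\<zeta> n))"
      note k = hardy_weighted_composition[OF \<phi> z1[of n] f]
      have kh: "?k holomorphic_on unit_disc" and kl: "taylor_coeff ?k \<in> l2 (\<lambda>_. 1)"
        using k(1) by (auto simp: H2_iff)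
      have teq: "t n = (\<lambda>z. ?c * ?k z)" by (auto simp: t_def s_def)
      have tc: "taylor_coeff (t n) = (\<lambda>i. ?c * taylor_coeff ?k i)"
        unfolding teq by (rule ext, rule taylor_coeff_cmult[OF kh])
      have "t n holomorphic_on unit_disc" unfolding teq by (rule holomorphic_on_mult[OF holomorphic_on_const kh])
      then have th: "t n \<in> hardy" unfolding H2_iff tc using hardy.l2_scale(1)[OF kl] by blast
      have "l2_norm (\<lambda>_. 1) (taylor_coeff (t n)) = 4 ^ n * q (\<zeta> n) * l2_norm (\<lambda>_. 1) (taylor_coeff ?k)"
        unfolding tc hardy.l2_scale(2)[OF kl] using q0[of n] by (simp add: norm_mult norm_power)
      \<comment> \<open>\<open>R\<close> is independent of \<open>n\<close> because all
        \<open>\<phi> (\<zeta> n)\<close> stay in the disc of radius \<open>r\<close>; the kernel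
        norm takes back only the square root of \<open>q (\<zeta> n)\<close>.\<close>
      also have "\<dots> \<le> 4 ^ n * q (\<zeta> n) * (R * nf / sqrt (q (\<zeta> n)))"
      proof (rule mult_left_mono)
        have "l2_norm (\<lambda>_. 1) (taylor_coeff ?k)
            \<le> 2 / sqrt (1 - (cmod (\<phi> (\<zeta> n)))\<^sup>2) * nf / sqrt (q (\<zeta> n))"
          using k(2) unfolding nf_def q_def .
        also have "\<dots> \<le> R * nf / sqrt (q (\<zeta> n))"
        proof -
          have "(cmod (\<phi> (\<zeta> n)))\<^sup>2 \<le> r\<^sup>2" using z\<phi>[of n] by (intro power_mono) auto
          then have "2 / sqrt (1 - (cmod (\<phi> (\<zeta> n)))\<^sup>2) \<le> R"
            unfolding R_def using r2 by (intro frac_le) auto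
          then show ?thesis using nf0 q0[of n] by (intro divide_right_mono mult_right_mono) auto
        qed
        finally show "l2_norm (\<lambda>_. 1) (taylor_coeff ?k) \<le> R * nf / sqrt (q (\<zeta> n))" .
      qed (use q0[of n] in simp)
      also have "\<dots> = R * nf * (4 ^ n * sqrt (q (\<zeta> n)))"
        using q0[of n] real_div_sqrt[of "q (\<zeta> n)"] by (simp add: field_simps)
      also have "\<dots> \<le> R * nf * (1/2) ^ n"
      proof (rule mult_left_mono)
        have "sqrt (q (\<zeta> n)) \<le> (1/8) ^ n"
        proof (rule real_le_lsqrt)
          have "((1/8::real) ^ n)\<^sup>2 = (1/64) ^ n"
            by (subst power_mult[symmetric], subst mult.commute, subst power_mult) (simp add: power2_eq_square)
          then show "q (\<zeta> n) \<le> ((1/8) ^ n)\<^sup>2" using zq[of n] by simp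
        qed (use q0[of n] in auto)
        then have "4 ^ n * sqrt (q (\<zeta> n)) \<le> 4 ^ n * (1/8) ^ n" by (intro mult_left_mono) auto
        also have "\<dots> = (1/2) ^ n" by (subst power_mult_distrib[symmetric]) simp
        finally show "4 ^ n * sqrt (q (\<zeta> n)) \<le> (1/2) ^ n" .
        show "0 \<le> R * nf" using nf0 r2 by (simp add: R_def)
      qed
      finally show ?thesis using th by blast
    qed
    have th: "t n holomorphic_on unit_disc" and tl: "taylor_coeff (t n) \<in> l2 (\<lambda>_. 1)" for n
      using t[of n] by (auto simp: H2_iff)
    define F where "F = (\<lambda>N z. \<Sum>n<N. t n z)"
    have F: "F N \<in> hardy \<and> l2_norm (\<lambda>_. 1) (taylor_coeff (F N)) \<le> (\<Sum>n<N. R * nf * (1/2) ^ n)" for N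
    proof (induction N)
      case 0
      have "taylor_coeff (\<lambda>z. 0) = (\<lambda>k. 0)" by (rule power_series_taylor(2)) auto
      then show ?case by (simp add: F_def H2_iff hardy.l2_zero)
    next
      case (Suc N)
      have Fh: "F N holomorphic_on unit_disc" and Fl: "taylor_coeff (F N) \<in> l2 (\<lambda>_. 1)"
        using Suc by (auto simp: H2_iff)
      have eq: "F (Suc N) = (\<lambda>z. F N z + t N z)" by (auto simp: F_def)
      have tc: "taylor_coeff (F (Suc N)) = (\<lambda>k. taylor_coeff (F N) k + taylor_coeff (t N) k)"
        unfolding eq by (rule ext, rule taylor_coeff_add[OF Fh th])
      have "F (Suc N) holomorphic_on unit_disc" unfolding eq by (rule holomorphic_on_add[OF Fh th])
      then show ?case
        using hardy.l2_add[OF Fl tl[of N]] Suc t[of N] unfolding H2_iff tc by auto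
    qed
    have B: "(\<Sum>n<N. R * nf * (1/2) ^ n) \<le> R * nf * 2" for N
    proof -
      have "(\<Sum>n<N. (1/2::real) ^ n) \<le> 2" by (simp add: sum_gp_strict)
      moreover have "0 \<le> R * nf" using nf0 r2 by (simp add: R_def)
      ultimately show ?thesis unfolding sum_distrib_left[symmetric] by (rule mult_left_mono)
    qed
    obtain \<rho> where \<rho>: "0 \<le> \<rho>" "\<rho> < 1" "\<And>z. cmod z \<le> 1/2 \<Longrightarrow> cmod (\<phi> z) \<le> \<rho>"
      by (rule self_map_bound[OF \<phi>, of "1/2"]) (auto intro: that)
    \<comment> \<open>A bound for \<open>f \<circ> \<phi>\<close> near 0, which turns the tail
      estimate for \<open>w\<close> into the uniform convergence that \<open>hardy_fatou\<close>
      requires.\<close>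
    define S where "S = (\<Sum>k. cmod (taylor_coeff f k) * \<rho> ^ k)"
    have S: "cmod (f (\<phi> z)) \<le> S" if "cmod z \<le> 1/2" for z
      using taylor_remainder[OF fh \<rho>(1,2) \<rho>(3)[OF that], of 0] by (simp add: S_def)
    have le: "cmod (F N z - w z * f (\<phi> z)) \<le> 4 * S * (1/16) ^ N" if z: "cmod z < 1/2" for N z
    proof -
      have "F N z - w z * f (\<phi> z) = ((\<Sum>n<N. s n z) - w z) * f (\<phi> z)"
        by (simp add: F_def t_def left_diff_distrib sum_distrib_right)
      then have "cmod (F N z - w z * f (\<phi> z)) = cmod (w z - (\<Sum>n<N. s n z)) * cmod (f (\<phi> z))"
        by (simp add: norm_mult norm_minus_commute)
      also have "\<dots> \<le> (4 * (1/16) ^ N) * S"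
      proof (rule mult_mono)
        have "cmod (w z - (\<Sum>n<N. s n z)) \<le> 2 * (1 / (1 - cmod z)) * (1/16) ^ N" using z by (intro tail) simp
        also have "\<dots> \<le> 2 * 2 * (1/16) ^ N"
          using z by (intro mult_right_mono mult_left_mono) (auto simp: field_simps)
        finally show "cmod (w z - (\<Sum>n<N. s n z)) \<le> 4 * (1/16) ^ N" by simp
      qed (use S[of z] z in auto)
      finally show ?thesis by (simp add: mult_ac)
    qed
    show ?thesis
    proof (rule hardy_fatou(1)[where F = F and e = "\<lambda>N. 4 * S * (1/16) ^ N" and B = "R * nf * 2"])
      show "(\<lambda>z. w z * f (\<phi> z)) holomorphic_on unit_disc" by (rule holomorphic_on_mult[OF wh fph])
      show "F N \<in> hardy" "l2_norm (\<lambda>_. 1) (taylor_coeff (F N)) \<le> R * nf * 2" for N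
        using F[of N] B[of N] by auto
      show "0 \<le> R * nf * 2" using nf0 r2 by (simp add: R_def)
    qed (use le p16 in auto)
  qed
  \<comment> \<open>With \<open>f = 1\<close>, \<open>mem\<close> puts \<open>w\<close> itself into
    the Hardy space.\<close>
  have one: "(\<lambda>_. 1) \<in> hardy"
  proof -
    have "(\<lambda>k. (if k = 0 then 1 else 0) * z ^ k) sums (1::complex)" for z
    proof -
      have "(\<lambda>k. (if k = 0 then 1 else 0) * z ^ k) = (\<lambda>k. if k = 0 then z ^ k else 0)" by auto
      then show ?thesis using sums_single[of 0 "\<lambda>k. z ^ k"] by simp
    qed
    then have tc: "taylor_coeff (\<lambda>_. 1) = (\<lambda>k. if k = 0 then 1 else 0)" by (rule power_series_taylor(2))
    have "(\<lambda>k. 1 * (cmod (if k = 0 then 1 else 0))\<^sup>2) sums (\<Sum>k\<in>{0::nat}. 1 * (cmod (if k = 0 then 1 else 0))\<^sup>2)"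
      by (rule sums_finite) auto
    then show ?thesis unfolding H2_iff tc l2_def by (auto simp: sums_iff)
  qed
  have "w \<in> cond_multipliers hardy \<phi>"
    using mem mem[OF one] by (simp add: cond_multipliers_def)
  moreover have "w \<notin> H_infinity"
  proof
    assume "w \<in> H_infinity"
    then obtain B where "\<forall>v\<in>w ` unit_disc. cmod v \<le> B"
      unfolding H_infinity_def bounded_iff by blast
    then have B: "\<And>z. z \<in> unit_disc \<Longrightarrow> cmod (w z) \<le> B" by blast
    have "4 ^ m \<le> 3 * (B + 1)" for m
    proof -
      let ?z = "\<zeta> m"
      have self: "s m ?z = 4 ^ m"
      proof -
        have "1 - cnj ?z * ?z = of_real (q ?z)"
          using complex_norm_square[of ?z] by (simp add: q_def mult.commute)
        then show ?thesis using q0[of m] by (simp add: s_def)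
      qed
      \<comment> \<open>Each earlier term is at most \<open>2 * 4 ^ n\<close>, since
        \<open>q (\<zeta> n)\<close> is at most twice the distance of \<open>\<zeta> n\<close> from
        the circle.\<close>
      have head: "cmod (\<Sum>n<m. s n ?z) \<le> 2/3 * (4 ^ m - 1)"
      proof -
        have "cmod (\<Sum>n<m. s n ?z) \<le> (\<Sum>n<m. 2 * 4 ^ n)"
        proof (rule sum_norm_le)
          fix n
          have "q (\<zeta> n) = (1 + cmod (\<zeta> n)) * (1 - cmod (\<zeta> n))"
            by (simp add: q_def power2_eq_square algebra_simps)
          also have "\<dots> \<le> 2 * cmod (1 - cnj (\<zeta> n) * ?z)"
            using z1[of n] szego_kernel_bound(1)[OF z1[of n], of ?z] z1[of m]
            by (intro mult_mono) auto
          finally have "q (\<zeta> n) / cmod (1 - cnj (\<zeta> n) * ?z) \<le> 2"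
            using cnj_mult_neq_1[OF z1[of n] z1[of m]] by (simp add: divide_le_eq)
          then have "4 ^ n * (q (\<zeta> n) / cmod (1 - cnj (\<zeta> n) * ?z)) \<le> 4 ^ n * 2"
            by (rule mult_left_mono) simp
          then show "cmod (s n ?z) \<le> 2 * 4 ^ n" unfolding sn by simp
        qed
        also have "\<dots> = 2/3 * (4 ^ m - 1)"
          unfolding sum_distrib_left[symmetric] by (simp add: sum_gp_strict field_simps)
        finally show ?thesis .
      qed
      \<comment> \<open>The tail starts beyond \<open>m\<close>, where \<open>qsep\<close> cancels
        the small denominator \<open>1 - cmod (\<zeta> m)\<close>.\<close>
      have rest: "cmod (w ?z - (\<Sum>n<Suc m. s n ?z)) \<le> 1"
      proof -
        have "cmod (s n ?z) \<le> 1 * (1/16) ^ n" if "n \<ge> Suc m" for n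
        proof -
          have "cmod (s n ?z) \<le> 4 ^ n * ((1/64) ^ n * (1 - cmod ?z)) / (1 - cmod ?z)"
            unfolding sn using lowz[OF z1[of m], of n] qsep[of m n] q0[of n] z1[of m] that
            by (intro frac_le mult_left_mono) auto
          also have "\<dots> = 4 ^ n * (1/64) ^ n" using z1[of m] by simp
          finally show ?thesis unfolding four by simp
        qed
        from suminf_tail_bound[OF s_summable[OF z1[of m]] this]
        have "cmod (w ?z - (\<Sum>n<Suc m. s n ?z)) \<le> 2 * 1 * (1/16) ^ Suc m" unfolding w_def .
        also have "\<dots> \<le> 1" using power_le_one[of "1/16::real" m] by simp
        finally show ?thesis .
      qed
      have "(4::real) ^ m = cmod (s m ?z)" by (simp add: self norm_power)
      also have "s m ?z = w ?z - (w ?z - (\<Sum>n<Suc m. s n ?z)) - (\<Sum>n<m. s n ?z)" by simp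
      also have "cmod \<dots> \<le> cmod (w ?z) + cmod (w ?z - (\<Sum>n<Suc m. s n ?z)) + cmod (\<Sum>n<m. s n ?z)"
        by (intro order_trans[OF norm_triangle_ineq4] add_right_mono norm_triangle_ineq4)
      also have "\<dots> \<le> B + 1 + 2/3 * (4 ^ m - 1)"
        using B[of ?z] z1[of m] head rest by (intro add_mono) auto
      finally have "(4::real) ^ m \<le> B + 1 + 2/3 * (4 ^ m - 1)" .
      moreover have "x \<le> 3 * (B + 1)" if "x \<le> B + 1 + 2/3 * (x - 1)" for x using that by (simp add: field_simps)
      ultimately show ?thesis by blast
    qed
    moreover obtain m where "3 * (B + 1) < 4 ^ m" using real_arch_pow[of 4] by auto
    ultimately show False by (meson linorder_not_less)
  qed
  ultimately show thesis by (rule that)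
qed

text \<open>Elements of \<open>H2 \<beta>\<close> are bounded at \<open>z\<close> by a multiple of
  \<open>kernel_norm z\<close>, which makes \<open>cmod (w z) / kernel_norm z\<close> a suitable
  weight in \<open>weighted_evaluation_bounded\<close>. The comparison of kernels is available only
  near the circle; compactness covers the rest.\<close>

lemma (in disc_weight) cond_multipliers_blaschke_subset:
  assumes \<phi>: "\<phi> holomorphic_on unit_disc" "\<phi> ` unit_disc \<subseteq> unit_disc" and b: "finite_blaschke_product \<phi>"
    and adm: "admissible (H2 \<beta>) (H2_inner \<beta>)"
  shows "cond_multipliers (H2 \<beta>) \<phi> \<subseteq> H_infinity"
proof
  fix w assume w: "w \<in> cond_multipliers (H2 \<beta>) \<phi>"
  have \<phi>1: "cmod (\<phi> z) < 1" if "cmod z < 1" for z using \<phi>(2) that by (force simp: image_subset_iff)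
  have wh: "w holomorphic_on unit_disc" using w by (simp add: cond_multipliers_def H2_iff)
  obtain h r where h: "mono_on {0<..} h" "r < 1"
    "\<And>a b. r \<le> cmod a \<Longrightarrow> cmod a < 1 \<Longrightarrow> r \<le> cmod b \<Longrightarrow> cmod b < 1 \<Longrightarrow>
      inner_norm (H2_inner \<beta>) (repr_kernel (H2 \<beta>) (H2_inner \<beta>) a)
        / inner_norm (H2_inner \<beta>) (repr_kernel (H2 \<beta>) (H2_inner \<beta>) b)
      \<le> h ((1 - cmod b) / (1 - cmod a))"
    using adm unfolding admissible_def by blast
  obtain M where M: "M > 0" "\<And>z. z \<in> unit_disc \<Longrightarrow> 1 - cmod (\<phi> z) \<le> M * (1 - cmod z)"
    by (rule finite_blaschke_product_bound[OF b]) (rule that; assumption)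
  have "\<exists>B. \<forall>z\<in>unit_disc. cmod (w z) / kernel_norm z * cmod (f (\<phi> z)) \<le> B" if "f \<in> H2 \<beta>" for f
  proof -
    have g: "(\<lambda>z. w z * f (\<phi> z)) \<in> H2 \<beta>" using w that by (simp add: cond_multipliers_def)
    then have l: "taylor_coeff (\<lambda>z. w z * f (\<phi> z)) \<in> l2 \<beta>" by (simp add: H2_iff)
    have "cmod (w z) / kernel_norm z * cmod (f (\<phi> z)) \<le> l2_norm \<beta> (taylor_coeff (\<lambda>z. w z * f (\<phi> z)))"
      if "z \<in> unit_disc" for z
    proof -
      have z: "cmod z < 1" using that by simp
      show ?thesis
        using evaluation_bound[OF l z] kernel_norm_pos[OF z]
        unfolding power_series_taylor_coeff[OF g z] by (simp add: norm_mult field_simps)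
    qed
    then show ?thesis by blast
  qed
  from weighted_evaluation_bounded[OF \<phi>(2) _ this]
  obtain C where C: "\<forall>z\<in>unit_disc. cmod (w z) / kernel_norm z * kernel_norm (\<phi> z) \<le> C"
    using kernel_norm_pos by (force simp: less_imp_le)
  \<comment> \<open>Chosen so that \<open>\<rho> \<le> cmod z\<close> forces
    \<open>r \<le> cmod (\<phi> z)\<close>, via
    \<open>1 - cmod (\<phi> z) \<le> M * (1 - cmod z)\<close>; both points then lie in the range of
    the kernel comparison.\<close>
  define \<rho> where "\<rho> = max 0 (max r (1 - (1 - r) / M))"
  have \<rho>: "0 \<le> \<rho>" "\<rho> < 1" "r \<le> \<rho>" "M * (1 - \<rho>) \<le> 1 - r"
  proof -
    show "0 \<le> \<rho>" "\<rho> < 1" "r \<le> \<rho>" using h(2) M(1) by (auto simp: \<rho>_def)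
    have "1 - (1 - r) / M \<le> \<rho>" by (simp add: \<rho>_def)
    then show "M * (1 - \<rho>) \<le> 1 - r" using M(1) by (simp add: field_simps)
  qed
  have C0: "0 \<le> C"
  proof -
    have "0 \<le> cmod (w 0) / kernel_norm 0 * kernel_norm (\<phi> 0)"
      using kernel_norm_pos[of 0] kernel_norm_pos[OF \<phi>1[of 0]] by simp
    then show ?thesis using C by (meson centre_in_ball order_trans zero_less_one)
  qed
  have outer: "cmod (w z) \<le> C * h M" if z: "\<rho> \<le> cmod z" "cmod z < 1" for z
  proof -
    have zd: "z \<in> unit_disc" using z by simp
    have "M * (1 - cmod z) \<le> M * (1 - \<rho>)" using M(1) z by (intro mult_left_mono) auto
    then have rp: "r \<le> cmod (\<phi> z)" using M(2)[OF zd] \<rho> by linarith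
    have pos: "kernel_norm z > 0" "kernel_norm (\<phi> z) > 0"
      using kernel_norm_pos[OF z(2)] kernel_norm_pos[OF \<phi>1[OF z(2)]] by auto
    have "kernel_norm z / kernel_norm (\<phi> z) \<le> h ((1 - cmod (\<phi> z)) / (1 - cmod z))"
      using h(3)[OF _ z(2) rp \<phi>1[OF z(2)]] z \<rho>
      by (simp add: norm_repr_kernel[OF adm z(2)] norm_repr_kernel[OF adm \<phi>1[OF z(2)]])
    also have "\<dots> \<le> h M"
    proof (rule mono_onD[OF h(1)])
      show "(1 - cmod (\<phi> z)) / (1 - cmod z) \<le> M" using M(2)[OF zd] z by (simp add: divide_le_eq)
    qed (use \<phi>1[OF z(2)] z M(1) in auto)
    finally have hM: "kernel_norm z / kernel_norm (\<phi> z) \<le> h M" .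
    have "cmod (w z) \<le> C * (kernel_norm z / kernel_norm (\<phi> z))"
      using bspec[OF C zd] pos by (simp add: field_simps)
    also have "\<dots> \<le> C * h M" by (rule mult_left_mono[OF hM C0])
    finally show ?thesis .
  qed
  have "continuous_on (cball 0 \<rho>) w"
    using holomorphic_on_imp_continuous_on[OF wh] by (rule continuous_on_subset) (use \<rho> in auto)
  then have "bounded (w ` cball 0 \<rho>)"
    by (intro compact_imp_bounded compact_continuous_image compact_cball)
  then obtain D where "\<forall>v\<in>w ` cball 0 \<rho>. cmod v \<le> D" unfolding bounded_iff by blast
  then have D: "\<And>z. cmod z \<le> \<rho> \<Longrightarrow> cmod (w z) \<le> D" by simp
  have "cmod (w z) \<le> max D (C * h M)" if "z \<in> unit_disc" for z
    using outer[of z] D[of z] that by (cases "cmod z \<le> \<rho>") auto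
  then have "bounded (w ` unit_disc)" unfolding bounded_iff by blast
  then show "w \<in> H_infinity" using wh by (simp add: H_infinity_def)
qed

text \<open>The unbounded multiplier is built in the Hardy space, where the norms are explicit, and
  reaches \<open>H2 \<beta>\<close> through \<open>cond_multipliers_hardy_subset\<close>. For the
  converse, \<open>H_infinity\<close> is included because \<open>f \<circ> \<phi>\<close> stays in
  \<open>H2 \<beta>\<close>; the Blaschke form enters through the opposite inclusion.\<close>

theorem (in disc_weight) cond_multipliers_eq_H_infinity_iff:
  assumes \<phi>: "\<phi> holomorphic_on unit_disc" "\<phi> ` unit_disc \<subseteq> unit_disc"
    and adm: "admissible (H2 \<beta>) (H2_inner \<beta>)"
    and comp: "\<And>f. f \<in> H2 \<beta> \<Longrightarrow> f \<circ> \<phi> \<in> H2 \<beta>"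
  shows "cond_multipliers (H2 \<beta>) \<phi> = H_infinity \<longleftrightarrow> finite_blaschke_product \<phi>"
proof
  assume eq: "cond_multipliers (H2 \<beta>) \<phi> = H_infinity"
  show "finite_blaschke_product \<phi>"
  proof (rule ccontr)
    assume "\<not> finite_blaschke_product \<phi>"
    then obtain w where "w \<in> cond_multipliers hardy \<phi>" "w \<notin> H_infinity"
      by (rule exists_unbounded_cond_multiplier[OF \<phi>])
    then show False using cond_multipliers_hardy_subset[OF \<phi> adm] eq by blast
  qed
next
  assume b: "finite_blaschke_product \<phi>"
  have mult: "multipliers (H2 \<beta>) = H_infinity" using adm by (simp add: admissible_def)
  have "H_infinity \<subseteq> cond_multipliers (H2 \<beta>) \<phi>"
  proof
    fix w assume "w \<in> H_infinity"
    then have w: "w \<in> multipliers (H2 \<beta>)" by (simp add: mult)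
    have "(\<lambda>z. w z * f (\<phi> z)) \<in> H2 \<beta>" if "f \<in> H2 \<beta>" for f
      using w comp[OF that] by (auto simp: multipliers_def o_def)
    then show "w \<in> cond_multipliers (H2 \<beta>) \<phi>" using w by (simp add: multipliers_def cond_multipliers_def)
  qed
  with cond_multipliers_blaschke_subset[OF \<phi> b adm]
  show "cond_multipliers (H2 \<beta>) \<phi> = H_infinity" by blast
qed

theorem theorem3p18:
  fixes \<phi> :: "complex \<Rightarrow> complex" and \<beta> :: "nat \<Rightarrow> real"
  assumes "\<phi> holomorphic_on unit_disc" and "\<phi> ` unit_disc \<subseteq> unit_disc"
    and "\<And>k. \<beta> k > 0"
    and "liminf (\<lambda>k. ereal (\<beta> k powr (1 / real k))) \<ge> 1"
    and "admissible (H2 \<beta>) (H2_inner \<beta>)"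
    and "bounded_composition_operator (H2 \<beta>) (H2_inner \<beta>) \<phi>"
  shows "cond_multipliers hardy \<phi> \<subseteq> cond_multipliers (H2 \<beta>) \<phi> \<and>
    (cond_multipliers (H2 \<beta>) \<phi> = H2 \<beta> \<longleftrightarrow> sup_norm \<phi> < 1) \<and>
    (cond_multipliers (H2 \<beta>) \<phi> = H_infinity \<longleftrightarrow> finite_blaschke_product \<phi>)"
proof -
  interpret disc_weight \<beta> by (rule disc_weight_liminf[OF assms(3,4)])
  have comp: "\<And>f. f \<in> H2 \<beta> \<Longrightarrow> f \<circ> \<phi> \<in> H2 \<beta>"
    using assms(6) unfolding bounded_composition_operator_def by blast
  have "hardy \<subseteq> H2 \<beta>" "multipliers (H2 \<beta>) = H_infinity" using assms(5) unfolding admissible_def by blast+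
  from cond_multipliers_hardy_subset[OF assms(1,2,5)]
    cond_multipliers_eq_space_iff[OF assms(1,2) this comp]
    cond_multipliers_eq_H_infinity_iff[OF assms(1,2,5) comp]
  show ?thesis by blast
qed

end
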